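(* Let $L>0$, $a>0$. The reconstruction map sending a coefficient family $(a_{m,n})_{m\in\mathbb Z^2,n\ge1}\subset\mathbb C^2$, $(b_{m,n})_{m\in\mathbb Z^2,n\ge0}\subset\mathbb C$ to the field $E=(E_\parallel,E_z)$, $E_\parallel=(E_x,E_y)$, $$E_\parallel(r,z)=\sum_{m\in\mathbb Z^2}\sum_{n\ge1}a_{m,n}\phi_m(r)s_n(z),\qquad E_z(r,z)=\sum_{m\in\mathbb Z^2}\sum_{n\ge0}b_{m,n}\phi_m(r)c_n(z),$$ identifies $\mathfrak C_{\mathrm{PEC}}$ (bijectively) with the form domain $\mathcal V_{\mathrm{PEC}}$. Under this identification, $$\|\nabla\times E\|_{L^2}^2=\sum_{m\in\mathbb Z^2}\sum_{n\ge1}\lambda_{m,n}\bigl(|a_{m,n}|^2+|b_{m,n}|^2\bigr)+\sum_{m\in\mathbb Z^2}|k_m|^2|b_{m,0}|^2 .$$ Consequently, $\mathfrak C_{\mathrm{phys}}$ is identified with $\mathcal V_{\mathrm{phys}}=\mathcal V_{\mathrm{PEC}}\cap\mathcal H_{\mathrm{phys}}$.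
   Context: Slab and spaces. $T_L^2=(\mathbb R/L\mathbb Z)^2$, $\Omega_{L,a}=T_L^2\times[0,a]$ with coordinates $(r,z)$, $r=(x,y)$; there are boundary faces only at $z=0$ and $z=a$. All function spaces are complex. $H(\operatorname{curl})=\{E\in L^2(\Omega_{L,a};\mathbb C^3):\nabla\times E\in L^2\}$ with norm$^2$ $\|E\|_{L^2}^2+\|\nabla\times E\|_{L^2}^2$. $H_0(\operatorname{curl})$ is the closure in this norm of the smooth (up to the plates), laterally periodic vector fields with $E_x=E_y=0$ at $z=0,a$. Put $\mathcal V_{\mathrm{PEC}}=\{E\in H_0(\operatorname{curl}):\nabla\cdot E=0$ in distributions on $T_L^2\times(0,a)\}$, $\mathcal H_{\mathrm{PEC}}=$ the $L^2$-closure of $\mathcal V_{\mathrm{PEC}}$, $h_0=(L^2a)^{-1/2}e_z$, $\mathcal H_{\mathrm{phys}}=\mathcal H_{\mathrm{PEC}}\ominus\operatorname{span}\{h_0\}$. Fourier notation. $k_m=\frac{2\pi}{L}m$ ($m\in\mathbb Z^2$), $\nu_n=\frac{\pi n}{a}$ ($n\ge0$), $\lambda_{m,n}=|k_m|^2+\nu_n^2$ ($n\ge1$), $\phi_m(r)=L^{-1}e^{ik_m\cdot r}$, $s_n(z)=\sqrt{2/a}\,\sin(\nu_nz)$ ($n\ge1$), $c_0(z)=a^{-1/2}$, $c_n(z)=\sqrt{2/a}\,\cos(\nu_nz)$ ($n\ge1$). Coefficient spaces. $\mathfrak C_{\mathrm{PEC}}$ is the space of coefficient families $(a,b)$ with $$\sum_{m\in\mathbb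 Z^2}\sum_{n\ge1}(1+\lambda_{m,n})\bigl(|a_{m,n}|^2+|b_{m,n}|^2\bigr)+\sum_{m\in\mathbb Z^2}(1+|k_m|^2)|b_{m,0}|^2<\infty$$ and $i\,k_m\cdot a_{m,n}-\nu_nb_{m,n}=0$ for all $m\in\mathbb Z^2$, $n\ge1$ (here $k\cdot a=k_1a_1+k_2a_2$, bilinear). $\mathfrak C_{\mathrm{phys}}=\{(a,b)\in\mathfrak C_{\mathrm{PEC}}:b_{0,0}=0\}$. *)

theory Defs
  imports "HOL-Analysis.Analysis"
begin

section \<open>The slab and its \<open>L\<^sup>2\<close> spaces\<close>

text \<open>
  A point of the slab is \<open>(x, y, z)\<close>. The torus \<open>(\<real>/L\<int>)\<^sup>2\<close> is represented by its fundamental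
  cell, so a field on the slab is a function on \<open>\<real>\<^sup>3\<close> of which only the values in
  \<open>[0,L]\<^sup>2 \<times> [0,a]\<close> count, up to null sets. Lateral periodicity is a condition on smooth
  functions only, where it is imposed on all of \<open>\<real>\<^sup>2\<close>.
\<close>

type_synonym point = "real \<times> real \<times> real"

definition slab_measure :: "real \<Rightarrow> real \<Rightarrow> point measure" where
  "slab_measure L a = restrict_space lborel ({0..L} \<times> {0..L} \<times> {0..a})"

definition L2 :: "real \<Rightarrow> real \<Rightarrow> (point \<Rightarrow> 'b::euclidean_space) set" where
  "L2 L a = {f \<in> borel_measurable (slab_measure L a).
               integrable (slab_measure L a) (\<lambda>p. (norm (f p))\<^sup>2)}"

definition l2norm :: "real \<Rightarrow> real \<Rightarrow> (point \<Rightarrow> 'b::euclidean_space) \<Rightarrow> real" where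
  "l2norm L a f = sqrt (\<integral>p. (norm (f p))\<^sup>2 \<partial>slab_measure L a)"

definition l2inner :: "real \<Rightarrow> real \<Rightarrow> (point \<Rightarrow> complex^3) \<Rightarrow> (point \<Rightarrow> complex^3) \<Rightarrow> complex" where
  "l2inner L a E F = (\<integral>p. (\<Sum>j\<in>UNIV. E p $ j * cnj (F p $ j)) \<partial>slab_measure L a)"

text \<open>
  Elements of the function spaces below are representatives; the actual elements are the classes
  of this equivalence relation.
\<close>

definition ae_eq :: "real \<Rightarrow> real \<Rightarrow> ((point \<Rightarrow> complex^3) \<times> (point \<Rightarrow> complex^3)) set" where
  "ae_eq L a = {(E, F). E \<in> L2 L a \<and> F \<in> L2 L a \<and> (AE p in slab_measure L a. E p = F p)}"


section \<open>Smooth functions and distributional derivatives\<close>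

text \<open>
  One-sided derivatives are taken at the boundary of \<open>S\<close>. The sets used are the whole space and
  the closed slab \<open>\<real>\<^sup>2 \<times> [0,a]\<close>, on which derivatives within \<open>S\<close> are unique.
\<close>

primrec Ck_on :: "nat \<Rightarrow> point set \<Rightarrow> (point \<Rightarrow> 'b::euclidean_space) \<Rightarrow> bool" where
  "Ck_on 0 S f \<longleftrightarrow> continuous_on S f"
| "Ck_on (Suc k) S f \<longleftrightarrow>
     (\<exists>D. (\<forall>p\<in>S. (f has_derivative (\<lambda>h. D h p)) (at p within S)) \<and> (\<forall>h. Ck_on k S (D h)))"

definition smooth_on :: "point set \<Rightarrow> (point \<Rightarrow> 'b::euclidean_space) \<Rightarrow> bool" where
  "smooth_on S f \<longleftrightarrow> (\<forall>k. Ck_on k S f)"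

definition lat_periodic :: "real \<Rightarrow> real set \<Rightarrow> (point \<Rightarrow> 'b) \<Rightarrow> bool" where
  "lat_periodic L Z f \<longleftrightarrow>
     (\<forall>x y. \<forall>z\<in>Z. f (x + L, y, z) = f (x, y, z) \<and> f (x, y + L, z) = f (x, y, z))"

text \<open>
  Test functions on \<open>T\<^sub>L\<^sup>2 \<times> (0,a)\<close>, extended by zero to all real \<open>z\<close>. The torus being compact,
  compact support only restricts \<open>z\<close>.
\<close>

definition test_function :: "real \<Rightarrow> real \<Rightarrow> (point \<Rightarrow> 'b::euclidean_space) \<Rightarrow> bool" where
  "test_function L a f \<longleftrightarrow> smooth_on UNIV f \<and> lat_periodic L UNIV f \<and>
     (\<exists>\<delta>>0. \<forall>x y z. z < \<delta> \<or> a - \<delta> < z \<longrightarrow> f (x, y, z) = 0)"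

definition partial :: "point \<Rightarrow> (point \<Rightarrow> complex) \<Rightarrow> point \<Rightarrow> complex" where
  "partial e f p = frechet_derivative f (at p) e"

abbreviation "dx \<equiv> partial (1, 0, 0)"
abbreviation "dy \<equiv> partial (0, 1, 0)"
abbreviation "dz \<equiv> partial (0, 0, 1)"

definition grad :: "(point \<Rightarrow> complex) \<Rightarrow> point \<Rightarrow> complex^3" where
  "grad f p = vector [dx f p, dy f p, dz f p]"

definition curl :: "(point \<Rightarrow> complex^3) \<Rightarrow> point \<Rightarrow> complex^3" where
  "curl \<Phi> p = vector
     [dy (\<lambda>q. \<Phi> q $ 3) p - dz (\<lambda>q. \<Phi> q $ 2) p,
      dz (\<lambda>q. \<Phi> q $ 1) p - dx (\<lambda>q. \<Phi> q $ 3) p,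
      dx (\<lambda>q. \<Phi> q $ 2) p - dy (\<lambda>q. \<Phi> q $ 1) p]"

definition bdot :: "complex^3 \<Rightarrow> complex^3 \<Rightarrow> complex" where
  "bdot u v = (\<Sum>j\<in>UNIV. u $ j * v $ j)"

definition weak_curl ::
    "real \<Rightarrow> real \<Rightarrow> (point \<Rightarrow> complex^3) \<Rightarrow> (point \<Rightarrow> complex^3) \<Rightarrow> bool" where
  "weak_curl L a E F \<longleftrightarrow> (\<forall>\<Phi>. test_function L a \<Phi> \<longrightarrow>
     (\<integral>p. bdot (E p) (curl \<Phi> p) \<partial>slab_measure L a) = (\<integral>p. bdot (F p) (\<Phi> p) \<partial>slab_measure L a))"

definition weak_div_free :: "real \<Rightarrow> real \<Rightarrow> (point \<Rightarrow> complex^3) \<Rightarrow> bool" where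
  "weak_div_free L a E \<longleftrightarrow> (\<forall>\<phi>. test_function L a \<phi> \<longrightarrow>
     (\<integral>p. bdot (E p) (grad \<phi> p) \<partial>slab_measure L a) = 0)"


section \<open>The Maxwell spaces\<close>

definition H_curl :: "real \<Rightarrow> real \<Rightarrow> (point \<Rightarrow> complex^3) set" where
  "H_curl L a = {E \<in> L2 L a. \<exists>F\<in>L2 L a. weak_curl L a E F}"

text \<open>A representative of the distributional curl of a field in \<^const>\<open>H_curl\<close>.\<close>

definition wcurl :: "real \<Rightarrow> real \<Rightarrow> (point \<Rightarrow> complex^3) \<Rightarrow> point \<Rightarrow> complex^3" where
  "wcurl L a E = (SOME F. F \<in> L2 L a \<and> weak_curl L a E F)"

definition hcurl_norm :: "real \<Rightarrow> real \<Rightarrow> (point \<Rightarrow> complex^3) \<Rightarrow> real" where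
  "hcurl_norm L a E = sqrt ((l2norm L a E)\<^sup>2 + (l2norm L a (wcurl L a E))\<^sup>2)"

definition smooth_PEC :: "real \<Rightarrow> real \<Rightarrow> (point \<Rightarrow> complex^3) set" where
  "smooth_PEC L a = {G. smooth_on (UNIV \<times> UNIV \<times> {0..a}) G \<and> lat_periodic L {0..a} G \<and>
     (\<forall>x y. \<forall>z\<in>{0, a}. G (x, y, z) $ 1 = 0 \<and> G (x, y, z) $ 2 = 0)}"

definition H0_curl :: "real \<Rightarrow> real \<Rightarrow> (point \<Rightarrow> complex^3) set" where
  "H0_curl L a = {E \<in> H_curl L a.
     \<forall>\<epsilon>>0. \<exists>G\<in>smooth_PEC L a. hcurl_norm L a (\<lambda>p. E p - G p) < \<epsilon>}"

definition V_PEC :: "real \<Rightarrow> real \<Rightarrow> (point \<Rightarrow> complex^3) set" where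
  "V_PEC L a = {E \<in> H0_curl L a. weak_div_free L a E}"

definition H_PEC :: "real \<Rightarrow> real \<Rightarrow> (point \<Rightarrow> complex^3) set" where
  "H_PEC L a = {E \<in> L2 L a. \<forall>\<epsilon>>0. \<exists>G\<in>V_PEC L a. l2norm L a (\<lambda>p. E p - G p) < \<epsilon>}"

definition h0 :: "real \<Rightarrow> real \<Rightarrow> point \<Rightarrow> complex^3" where
  "h0 L a p = vector [0, 0, complex_of_real (1 / sqrt (L\<^sup>2 * a))]"

definition H_phys :: "real \<Rightarrow> real \<Rightarrow> (point \<Rightarrow> complex^3) set" where
  "H_phys L a = {E \<in> H_PEC L a. \<forall>c. l2inner L a E (\<lambda>p. c *s h0 L a p) = 0}"

definition V_phys :: "real \<Rightarrow> real \<Rightarrow> (point \<Rightarrow> complex^3) set" where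
  "V_phys L a = V_PEC L a \<inter> H_phys L a"


section \<open>Fourier modes and coefficient spaces\<close>

definition kvec :: "real \<Rightarrow> int \<times> int \<Rightarrow> real \<times> real" where
  "kvec L m = (2 * pi / L * real_of_int (fst m), 2 * pi / L * real_of_int (snd m))"

definition nu :: "real \<Rightarrow> nat \<Rightarrow> real" where
  "nu a n = pi * real n / a"

definition lam :: "real \<Rightarrow> real \<Rightarrow> int \<times> int \<Rightarrow> nat \<Rightarrow> real" where
  "lam L a m n = (norm (kvec L m))\<^sup>2 + (nu a n)\<^sup>2"

definition phi :: "real \<Rightarrow> int \<times> int \<Rightarrow> real \<times> real \<Rightarrow> complex" where
  "phi L m r = exp (\<i> * complex_of_real (kvec L m \<bullet> r)) / complex_of_real L"

definition smode :: "real \<Rightarrow> nat \<Rightarrow> real \<Rightarrow> real" where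
  "smode a n z = sqrt (2 / a) * sin (nu a n * z)"

definition cmode :: "real \<Rightarrow> nat \<Rightarrow> real \<Rightarrow> real" where
  "cmode a n z = (if n = 0 then 1 / sqrt a else sqrt (2 / a) * cos (nu a n * z))"

type_synonym coeffs = "(int \<times> int \<Rightarrow> nat \<Rightarrow> complex^2) \<times> (int \<times> int \<Rightarrow> nat \<Rightarrow> complex)"

text \<open>
  The first family is indexed by \<open>n \<ge> 1\<close> only; its unused entries at \<open>n = 0\<close> are fixed to be zero,
  so that distinct members of the set are distinct families.
\<close>

definition C_PEC :: "real \<Rightarrow> real \<Rightarrow> coeffs set" where
  "C_PEC L a = {(\<alpha>, \<beta>).
     (\<forall>m. \<alpha> m 0 = 0) \<and>
     (\<lambda>(m, n). (1 + lam L a m n) * ((norm (\<alpha> m n))\<^sup>2 + (norm (\<beta> m n))\<^sup>2))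
        summable_on (UNIV \<times> {1..}) \<and>
     (\<lambda>m. (1 + (norm (kvec L m))\<^sup>2) * (norm (\<beta> m 0))\<^sup>2) summable_on UNIV \<and>
     (\<forall>m. \<forall>n\<ge>1.
        \<i> * (complex_of_real (fst (kvec L m)) * \<alpha> m n $ 1
             + complex_of_real (snd (kvec L m)) * \<alpha> m n $ 2)
        - complex_of_real (nu a n) * \<beta> m n = 0)}"

definition C_phys :: "real \<Rightarrow> real \<Rightarrow> coeffs set" where
  "C_phys L a = {(\<alpha>, \<beta>) \<in> C_PEC L a. \<beta> (0, 0) 0 = 0}"

definition E_par :: "(point \<Rightarrow> complex^3) \<Rightarrow> point \<Rightarrow> complex^2" where
  "E_par E p = vector [E p $ 1, E p $ 2]"

text \<open>
  The class of all fields to which the two Fourier series converge unconditionally in \<open>L\<^sup>2\<close>; it is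
  empty if one of them diverges.
\<close>

definition recon :: "real \<Rightarrow> real \<Rightarrow> coeffs \<Rightarrow> (point \<Rightarrow> complex^3) set" where
  "recon L a = (\<lambda>(\<alpha>, \<beta>). {E \<in> L2 L a.
     ((\<lambda>S. l2norm L a (\<lambda>(x, y, z). E_par E (x, y, z)
             - (\<Sum>(m, n)\<in>S. (phi L m (x, y) * complex_of_real (smode a n z)) *s \<alpha> m n)))
        \<longlongrightarrow> 0) (finite_subsets_at_top (UNIV \<times> {1..})) \<and>
     ((\<lambda>S. l2norm L a (\<lambda>(x, y, z). E (x, y, z) $ 3
             - (\<Sum>(m, n)\<in>S. \<beta> m n * phi L m (x, y) * complex_of_real (cmode a n z))))
        \<longlongrightarrow> 0) (finite_subsets_at_top UNIV)})"

end

theory Submission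
  imports Defs
begin

text \<open>
  The families \<open>\<phi>\<^sub>m s\<^sub>n\<close> (\<open>n \<ge> 1\<close>) and \<open>\<phi>\<^sub>m c\<^sub>n\<close> (\<open>n \<ge> 0\<close>) are orthonormal bases of \<open>L\<^sup>2\<close> of the slab, so by
  Riesz-Fischer a field is the same as its coefficients. The curl maps the sine/sine/cosine
  expansion of a field to a cosine/cosine/sine expansion with symbol \<open>K \<times> e\<close>, and the divergence
  constraint \<open>K \<cdot> e = 0\<close> turns \<open>\<bar>K \<times> e\<bar>\<^sup>2\<close> into \<open>\<bar>K\<bar>\<^sup>2\<bar>e\<bar>\<^sup>2\<close>. Parseval then gives the norm identity.

  A family in the coefficient space is reached by its partial sums, which are smooth, divergence
  free and have vanishing tangential components on the plates. Conversely, for a field in the form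
  domain the coefficients of the curl are found by testing against modes. These are not compactly
  supported in \<open>z\<close>: for the curl the boundary terms vanish because the field is a limit of smooth
  fields with vanishing tangential components, and for the divergence the mode \<open>\<phi>\<^sub>m s\<^sub>n\<close>
  vanishes on the plates and is cut off near them.
\<close>

section \<open>Square-integrable functions\<close>

text \<open>The space \<open>H0_curl\<close> is a closure and its members have no pointwise traces,
  so the boundary condition is felt only through integration by parts: \<open>H0_curl_test\<close>
  lets such a field be paired with the curl of any periodic C1 field, whatever its values on the
  plates. Cosine modes in the tangential directions then yield the curl coefficients. The divergence
  carries no boundary condition, so its test functions must vanish near the plates. The cutoff costs
  a derivative of size 1/\<delta>, which only a factor vanishing linearly there can absorb. Sine
  modes do, and they are exactly the modes that give the constraints with n at least 1; the entries
  \<open>\<beta> m 0\<close> stay free.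

  Since \<open>wcurl\<close> is a choice among representatives, its norm is meaningful only after
  uniqueness almost everywhere. Completeness of the modes is obtained measure-theoretically:
  products of modes are sums of modes, a lateral coordinate is recovered from the cosine and the
  sign of the sine of its angle, and the height from a single cosine.\<close>

definition square_integrable :: "'a measure \<Rightarrow> ('a \<Rightarrow> 'b::euclidean_space) set" where
  "square_integrable M = {f \<in> borel_measurable M. integrable M (\<lambda>x. (norm (f x))\<^sup>2)}"

definition norm2 :: "'a measure \<Rightarrow> ('a \<Rightarrow> 'b::euclidean_space) \<Rightarrow> real" where
  "norm2 M f = sqrt (\<integral>x. (norm (f x))\<^sup>2 \<partial>M)"

definition inner2 :: "'a measure \<Rightarrow> ('a \<Rightarrow> complex) \<Rightarrow> ('a \<Rightarrow> complex) \<Rightarrow> complex" where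
  "inner2 M f g = (\<integral>x. f x * cnj (g x) \<partial>M)"

lemma square_integrable_measurable: "f \<in> square_integrable M \<Longrightarrow> f \<in> borel_measurable M"
  by (simp add: square_integrable_def)

lemma square_integrable_norm: "f \<in> square_integrable M \<Longrightarrow> integrable M (\<lambda>x. (norm (f x))\<^sup>2)"
  by (simp add: square_integrable_def)

lemma square_integrable_bound:
  fixes g :: "'a \<Rightarrow> 'b::euclidean_space" and f :: "'a \<Rightarrow> 'c::euclidean_space"
  assumes "g \<in> square_integrable M" "f \<in> borel_measurable M"
    and "\<And>x. x \<in> space M \<Longrightarrow> norm (f x) \<le> C * norm (g x)"
  shows "f \<in> square_integrable M"
proof -
  have "integrable M (\<lambda>x. (norm (f x))\<^sup>2)"
  proof (rule Bochner_Integration.integrable_bound)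
    show "integrable M (\<lambda>x. C\<^sup>2 * (norm (g x))\<^sup>2)"
      using assms(1) by (simp add: square_integrable_norm)
    show "(\<lambda>x. (norm (f x))\<^sup>2) \<in> borel_measurable M" using assms(2) by simp
    show "AE x in M. norm ((norm (f x))\<^sup>2) \<le> norm (C\<^sup>2 * (norm (g x))\<^sup>2)"
      using assms(3) power_mono[of "norm (f _)" "C * norm (g _)" 2]
      by (intro AE_I2) (simp add: power_mult_distrib)
  qed
  with assms(2) show ?thesis by (simp add: square_integrable_def)
qed

lemma square_integrable_zero [simp]: "(\<lambda>x. 0) \<in> square_integrable M"
  by (simp add: square_integrable_def)

lemma square_integrable_add:
  assumes "f \<in> square_integrable M" "g \<in> square_integrable M"
  shows "(\<lambda>x. f x + g x) \<in> square_integrable M"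
proof -
  note [measurable] = assms[THEN square_integrable_measurable]
  have "integrable M (\<lambda>x. (norm (f x + g x))\<^sup>2)"
  proof (rule Bochner_Integration.integrable_bound)
    show "integrable M (\<lambda>x. 2 * (norm (f x))\<^sup>2 + 2 * (norm (g x))\<^sup>2)"
      using assms by (simp add: square_integrable_norm)
    show "AE x in M. norm ((norm (f x + g x))\<^sup>2) \<le> norm (2 * (norm (f x))\<^sup>2 + 2 * (norm (g x))\<^sup>2)"
    proof (intro AE_I2)
      fix x
      have "(norm (f x + g x))\<^sup>2 \<le> (norm (f x) + norm (g x))\<^sup>2"
        by (intro power_mono norm_triangle_ineq) simp
      also have "\<dots> \<le> 2 * (norm (f x))\<^sup>2 + 2 * (norm (g x))\<^sup>2"
        using sum_squares_bound[of "norm (f x)" "norm (g x)"] by (simp add: power2_sum)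
      finally show "norm ((norm (f x + g x))\<^sup>2) \<le> norm (2 * (norm (f x))\<^sup>2 + 2 * (norm (g x))\<^sup>2)"
        by simp
    qed
  qed simp
  then show ?thesis by (simp add: square_integrable_def)
qed

lemma square_integrable_uminus:
  "f \<in> square_integrable M \<Longrightarrow> (\<lambda>x. - f x) \<in> square_integrable M"
  by (simp add: square_integrable_def)

lemma square_integrable_diff:
  "f \<in> square_integrable M \<Longrightarrow> g \<in> square_integrable M \<Longrightarrow> (\<lambda>x. f x - g x) \<in> square_integrable M"
  using square_integrable_add[OF _ square_integrable_uminus, of f M g] by simp

lemma square_integrable_cmult:
  fixes c :: complex
  shows "f \<in> square_integrable M \<Longrightarrow> (\<lambda>x. c * f x) \<in> square_integrable M"
  by (rule square_integrable_bound[where g = f and C = "norm c"])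
     (auto simp: norm_mult dest: square_integrable_measurable)

lemma square_integrable_sum:
  "(\<And>i. i \<in> S \<Longrightarrow> f i \<in> square_integrable M) \<Longrightarrow> (\<lambda>x. \<Sum>i\<in>S. f i x) \<in> square_integrable M"
  by (induction S rule: infinite_finite_induct) (auto intro: square_integrable_add)

lemma square_integrable_mult_norm:
  fixes f :: "'a \<Rightarrow> 'b::euclidean_space" and g :: "'a \<Rightarrow> 'c::euclidean_space"
  assumes "f \<in> square_integrable M" "g \<in> square_integrable M"
  shows "integrable M (\<lambda>x. norm (f x) * norm (g x))"
proof (rule Bochner_Integration.integrable_bound)
  note [measurable] = assms[THEN square_integrable_measurable]
  show "integrable M (\<lambda>x. (norm (f x))\<^sup>2 + (norm (g x))\<^sup>2)"
    using assms by (simp add: square_integrable_norm)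
  show "(\<lambda>x. norm (f x) * norm (g x)) \<in> borel_measurable M" by simp
  have "norm (f x) * norm (g x) \<le> (norm (f x))\<^sup>2 + (norm (g x))\<^sup>2" for x
    using sum_squares_bound[of "norm (f x)" "norm (g x)"]
      mult_nonneg_nonneg[OF norm_ge_zero[of "f x"] norm_ge_zero[of "g x"]] by linarith
  then show "AE x in M. norm (norm (f x) * norm (g x)) \<le> norm ((norm (f x))\<^sup>2 + (norm (g x))\<^sup>2)"
    by (intro AE_I2) simp
qed

section \<open>Cauchy-Schwarz and the triangle inequality\<close>

lemma norm2_nonneg [simp]: "0 \<le> norm2 M f"
  by (simp add: norm2_def)

lemma norm2_sq: "(norm2 M f)\<^sup>2 = (\<integral>x. (norm (f x))\<^sup>2 \<partial>M)"
  by (simp add: norm2_def)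

lemma norm2_minus_commute: "norm2 M (\<lambda>x. f x - g x) = norm2 M (\<lambda>x. g x - f x)"
  by (simp add: norm2_def norm_minus_commute)

text \<open>Cauchy-Schwarz by the discriminant argument: the integral of
  \<open>(t * norm (f x) - norm (g x))\<^sup>2\<close> is nonnegative for every real
  \<open>t\<close>, and the best \<open>t\<close> gives the bound.\<close>

lemma integral_mult_norm_le:
  fixes f :: "'a \<Rightarrow> 'b::euclidean_space" and g :: "'a \<Rightarrow> 'c::euclidean_space"
  assumes "f \<in> square_integrable M" "g \<in> square_integrable M"
  shows "(\<integral>x. norm (f x) * norm (g x) \<partial>M) \<le> norm2 M f * norm2 M g"
proof -
  define A where "A = (\<integral>x. (norm (f x))\<^sup>2 \<partial>M)"
  define B where "B = (\<integral>x. (norm (g x))\<^sup>2 \<partial>M)"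
  define C where "C = (\<integral>x. norm (f x) * norm (g x) \<partial>M)"
  have A0: "A \<ge> 0" "C \<ge> 0" by (auto simp: A_def C_def)
  have q: "2 * t * C \<le> t\<^sup>2 * A + B" for t
  proof -
    have "2 * t * C = (\<integral>x. 2 * t * (norm (f x) * norm (g x)) \<partial>M)" by (simp add: C_def)
    also have "\<dots> \<le> (\<integral>x. t\<^sup>2 * (norm (f x))\<^sup>2 + (norm (g x))\<^sup>2 \<partial>M)"
    proof (rule integral_mono)
      fix x
      show "2 * t * (norm (f x) * norm (g x)) \<le> t\<^sup>2 * (norm (f x))\<^sup>2 + (norm (g x))\<^sup>2"
        using sum_squares_bound[of "t * norm (f x)" "norm (g x)"]
        by (simp add: power_mult_distrib mult.assoc)
    qed (use assms in \<open>auto intro!: integrable_mult_right square_integrable_mult_norm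
          Bochner_Integration.integrable_add simp: square_integrable_norm\<close>)
    also have "\<dots> = t\<^sup>2 * A + B"
      using assms by (simp add: A_def B_def square_integrable_norm)
    finally show ?thesis .
  qed
  have "C\<^sup>2 \<le> A * B"
  proof (cases "A = 0")
    case True
    have "C = 0"
    proof (rule ccontr)
      assume "C \<noteq> 0"
      \<comment> \<open>This \<open>t\<close> makes the left side of \<open>q\<close> equal to
        \<open>B + 1\<close>, while the right side is only \<open>B\<close>.\<close>
      with A0 q[of "(B + 1) / (2 * C)"] True show False by (simp add: field_simps)
    qed
    with True show ?thesis by simp
  next
    case False
    with A0 q[of "C / A"] show ?thesis by (simp add: field_simps power2_eq_square)
  qed
  then show ?thesis
    unfolding norm2_def A_def[symmetric] B_def[symmetric] C_def[symmetric] real_sqrt_mult[symmetric]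
    by (rule real_le_rsqrt)
qed

lemma norm2_triangle:
  assumes "f \<in> square_integrable M" "g \<in> square_integrable M"
  shows "norm2 M (\<lambda>x. f x + g x) \<le> norm2 M f + norm2 M g"
proof (rule power2_le_imp_le)
  have i: "integrable M (\<lambda>x. (norm (f x))\<^sup>2)" "integrable M (\<lambda>x. (norm (g x))\<^sup>2)"
    using assms by (auto simp: square_integrable_norm)
  have "(norm2 M (\<lambda>x. f x + g x))\<^sup>2 \<le>
      (\<integral>x. (norm (f x))\<^sup>2 + 2 * (norm (f x) * norm (g x)) + (norm (g x))\<^sup>2 \<partial>M)"
    unfolding norm2_sq
  proof (rule integral_mono)
    show "integrable M (\<lambda>x. (norm (f x + g x))\<^sup>2)"
      using assms by (intro square_integrable_norm square_integrable_add)
    show "integrable M (\<lambda>x. (norm (f x))\<^sup>2 + 2 * (norm (f x) * norm (g x)) + (norm (g x))\<^sup>2)"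
      using i square_integrable_mult_norm[OF assms] by auto
    fix x
    have "(norm (f x + g x))\<^sup>2 \<le> (norm (f x) + norm (g x))\<^sup>2"
      by (intro power_mono norm_triangle_ineq) simp
    then show "(norm (f x + g x))\<^sup>2 \<le> (norm (f x))\<^sup>2 + 2 * (norm (f x) * norm (g x)) + (norm (g x))\<^sup>2"
      by (simp add: power2_sum)
  qed
  also have "\<dots> = (norm2 M f)\<^sup>2 + 2 * (\<integral>x. norm (f x) * norm (g x) \<partial>M) + (norm2 M g)\<^sup>2"
    using i square_integrable_mult_norm[OF assms] by (simp add: norm2_sq)
  also have "\<dots> \<le> (norm2 M f + norm2 M g)\<^sup>2"
    using integral_mult_norm_le[OF assms] by (simp add: power2_sum)
  finally show "(norm2 M (\<lambda>x. f x + g x))\<^sup>2 \<le> (norm2 M f + norm2 M g)\<^sup>2" .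
qed simp

lemma norm2_triangle_diff:
  assumes "f \<in> square_integrable M" "g \<in> square_integrable M" "h \<in> square_integrable M"
  shows "norm2 M (\<lambda>x. f x - h x) \<le> norm2 M (\<lambda>x. f x - g x) + norm2 M (\<lambda>x. g x - h x)"
  using norm2_triangle[of "\<lambda>x. f x - g x" M "\<lambda>x. g x - h x"] assms
  by (simp add: square_integrable_diff)

lemma norm2_diff_ge:
  assumes "f \<in> square_integrable M" "g \<in> square_integrable M"
  shows "\<bar>norm2 M f - norm2 M g\<bar> \<le> norm2 M (\<lambda>x. f x - g x)"
  using norm2_triangle[of "\<lambda>x. f x - g x" M g] norm2_triangle[of "\<lambda>x. g x - f x" M f]
    norm2_minus_commute[of M f g] assms
  by (simp add: square_integrable_diff)

lemma norm2_cong_AE: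
  assumes "f \<in> borel_measurable M" "g \<in> borel_measurable M" "AE x in M. f x = g x"
  shows "norm2 M f = norm2 M g"
  unfolding norm2_def
  using assms by (intro arg_cong[where f = sqrt] integral_cong_AE) (auto elim: eventually_mono)

section \<open>The complex inner product\<close>

lemma square_integrable_mult:
  fixes f g :: "'a \<Rightarrow> complex"
  assumes "f \<in> square_integrable M" "g \<in> square_integrable M"
  shows "integrable M (\<lambda>x. f x * g x)"
proof (rule Bochner_Integration.integrable_bound[OF square_integrable_mult_norm[OF assms]])
  note [measurable] = assms[THEN square_integrable_measurable]
  show "(\<lambda>x. f x * g x) \<in> borel_measurable M" by simp
qed (simp add: norm_mult)

lemma square_integrable_cnj:
  "f \<in> square_integrable M \<Longrightarrow> (\<lambda>x. cnj (f x)) \<in> square_integrable M"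
  by (rule square_integrable_bound[where g = f and C = 1])
     (auto dest: square_integrable_measurable
       intro!: borel_measurable_continuous_on[where f = cnj] continuous_on_cnj)

lemma norm_integral_mult_le:
  fixes f g :: "'a \<Rightarrow> complex"
  assumes "f \<in> square_integrable M" "g \<in> square_integrable M"
  shows "norm (\<integral>x. f x * g x \<partial>M) \<le> norm2 M f * norm2 M g"
proof -
  have "norm (\<integral>x. f x * g x \<partial>M) \<le> (\<integral>x. norm (f x) * norm (g x) \<partial>M)"
    using integral_norm_bound[of M "\<lambda>x. f x * g x"] by (simp add: norm_mult)
  also have "\<dots> \<le> norm2 M f * norm2 M g" by (rule integral_mult_norm_le[OF assms])
  finally show ?thesis .
qed

lemma norm_inner2_le:
  assumes "f \<in> square_integrable M" "g \<in> square_integrable M"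
  shows "norm (inner2 M f g) \<le> norm2 M f * norm2 M g"
  using norm_integral_mult_le[OF assms(1) square_integrable_cnj[OF assms(2)]]
  by (simp add: inner2_def norm2_def)

lemma inner2_diff_left:
  assumes "f \<in> square_integrable M" "g \<in> square_integrable M" "h \<in> square_integrable M"
  shows "inner2 M (\<lambda>x. f x - g x) h = inner2 M f h - inner2 M g h"
  unfolding inner2_def using assms
  by (simp add: left_diff_distrib square_integrable_mult square_integrable_cnj)

lemma inner2_sum_left:
  assumes "\<And>i. i \<in> S \<Longrightarrow> f i \<in> square_integrable M" "h \<in> square_integrable M"
  shows "inner2 M (\<lambda>x. \<Sum>i\<in>S. c i * f i x) h = (\<Sum>i\<in>S. c i * inner2 M (f i) h)"
  unfolding inner2_def using assms
  by (simp add: sum_distrib_right mult.assoc square_integrable_mult square_integrable_cnj)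

lemma inner2_commute: "inner2 M f g = cnj (inner2 M g f)"
  unfolding inner2_def by (simp add: mult.commute flip: Bochner_Integration.integral_cnj)

lemma inner2_self: "inner2 M f f = complex_of_real ((norm2 M f)\<^sup>2)"
  unfolding inner2_def norm2_sq
  by (simp flip: complex_norm_square integral_complex_of_real)

text \<open>Cauchy-Schwarz against the constant 1. On a finite measure space it turns L2 estimates
  into L1 estimates, which can be summed pointwise.\<close>

lemma finite_measure_square_integrable:
  fixes f :: "'a \<Rightarrow> 'b::euclidean_space"
  assumes "finite_measure M" "f \<in> square_integrable M"
  shows "integrable M f" "(\<integral>x. norm (f x) \<partial>M) \<le> norm2 M f * sqrt (measure M (space M))"
proof -
  interpret finite_measure M by fact
  have 1: "(\<lambda>x. 1::real) \<in> square_integrable M" by (simp add: square_integrable_def)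
  show "integrable M f"
    using square_integrable_mult_norm[OF assms(2) 1] square_integrable_measurable[OF assms(2)]
    by (simp add: integrable_norm_iff)
  show "(\<integral>x. norm (f x) \<partial>M) \<le> norm2 M f * sqrt (measure M (space M))"
    using integral_mult_norm_le[OF assms(2) 1] by (simp add: norm2_def)
qed

text \<open>Fatou's lemma for the squared norms: balls of L2 are closed under limits almost
  everywhere. This transfers the tail estimates of a Cauchy sequence to its limit.\<close>

lemma square_integrable_Fatou:
  fixes f :: "'a \<Rightarrow> 'b::euclidean_space" and s :: "nat \<Rightarrow> 'a \<Rightarrow> 'b"
  assumes s: "\<And>n. s n \<in> square_integrable M" and f: "f \<in> borel_measurable M"
    and lim: "AE x in M. (\<lambda>n. s n x) \<longlonglongrightarrow> f x" and bd: "\<And>n. norm2 M (s n) \<le> C"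
  shows "f \<in> square_integrable M" "norm2 M f \<le> C"
proof -
  have C: "0 \<le> C" using order_trans[OF norm2_nonneg bd[of 0]] .
  note [measurable] = s[THEN square_integrable_measurable] f
  have "(\<integral>\<^sup>+x. ennreal ((norm (f x))\<^sup>2) \<partial>M) = (\<integral>\<^sup>+x. liminf (\<lambda>n. ennreal ((norm (s n x))\<^sup>2)) \<partial>M)"
  proof (rule nn_integral_cong_AE, use lim in eventually_elim)
    case (elim x)
    then have "(\<lambda>n. ennreal ((norm (s n x))\<^sup>2)) \<longlonglongrightarrow> ennreal ((norm (f x))\<^sup>2)"
      by (intro tendsto_intros)
    then show ?case by (intro lim_imp_Liminf[symmetric]) auto
  qed
  also have "\<dots> \<le> liminf (\<lambda>n. \<integral>\<^sup>+x. ennreal ((norm (s n x))\<^sup>2) \<partial>M)"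
    by (rule nn_integral_liminf) simp
  also have "\<dots> \<le> ennreal (C\<^sup>2)"
  proof (rule order_trans[OF Liminf_le_Limsup Limsup_bounded], simp, intro always_eventually allI)
    fix n
    have "(\<integral>\<^sup>+x. ennreal ((norm (s n x))\<^sup>2) \<partial>M) = ennreal ((norm2 M (s n))\<^sup>2)"
      unfolding norm2_sq by (rule nn_integral_eq_integral) (auto simp: square_integrable_norm s)
    also have "\<dots> \<le> ennreal (C\<^sup>2)"
      using bd by (intro ennreal_leI power_mono) auto
    finally show "(\<integral>\<^sup>+x. ennreal ((norm (s n x))\<^sup>2) \<partial>M) \<le> ennreal (C\<^sup>2)" .
  qed
  finally have le: "(\<integral>\<^sup>+x. ennreal ((norm (f x))\<^sup>2) \<partial>M) \<le> ennreal (C\<^sup>2)" .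
  then have int: "integrable M (\<lambda>x. (norm (f x))\<^sup>2)"
    by (intro integrableI_bounded) (auto intro: le_less_trans)
  then show "f \<in> square_integrable M" using f by (simp add: square_integrable_def)
  have "ennreal ((norm2 M f)\<^sup>2) \<le> ennreal (C\<^sup>2)"
    using le unfolding norm2_sq by (subst (asm) nn_integral_eq_integral[OF int]) auto
  then show "norm2 M f \<le> C"
    using C by (auto intro: power2_le_imp_le)
qed

text \<open>With a geometric rate the increments are summable in L1, hence absolutely summable at
  almost every point. This produces the pointwise limit, which Fatou then shows to be the L2 limit.
  Nets are reduced to such sequences in \<open>expands_exists\<close>.\<close>

lemma square_integrable_complete:
  fixes s :: "nat \<Rightarrow> 'a \<Rightarrow> 'b::euclidean_space"
  assumes M: "finite_measure M" and s: "\<And>n. s n \<in> square_integrable M"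
    and rate: "\<And>n. norm2 M (\<lambda>x. s (Suc n) x - s n x) \<le> (1/2) ^ n"
  obtains f where "f \<in> square_integrable M" "(\<lambda>n. norm2 M (\<lambda>x. f x - s n x)) \<longlonglongrightarrow> 0"
proof -
  note [measurable] = s[THEN square_integrable_measurable]
  define d where "d n x = s (Suc n) x - s n x" for n x
  have d: "d n \<in> square_integrable M" for n
    unfolding d_def using s by (intro square_integrable_diff)
  note [measurable] = d[THEN square_integrable_measurable]
  define K where "K = sqrt (measure M (space M))"
  have "(\<integral>\<^sup>+x. (\<Sum>n. ennreal (norm (d n x))) \<partial>M) = (\<Sum>n. \<integral>\<^sup>+x. ennreal (norm (d n x)) \<partial>M)"
    by (rule nn_integral_suminf) simp
  also have "\<dots> \<le> (\<Sum>n. ennreal ((1/2) ^ n * K))"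
  proof (rule suminf_le)
    fix n
    have "(\<integral>\<^sup>+x. ennreal (norm (d n x)) \<partial>M) = ennreal (\<integral>x. norm (d n x) \<partial>M)"
      using finite_measure_square_integrable(1)[OF M d] by (intro nn_integral_eq_integral) auto
    also have "\<dots> \<le> ennreal ((1/2) ^ n * K)"
      using finite_measure_square_integrable(2)[OF M d, of n] mult_right_mono[OF rate[of n], of K]
      by (intro ennreal_leI) (simp add: K_def d_def[abs_def])
    finally show "(\<integral>\<^sup>+x. ennreal (norm (d n x)) \<partial>M) \<le> ennreal ((1/2) ^ n * K)" .
  qed auto
  also have "\<dots> = ennreal (\<Sum>n. (1/2) ^ n * K)"
    by (rule suminf_ennreal2) (auto simp: K_def intro!: summable_mult2 summable_geometric)
  also have "\<dots> < \<infinity>" by simp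
  finally have "AE x in M. (\<Sum>n. ennreal (norm (d n x))) \<noteq> \<infinity>"
    by (intro nn_integral_PInf_AE) auto
  then have conv: "AE x in M. convergent (\<lambda>n. s n x)"
  proof eventually_elim
    case (elim x)
    then have "summable (\<lambda>n. norm (d n x))"
      by (intro summable_suminf_not_top) auto
    then have "summable (\<lambda>n. d n x)" by (rule summable_norm_cancel)
    then have "convergent (\<lambda>n. \<Sum>i<n. d i x)" by (simp add: summable_iff_convergent)
    moreover have "(\<Sum>i<n. d i x) = s n x - s 0 x" for n
      by (simp add: d_def sum_lessThan_telescope[of "\<lambda>i. s i x"])
    ultimately have "convergent (\<lambda>n. s n x - s 0 x)" by simp
    then show ?case by (simp add: convergent_diff_const_right_iff)
  qed
  define f where "f x = lim (\<lambda>n. s n x)" for x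
  have f [measurable]: "f \<in> borel_measurable M" unfolding f_def by measurable
  have lim: "AE x in M. (\<lambda>n. s n x) \<longlonglongrightarrow> f x"
    using conv by eventually_elim (simp add: f_def convergent_LIMSEQ_iff)
  \<comment> \<open>The bound is the exact geometric sum of the increments from \<open>n\<close> to
    \<open>n + k\<close>; dropping the last factor afterwards makes it uniform in
    \<open>k\<close>.\<close>
  have tail: "norm2 M (\<lambda>x. s (n + k) x - s n x) \<le> 2 * (1/2) ^ n * (1 - (1/2) ^ k)" for n k
  proof (induction k)
    case 0
    then show ?case by (simp add: norm2_def)
  next
    case (Suc k)
    have "norm2 M (\<lambda>x. s (n + Suc k) x - s n x) \<le>
        norm2 M (\<lambda>x. s (n + Suc k) x - s (n + k) x) + norm2 M (\<lambda>x. s (n + k) x - s n x)"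
      by (rule norm2_triangle_diff) (rule s)+
    also have "\<dots> \<le> (1/2) ^ (n + k) + 2 * (1/2) ^ n * (1 - (1/2) ^ k)"
      using rate[of "n + k"] Suc by simp
    also have "\<dots> = 2 * (1/2) ^ n * (1 - (1/2) ^ Suc k)"
      by (simp add: power_add algebra_simps)
    finally show ?case .
  qed
  have fs: "(\<lambda>x. f x - s n x) \<in> square_integrable M \<and> norm2 M (\<lambda>x. f x - s n x) \<le> 2 * (1/2) ^ n" for n
  proof -
    have l: "AE x in M. (\<lambda>k. s (n + k) x - s n x) \<longlonglongrightarrow> f x - s n x"
      using lim
    proof eventually_elim
      case (elim x)
      show ?case
        using LIMSEQ_ignore_initial_segment[OF elim, of n]
        by (intro tendsto_diff tendsto_const) (simp add: add.commute)
    qed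
    have b: "norm2 M (\<lambda>x. s (n + k) x - s n x) \<le> 2 * (1/2) ^ n" for k
      by (rule order_trans[OF tail mult_left_le]) simp_all
    show ?thesis
      using square_integrable_Fatou[OF _ _ l b] s by (simp add: square_integrable_diff)
  qed
  show ?thesis
  proof
    show "f \<in> square_integrable M"
      using square_integrable_add[OF conjunct1[OF fs[of 0]] s[of 0]] by simp
    have "(\<lambda>n. 2 * (1/2) ^ n :: real) \<longlonglongrightarrow> 2 * 0"
      by (intro tendsto_mult tendsto_const LIMSEQ_power_zero) simp
    then have z: "(\<lambda>n. 2 * (1/2) ^ n :: real) \<longlonglongrightarrow> 0" by simp
    show "(\<lambda>n. norm2 M (\<lambda>x. f x - s n x)) \<longlonglongrightarrow> 0"
      by (rule tendsto_sandwich[OF _ _ tendsto_const z]) (use fs in auto)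
  qed
qed

subsection \<open>Orthonormal bases\<close>

text \<open>Completeness is encoded as triviality of the orthogonal complement, the form in which an
  annihilator argument delivers it; convergence of Fourier series is derived from it. The index set
  \<open>I\<close> is explicit because the sine modes with n = 0 vanish and must be left
  out.\<close>

locale orthonormal_basis =
  fixes M :: "'a measure" and I :: "'i set" and e :: "'i \<Rightarrow> 'a \<Rightarrow> complex"
  assumes M: "finite_measure M"
    and e: "i \<in> I \<Longrightarrow> e i \<in> square_integrable M"
    and ortho: "i \<in> I \<Longrightarrow> j \<in> I \<Longrightarrow> inner2 M (e i) (e j) = (if i = j then 1 else 0)"
    and complete: "f \<in> square_integrable M \<Longrightarrow> (\<And>i. i \<in> I \<Longrightarrow> inner2 M f (e i) = 0) \<Longrightarrow>
      AE x in M. f x = 0"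
begin

definition expands :: "('a \<Rightarrow> complex) \<Rightarrow> ('i \<Rightarrow> complex) \<Rightarrow> bool" where
  "expands f c \<longleftrightarrow> ((\<lambda>S. norm2 M (\<lambda>x. f x - (\<Sum>i\<in>S. c i * e i x))) \<longlongrightarrow> 0) (finite_subsets_at_top I)"

lemma comb_square_integrable:
  "S \<subseteq> I \<Longrightarrow> (\<lambda>x. \<Sum>i\<in>S. c i * e i x) \<in> square_integrable M"
  by (intro square_integrable_sum square_integrable_cmult e) auto

lemma inner2_comb:
  assumes "finite S" "S \<subseteq> I" "i \<in> I"
  shows "inner2 M (\<lambda>x. \<Sum>j\<in>S. c j * e j x) (e i) = (if i \<in> S then c i else 0)"
proof -
  have "inner2 M (\<lambda>x. \<Sum>j\<in>S. c j * e j x) (e i) = (\<Sum>j\<in>S. c j * inner2 M (e j) (e i))"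
    using assms e by (intro inner2_sum_left) auto
  also have "\<dots> = (\<Sum>j\<in>S. if i = j then c j else 0)"
    using assms by (intro sum.cong) (auto simp: ortho subset_iff)
  finally show ?thesis using assms by (simp add: sum.delta)
qed

lemma norm2_comb:
  assumes "finite S" "S \<subseteq> I"
  shows "(norm2 M (\<lambda>x. \<Sum>i\<in>S. c i * e i x))\<^sup>2 = (\<Sum>i\<in>S. (norm (c i))\<^sup>2)"
proof -
  let ?f = "\<lambda>x. \<Sum>i\<in>S. c i * e i x"
  have "complex_of_real ((norm2 M ?f)\<^sup>2) = (\<Sum>i\<in>S. c i * inner2 M (e i) ?f)"
    unfolding inner2_self[symmetric] using assms e comb_square_integrable[of S c]
    by (intro inner2_sum_left) auto
  also have "\<dots> = (\<Sum>i\<in>S. c i * cnj (c i))"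
    using assms by (intro sum.cong refl) (auto simp: inner2_commute[of _ "e _"] inner2_comb subset_iff)
  also have "\<dots> = complex_of_real (\<Sum>i\<in>S. (norm (c i))\<^sup>2)"
    by (simp flip: complex_norm_square)
  finally show ?thesis by (simp only: of_real_eq_iff)
qed

lemma norm2_comb_diff:
  assumes "finite T" "S \<subseteq> T" "T \<subseteq> I"
  shows "(norm2 M (\<lambda>x. (\<Sum>i\<in>T. c i * e i x) - (\<Sum>i\<in>S. c i * e i x)))\<^sup>2 = (\<Sum>i\<in>T - S. (norm (c i))\<^sup>2)"
proof -
  have "(\<Sum>i\<in>T. c i * e i x) - (\<Sum>i\<in>S. c i * e i x) = (\<Sum>i\<in>T - S. c i * e i x)" for x
    using assms by (simp add: sum_diff)
  then show ?thesis using assms norm2_comb[of "T - S" c] by auto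
qed

text \<open>Riesz-Fischer. The squared norm of a difference of partial sums is a piece of the
  summable series, so the net of partial sums is Cauchy. A sequence of index sets with geometric
  tails is extracted, and its limit attracts the whole net.\<close>

lemma expands_exists:
  assumes c: "(\<lambda>i. (norm (c i))\<^sup>2) summable_on I"
  obtains f where "f \<in> square_integrable M" "expands f c"
proof -
  let ?p = "\<lambda>S x. \<Sum>i\<in>S. c i * e i x"
  have ev: "\<exists>S. finite S \<and> S \<subseteq> I \<and> (\<forall>T. finite T \<and> S \<subseteq> T \<and> T \<subseteq> I \<longrightarrow>
      norm2 M (\<lambda>x. ?p T x - ?p S x) \<le> \<epsilon>)" if "\<epsilon> > 0" for \<epsilon>
  proof -
    obtain s where s: "((\<lambda>i. (norm (c i))\<^sup>2) has_sum s) I"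
      using c by (auto simp: summable_on_def)
    then have "\<forall>\<^sub>F S in finite_subsets_at_top I. dist (\<Sum>i\<in>S. (norm (c i))\<^sup>2) s < \<epsilon>\<^sup>2"
      using that by (auto simp: has_sum_def tendsto_iff)
    then obtain S where S: "finite S" "S \<subseteq> I" "dist (\<Sum>i\<in>S. (norm (c i))\<^sup>2) s < \<epsilon>\<^sup>2"
      by (auto simp: eventually_finite_subsets_at_top)
    have "norm2 M (\<lambda>x. ?p T x - ?p S x) \<le> \<epsilon>" if T: "finite T" "S \<subseteq> T" "T \<subseteq> I" for T
    proof (rule power2_le_imp_le)
      have "(norm2 M (\<lambda>x. ?p T x - ?p S x))\<^sup>2 = (\<Sum>i\<in>T. (norm (c i))\<^sup>2) - (\<Sum>i\<in>S. (norm (c i))\<^sup>2)"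
        using T S by (subst norm2_comb_diff) (auto simp: sum_diff)
      also have "\<dots> \<le> s - (\<Sum>i\<in>S. (norm (c i))\<^sup>2)"
        using finite_sum_le_has_sum[OF s, of T] T by simp
      also have "\<dots> \<le> \<epsilon>\<^sup>2" using S(3) by (simp add: dist_real_def)
      finally show "(norm2 M (\<lambda>x. ?p T x - ?p S x))\<^sup>2 \<le> \<epsilon>\<^sup>2" .
    qed (use \<open>\<epsilon> > 0\<close> in simp)
    with S show ?thesis by blast
  qed
  have "\<forall>n. \<exists>S. finite S \<and> S \<subseteq> I \<and> (\<forall>T. finite T \<and> S \<subseteq> T \<and> T \<subseteq> I \<longrightarrow>
      norm2 M (\<lambda>x. ?p T x - ?p S x) \<le> (1/2) ^ n)"
    by (intro allI ev) simp
  from choice[OF this]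
  obtain S where S': "\<And>n. finite (S n) \<and> S n \<subseteq> I \<and> (\<forall>T. finite T \<and> S n \<subseteq> T \<and> T \<subseteq> I \<longrightarrow>
      norm2 M (\<lambda>x. ?p T x - ?p (S n) x) \<le> (1/2) ^ n)" by (elim exE) auto
  then have S: "finite (S n)" "S n \<subseteq> I" for n by simp_all
  have Sb: "norm2 M (\<lambda>x. ?p T x - ?p (S n) x) \<le> (1/2) ^ n"
    if "finite T" "S n \<subseteq> T" "T \<subseteq> I" for n T
    using S'[of n] that by simp
  \<comment> \<open>Unions make the index sets increasing, so that \<open>U (Suc n)\<close> is among
    the sets to which the tail bound at \<open>n\<close> applies.\<close>
  define U where "U n = (\<Union>k\<le>n. S k)" for n
  have U: "finite (U n)" "U n \<subseteq> I" "S n \<subseteq> U n" "U n \<subseteq> U (Suc n)" for n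
    using S by (auto simp: U_def intro: le_SucI)
  have Ub: "norm2 M (\<lambda>x. ?p T x - ?p (U n) x) \<le> (1/2) ^ n"
    if "finite T" "U n \<subseteq> T" "T \<subseteq> I" for n T
  proof -
    have "(norm2 M (\<lambda>x. ?p T x - ?p (U n) x))\<^sup>2 \<le> (norm2 M (\<lambda>x. ?p T x - ?p (S n) x))\<^sup>2"
      using U[of n] that by (subst (1 2) norm2_comb_diff) (auto intro!: sum_mono2)
    then have "norm2 M (\<lambda>x. ?p T x - ?p (U n) x) \<le> norm2 M (\<lambda>x. ?p T x - ?p (S n) x)"
      by (rule power2_le_imp_le) simp
    also have "\<dots> \<le> (1/2) ^ n" using Sb[of T n] U[of n] that by auto
    finally show ?thesis .
  qed
  obtain f where f: "f \<in> square_integrable M" "(\<lambda>n. norm2 M (\<lambda>x. f x - ?p (U n) x)) \<longlonglongrightarrow> 0"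
    by (rule square_integrable_complete[OF M, of "\<lambda>n. ?p (U n)"])
       (simp_all add: comb_square_integrable Ub U)
  have "expands f c"
    unfolding expands_def
  proof (rule tendstoI)
    fix \<epsilon> :: real assume "\<epsilon> > 0"
    have "(\<lambda>n. (1/2) ^ n :: real) \<longlonglongrightarrow> 0" by (rule LIMSEQ_power_zero) simp
    then have "(\<lambda>n. norm2 M (\<lambda>x. f x - ?p (U n) x) + (1/2) ^ n) \<longlonglongrightarrow> 0 + 0"
      using f(2) by (intro tendsto_add)
    then have "\<forall>\<^sub>F n in sequentially. norm2 M (\<lambda>x. f x - ?p (U n) x) + (1/2) ^ n < \<epsilon>"
      using \<open>\<epsilon> > 0\<close> by (simp add: order_tendstoD)
    then obtain n where n: "norm2 M (\<lambda>x. f x - ?p (U n) x) + (1/2) ^ n < \<epsilon>"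
      by (auto simp: eventually_sequentially)
    show "\<forall>\<^sub>F S in finite_subsets_at_top I. dist (norm2 M (\<lambda>x. f x - ?p S x)) 0 < \<epsilon>"
      unfolding eventually_finite_subsets_at_top
    proof (intro exI[of _ "U n"] conjI allI impI U)
      fix T assume T: "finite T \<and> U n \<subseteq> T \<and> T \<subseteq> I"
      have "norm2 M (\<lambda>x. f x - ?p T x) \<le>
          norm2 M (\<lambda>x. f x - ?p (U n) x) + norm2 M (\<lambda>x. ?p (U n) x - ?p T x)"
        using f(1) T U[of n] by (intro norm2_triangle_diff comb_square_integrable) auto
      also have "\<dots> < \<epsilon>" using Ub[of T n] T n norm2_minus_commute[of M "?p (U n)" "?p T"] by simp
      finally show "dist (norm2 M (\<lambda>x. f x - ?p T x)) 0 < \<epsilon>" by simp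
    qed
  qed
  with f(1) show ?thesis using that by blast
qed

text \<open>The inner product is continuous in norm, and a partial sum has inner product
  \<open>c i\<close> with \<open>e i\<close> as soon as it contains the index
  \<open>i\<close>.\<close>

lemma expands_coeff:
  assumes f: "f \<in> square_integrable M" "expands f c" and i: "i \<in> I"
  shows "c i = inner2 M f (e i)"
proof -
  let ?p = "\<lambda>S x. \<Sum>i\<in>S. c i * e i x"
  have ev: "\<forall>\<^sub>F S in finite_subsets_at_top I. norm (inner2 M f (e i) - c i) \<le>
      norm2 M (\<lambda>x. f x - ?p S x) * norm2 M (e i)"
    unfolding eventually_finite_subsets_at_top
  proof (intro exI[of _ "{i}"] conjI allI impI)
    fix S assume S: "finite S \<and> {i} \<subseteq> S \<and> S \<subseteq> I"
    have "inner2 M (\<lambda>x. f x - ?p S x) (e i) = inner2 M f (e i) - c i"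
      using S i f e comb_square_integrable[of S c] by (simp add: inner2_diff_left inner2_comb)
    then show "norm (inner2 M f (e i) - c i) \<le> norm2 M (\<lambda>x. f x - ?p S x) * norm2 M (e i)"
      using norm_inner2_le[of "\<lambda>x. f x - ?p S x" M "e i"] S i f e
      by (simp add: square_integrable_diff comb_square_integrable)
  qed (use i in auto)
  have "((\<lambda>S. norm2 M (\<lambda>x. f x - ?p S x) * norm2 M (e i)) \<longlongrightarrow> 0 * norm2 M (e i))
      (finite_subsets_at_top I)"
    using f(2) unfolding expands_def by (intro tendsto_mult tendsto_const)
  from tendsto_le[OF _ this tendsto_const ev]
  show ?thesis by simp
qed

lemma expands_parseval:
  assumes f: "f \<in> square_integrable M" "expands f c"
  shows "((\<lambda>i. (norm (c i))\<^sup>2) has_sum (norm2 M f)\<^sup>2) I"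
proof -
  let ?p = "\<lambda>S x. \<Sum>i\<in>S. c i * e i x"
  have "((\<lambda>S. norm2 M f - norm2 M (?p S)) \<longlongrightarrow> 0) (finite_subsets_at_top I)"
  proof (rule Lim_null_comparison)
    show "\<forall>\<^sub>F S in finite_subsets_at_top I.
        norm (norm2 M f - norm2 M (?p S)) \<le> norm2 M (\<lambda>x. f x - ?p S x)"
      using f(1) norm2_diff_ge[OF f(1) comb_square_integrable]
      by (intro eventually_finite_subsets_at_top_weakI) auto
  qed (use f(2) in \<open>simp add: expands_def\<close>)
  from tendsto_diff[OF tendsto_const[of "norm2 M f"] this]
  have "((\<lambda>S. norm2 M (?p S)) \<longlongrightarrow> norm2 M f) (finite_subsets_at_top I)" by simp
  then have "((\<lambda>S. (norm2 M (?p S))\<^sup>2) \<longlongrightarrow> (norm2 M f)\<^sup>2) (finite_subsets_at_top I)"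
    by (rule tendsto_power)
  then show ?thesis
    unfolding has_sum_def
    by (rule Lim_transform_eventually)
       (auto intro!: eventually_finite_subsets_at_top_weakI simp: norm2_comb)
qed

lemma expands_unique_AE:
  assumes "f \<in> square_integrable M" "expands f c" "g \<in> square_integrable M" "expands g c"
  shows "AE x in M. f x = g x"
proof -
  have "AE x in M. f x - g x = 0"
    using assms expands_coeff[of f c] expands_coeff[of g c] e
    by (intro complete) (auto simp: square_integrable_diff inner2_diff_left)
  then show ?thesis by simp
qed

lemma expands_cong_AE:
  assumes "f \<in> square_integrable M" "expands f c" "g \<in> square_integrable M" "AE x in M. f x = g x"
  shows "expands g c"
proof -
  have "norm2 M (\<lambda>x. f x - (\<Sum>i\<in>S. c i * e i x)) = norm2 M (\<lambda>x. g x - (\<Sum>i\<in>S. c i * e i x))"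
    if "S \<subseteq> I" for S
    using assms that comb_square_integrable[of S c]
    by (intro norm2_cong_AE)
       (auto dest!: square_integrable_measurable elim: eventually_mono intro!: borel_measurable_diff)
  then show ?thesis
    using assms(2) unfolding expands_def
    by (elim Lim_transform_eventually) (auto intro!: eventually_finite_subsets_at_top_weakI)
qed

text \<open>Bessel's inequality makes the coefficients square summable, so some \<open>g\<close>
  expands with them. Then \<open>g\<close> minus \<open>f\<close> is orthogonal to the whole basis
  and vanishes almost everywhere.\<close>

lemma expands_inner2:
  assumes f: "f \<in> square_integrable M"
  shows "expands f (\<lambda>i. inner2 M f (e i))"
proof -
  define c where "c i = inner2 M f (e i)" for i
  let ?p = "\<lambda>S x. \<Sum>i\<in>S. c i * e i x"
  have bessel: "(\<Sum>i\<in>S. (norm (c i))\<^sup>2) \<le> (norm2 M f)\<^sup>2" if S: "finite S" "S \<subseteq> I" for S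
  proof -
    have "inner2 M (?p S) f = (\<Sum>i\<in>S. c i * inner2 M (e i) f)"
      using S f e by (intro inner2_sum_left) auto
    also have "\<dots> = (\<Sum>i\<in>S. c i * cnj (c i))"
      by (simp add: c_def inner2_commute[of _ "e _"])
    also have "\<dots> = complex_of_real ((norm2 M (?p S))\<^sup>2)"
      using S by (simp add: norm2_comb flip: complex_norm_square)
    finally have "(norm2 M (?p S))\<^sup>2 = norm (inner2 M (?p S) f)" by (simp add: norm_power)
    also have "\<dots> \<le> norm2 M (?p S) * norm2 M f"
      using S f by (intro norm_inner2_le comb_square_integrable)
    finally have "norm2 M (?p S) \<le> norm2 M f"
      by (cases "norm2 M (?p S) = 0") (auto simp: power2_eq_square order_less_le)
    then show ?thesis unfolding norm2_comb[OF S, symmetric] by (intro power_mono) auto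
  qed
  have "(\<lambda>i. (norm (c i))\<^sup>2) summable_on I"
    by (rule nonneg_bdd_above_summable_on) (auto intro!: bdd_aboveI2 bessel)
  then obtain g where g: "g \<in> square_integrable M" "expands g c" by (rule expands_exists)
  have "AE x in M. g x - f x = 0"
    using f g e
    by (intro complete)
       (simp_all add: square_integrable_diff inner2_diff_left c_def expands_coeff[OF g, symmetric])
  then have "expands f c"
    by (intro expands_cong_AE[OF g f]) simp
  then show ?thesis by (simp add: c_def[abs_def])
qed

end

section \<open>Smooth functions\<close>

lemma Ck_on_SucD: "Ck_on (Suc k) S f \<Longrightarrow> Ck_on k S f"
proof (induction k arbitrary: f)
  case 0
  then show ?case by (auto intro: has_derivative_continuous_on)
next
  case (Suc k)
  from Suc.prems obtain D where
    D: "\<forall>p\<in>S. (f has_derivative (\<lambda>h. D h p)) (at p within S)" "\<forall>h. Ck_on (Suc k) S (D h)"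
    by (subst (asm) Ck_on.simps(2)) blast
  then show ?case by (subst Ck_on.simps(2)) (blast intro: Suc.IH)
qed

lemma Ck_on_const: "Ck_on k S (\<lambda>p. c)"
proof (induction k arbitrary: c)
  case (Suc k)
  then show ?case by (auto intro!: exI[of _ "\<lambda>h p. 0"])
qed auto

lemma Ck_on_add: "Ck_on k S f \<Longrightarrow> Ck_on k S g \<Longrightarrow> Ck_on k S (\<lambda>p. f p + g p)"
proof (induction k arbitrary: f g)
  case 0
  then show ?case by (auto intro: continuous_on_add)
next
  case (Suc k)
  from Suc.prems obtain D D' where
    "\<forall>p\<in>S. (f has_derivative (\<lambda>h. D h p)) (at p within S)" "\<forall>h. Ck_on k S (D h)"
    "\<forall>p\<in>S. (g has_derivative (\<lambda>h. D' h p)) (at p within S)" "\<forall>h. Ck_on k S (D' h)"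
    by auto
  then show ?case
    by (auto intro!: exI[of _ "\<lambda>h p. D h p + D' h p"] has_derivative_add Suc.IH)
qed

lemma Ck_on_linear:
  assumes "bounded_linear T"
  shows "Ck_on k S f \<Longrightarrow> Ck_on k S (\<lambda>p. T (f p))"
proof (induction k arbitrary: f)
  case 0
  then show ?case using bounded_linear.continuous_on[OF assms] by auto
next
  case (Suc k)
  from Suc.prems obtain D where
    "\<forall>p\<in>S. (f has_derivative (\<lambda>h. D h p)) (at p within S)" "\<forall>h. Ck_on k S (D h)"
    by auto
  then show ?case
    by (auto intro!: exI[of _ "\<lambda>h p. T (D h p)"] bounded_linear.has_derivative[OF assms] Suc.IH)
qed

lemma Ck_on_bilinear:
  assumes "bounded_bilinear B"
  shows "Ck_on k S f \<Longrightarrow> Ck_on k S g \<Longrightarrow> Ck_on k S (\<lambda>p. B (f p) (g p))"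
proof (induction k arbitrary: f g)
  case 0
  then show ?case using bounded_bilinear.continuous_on[OF assms] by auto
next
  case (Suc k)
  from Suc.prems obtain D D' where D:
    "\<forall>p\<in>S. (f has_derivative (\<lambda>h. D h p)) (at p within S)" "\<forall>h. Ck_on k S (D h)"
    "\<forall>p\<in>S. (g has_derivative (\<lambda>h. D' h p)) (at p within S)" "\<forall>h. Ck_on k S (D' h)"
    by auto
  show ?case
    unfolding Ck_on.simps
  proof (intro exI[of _ "\<lambda>h p. B (f p) (D' h p) + B (D h p) (g p)"] conjI ballI allI)
    fix p assume "p \<in> S"
    then show "((\<lambda>p. B (f p) (g p)) has_derivative (\<lambda>h. B (f p) (D' h p) + B (D h p) (g p))) (at p within S)"
      using D by (intro bounded_bilinear.FDERIV[OF assms]) auto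
  next
    fix h
    show "Ck_on k S (\<lambda>p. B (f p) (D' h p) + B (D h p) (g p))"
      using Suc.prems[THEN Ck_on_SucD] D(2)[rule_format, of h] D(4)[rule_format, of h]
      by (intro Ck_on_add Suc.IH)
  qed
qed

lemmas Ck_on_mult = Ck_on_bilinear[OF bounded_bilinear_mult]

lemma Ck_on_sum: "(\<And>i. i \<in> I \<Longrightarrow> Ck_on k S (f i)) \<Longrightarrow> Ck_on k S (\<lambda>p. \<Sum>i\<in>I. f i p)"
  by (induction I rule: infinite_finite_induct) (auto intro: Ck_on_add Ck_on_const)

text \<open>A set of functions that contains the directional derivatives of its members consists of
  smooth functions; no higher derivative has to be computed.\<close>

lemma Ck_on_closed_family:
  assumes "f \<in> F"
    and step: "\<And>f. f \<in> F \<Longrightarrow> \<exists>D. (\<forall>p\<in>S. (f has_derivative (\<lambda>h. D h p)) (at p within S)) \<and> (\<forall>h. D h \<in> F)"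
  shows "Ck_on k S f"
  using assms(1)
proof (induction k arbitrary: f)
  case 0
  from step[OF this] show ?case by (auto intro: has_derivative_continuous_on)
next
  case (Suc k)
  from step[OF Suc.prems] show ?case using Suc.IH by auto
qed

lemma bounded_linear_axis: "bounded_linear (axis j :: complex \<Rightarrow> complex^3)"
  unfolding linear_conv_bounded_linear[symmetric]
  by (rule linearI) (auto simp: axis_def vec_eq_iff)

lemma axis_sum: "(\<chi> j. f j) = (\<Sum>j\<in>UNIV. axis j (f j))"
  by (simp add: vec_eq_iff axis_def if_distrib cong: if_cong)

lemma Ck_on_vec:
  fixes f :: "point \<Rightarrow> complex^3"
  shows "(\<And>j. Ck_on k S (\<lambda>p. f p $ j)) \<Longrightarrow> Ck_on k S f"
proof -
  assume "\<And>j. Ck_on k S (\<lambda>p. f p $ j)"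
  then have "Ck_on k S (\<lambda>p. \<Sum>j\<in>UNIV. axis j (f p $ j))"
    by (intro Ck_on_sum Ck_on_linear[OF bounded_linear_axis])
  moreover have "(\<Sum>j\<in>UNIV. axis j (f p $ j)) = f p" for p
    unfolding axis_sum[symmetric] by (simp add: vec_eq_iff)
  ultimately show ?thesis by simp
qed

subsection \<open>Flat functions and cutoffs\<close>

text \<open>The classical smooth function exp(-1/t), divided by powers of t. Differentiation stays
  inside the linear span of this family, so smoothness follows by induction over all
  \<open>k\<close> at once.\<close>

definition flat :: "nat \<Rightarrow> real \<Rightarrow> real" where
  "flat k t = (if 0 < t then exp (- 1 / t) / t ^ k else 0)"

lemma flat_nonneg [simp]: "0 \<le> flat k t"
  by (simp add: flat_def)

lemma power_le_fact_exp: "0 \<le> v \<Longrightarrow> v ^ k \<le> fact k * exp (v::real)"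
proof -
  assume "0 \<le> v"
  then have "(\<Sum>n\<in>{k}. v ^ n /\<^sub>R fact n) \<le> (\<Sum>n. v ^ n /\<^sub>R fact n)"
    by (intro sum_le_suminf summable_exp_generic) auto
  then show ?thesis by (simp add: exp_def divide_simps mult.commute)
qed

text \<open>Put v = 1/t in \<open>v ^ k \<le> fact k * exp v\<close>. These factorials are the
  source of the numerical constants in the cutoff estimates.\<close>

lemma flat_le_fact: "flat k t \<le> fact k"
proof (cases "t > 0")
  case True
  then have "(1 / t) ^ k \<le> fact k * exp (1 / t)" by (intro power_le_fact_exp) simp
  then show ?thesis using True by (simp add: flat_def exp_minus field_simps)
qed (simp add: flat_def)

lemma flat_Suc: "t * flat (Suc k) t = flat k t"
  by (simp add: flat_def)

lemma flat_has_derivative: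
  "(flat k has_field_derivative flat (k + 2) t - real k * flat (k + 1) t) (at t)"
proof -
  consider "t > 0" | "t < 0" | "t = 0" by linarith
  then show ?thesis
  proof cases
    case 1
    have "((\<lambda>t. exp (- 1 / t) / t ^ k) has_field_derivative flat (k + 2) t - real k * flat (k + 1) t) (at t)"
      using 1 by (auto intro!: derivative_eq_intros simp: flat_def field_simps power2_eq_square
          simp flip: power_Suc) (cases k; simp add: field_simps)
    then show ?thesis
      by (rule has_field_derivative_transform_within_open[where S = "{0<..}"])
         (use 1 in \<open>auto simp: flat_def\<close>)
  next
    case 2
    have "((\<lambda>t. 0) has_field_derivative 0) (at t)" by simp
    then have "(flat k has_field_derivative 0) (at t)"
      by (rule has_field_derivative_transform_within_open[where S = "{..<0}"])
         (use 2 in \<open>auto simp: flat_def\<close>)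
    with 2 show ?thesis by (simp add: flat_def)
  next
    case 3
    have "((\<lambda>h. (flat k (0 + h) - flat k 0) / h) \<longlongrightarrow> 0) (at 0)"
    proof (rule Lim_null_comparison)
      have "norm ((flat k (0 + h) - flat k 0) / h) \<le> fact (k + 2) * \<bar>h\<bar>" if "h \<noteq> 0" for h
      proof -
        \<comment> \<open>Trading powers of \<open>h\<close> for a larger index shows that the
          difference quotient at 0 is \<open>h\<close> times a bounded function.\<close>
        have "(flat k (0 + h) - flat k 0) / h = h * flat (Suc (Suc k)) h"
          using that flat_Suc[of h k] flat_Suc[of h "Suc k"] by (simp add: flat_def[of k 0] field_simps)
        then show ?thesis
          using mult_left_mono[OF flat_le_fact[of "Suc (Suc k)" h], of "\<bar>h\<bar>"]
          by (simp add: abs_mult mult.commute)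
      qed
      then show "\<forall>\<^sub>F h in at 0. norm ((flat k (0 + h) - flat k 0) / h) \<le> fact (k + 2) * \<bar>h\<bar>"
        by (auto simp: eventually_at intro!: exI[of _ 1])
      have "((\<lambda>h. fact (k + 2) * \<bar>h\<bar>) \<longlongrightarrow> fact (k + 2) * \<bar>0::real\<bar>) (at 0)"
        by (intro tendsto_intros)
      then show "((\<lambda>h. fact (k + 2) * \<bar>h\<bar> :: real) \<longlongrightarrow> 0) (at 0)" by simp
    qed
    with 3 show ?thesis by (simp add: DERIV_def flat_def)
  qed
qed

lemma flat_continuous: "continuous_on S f \<Longrightarrow> continuous_on S (\<lambda>x. flat k (f x))"
  by (rule continuous_on_compose2[OF DERIV_continuous_on[of UNIV "flat k"]])
     (rule has_field_derivative_at_within, rule flat_has_derivative, assumption, rule subset_UNIV)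

lemma Ck_on_flat:
  fixes l :: "point \<Rightarrow> real"
  assumes "bounded_linear l"
  shows "Ck_on n S (\<lambda>p. flat k (l p + c))"
proof (induction n arbitrary: k)
  case 0
  then show ?case
    using linear_continuous_on[OF assms, of S] by (auto intro!: flat_continuous continuous_intros)
next
  case (Suc n)
  show ?case
    unfolding Ck_on.simps
  proof (intro exI[of _ "\<lambda>h p. l h * (flat (k + 2) (l p + c) + - real k * flat (k + 1) (l p + c))"]
      conjI ballI allI)
    fix p
    have "((\<lambda>p. l p + c) has_derivative l) (at p within S)"
      using bounded_linear_imp_has_derivative[OF assms] by (auto intro!: derivative_eq_intros)
    from has_derivative_compose[OF this, of "flat k"
        "(*) (flat (k + 2) (l p + c) - real k * flat (k + 1) (l p + c))"]
    show "((\<lambda>p. flat k (l p + c)) has_derivative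
        (\<lambda>h. l h * (flat (k + 2) (l p + c) + - real k * flat (k + 1) (l p + c)))) (at p within S)"
      using flat_has_derivative[of k "l p + c"]
      by (simp add: has_field_derivative_def mult.commute)
  next
    fix h
    show "Ck_on n S (\<lambda>p. l h * (flat (k + 2) (l p + c) + - real k * flat (k + 1) (l p + c)))"
      by (intro Ck_on_mult Ck_on_add Ck_on_const Suc)
  qed
qed

text \<open>
  As \<open>\<delta> \<rightarrow> 0\<close> the cutoff tends to 1 inside \<open>(0,a)\<close>, while its derivative times the distance to
  the plates stays bounded and tends to 0. By dominated convergence, identities that hold for test
  functions therefore extend to smooth functions which vanish on the plates.
\<close>

definition cutoff :: "real \<Rightarrow> real \<Rightarrow> real \<Rightarrow> real" where
  "cutoff a \<delta> z = flat 0 (z / \<delta> - 1) * flat 0 ((a - z) / \<delta> - 1)"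

definition cutoff' :: "real \<Rightarrow> real \<Rightarrow> real \<Rightarrow> real" where
  "cutoff' a \<delta> z = (flat 2 (z / \<delta> - 1) * flat 0 ((a - z) / \<delta> - 1)
     - flat 0 (z / \<delta> - 1) * flat 2 ((a - z) / \<delta> - 1)) / \<delta>"

lemma cutoff_has_derivative: "\<delta> > 0 \<Longrightarrow> (cutoff a \<delta> has_field_derivative cutoff' a \<delta> z) (at z)"
proof -
  assume "\<delta> > 0"
  \<comment> \<open>The general derivative formula has a second term with factor \<open>k\<close>,
    which disappears for \<open>flat 0\<close>.\<close>
  have d: "((\<lambda>z. flat 0 (g z)) has_field_derivative flat 2 (g z) * g') (at z)"
    if "(g has_field_derivative g') (at z)" for g g'
    using DERIV_chain2[OF flat_has_derivative[of 0] that] by (simp add: numeral_2_eq_2)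
  have 1: "((\<lambda>z. z / \<delta> - 1) has_field_derivative 1 / \<delta>) (at z)"
    using \<open>\<delta> > 0\<close> by (auto intro!: derivative_eq_intros)
  have 2: "((\<lambda>z. (a - z) / \<delta> - 1) has_field_derivative - 1 / \<delta>) (at z)"
    using \<open>\<delta> > 0\<close> by (auto intro!: derivative_eq_intros)
  show ?thesis
    using DERIV_mult[OF d[OF 1] d[OF 2]]
    using \<open>\<delta> > 0\<close> by (simp add: cutoff_def[abs_def] cutoff'_def field_simps)
qed

lemma flat0_le_1: "flat 0 t \<le> 1"
  using flat_le_fact[of 0 t] by simp

lemma cutoff_bounds: "0 \<le> cutoff a \<delta> z" "cutoff a \<delta> z \<le> 1"
  by (auto simp: cutoff_def intro!: mult_le_one flat0_le_1)

lemma cutoff_eq_0: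
  assumes "\<delta> > 0" "z < \<delta> \<or> a - \<delta> < z"
  shows "cutoff a \<delta> z = 0"
proof -
  have "z / \<delta> - 1 \<le> 0 \<or> (a - z) / \<delta> - 1 \<le> 0"
    using assms by (auto simp: field_simps)
  then show ?thesis by (auto simp: cutoff_def flat_def)
qed

lemma Ck_on_cutoff: "Ck_on n S (\<lambda>p. cutoff a \<delta> (snd (snd p)))"
proof -
  have l: "bounded_linear (\<lambda>p::point. snd (snd p) / \<delta>)"
    "bounded_linear (\<lambda>p::point. - (snd (snd p) / \<delta>))"
    by (intro bounded_linear_minus bounded_linear_compose[OF bounded_linear_divide]
        bounded_linear_compose[OF bounded_linear_snd bounded_linear_snd])+
  show ?thesis
    using Ck_on_mult[OF Ck_on_flat[OF l(1), of n S 0 "-1"] Ck_on_flat[OF l(2), of n S 0 "a / \<delta> - 1"]]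
    by (simp add: cutoff_def diff_divide_distrib algebra_simps)
qed

lemma abs_cutoff'_le:
  assumes "\<delta> > 0"
  shows "\<bar>cutoff' a \<delta> z\<bar> \<le> (flat 2 (z / \<delta> - 1) + flat 2 ((a - z) / \<delta> - 1)) / \<delta>"
proof -
  let ?u = "z / \<delta> - 1" and ?v = "(a - z) / \<delta> - 1"
  have "flat 2 ?u * flat 0 ?v \<le> flat 2 ?u" "flat 0 ?u * flat 2 ?v \<le> flat 2 ?v"
    using flat0_le_1 by (auto intro: mult_left_le mult_left_le_one_le)
  moreover have "0 \<le> flat 2 ?u * flat 0 ?v" "0 \<le> flat 0 ?u * flat 2 ?v" by simp_all
  ultimately have "\<bar>flat 2 ?u * flat 0 ?v - flat 0 ?u * flat 2 ?v\<bar> \<le> flat 2 ?u + flat 2 ?v"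
    using flat_nonneg[of 2 ?u] flat_nonneg[of 2 ?v] by linarith
  with assms show ?thesis by (simp add: cutoff'_def divide_right_mono)
qed

text \<open>With u = z/\<delta> - 1 the left side is \<open>(u + 1) * flat 2 u\<close>, which equals
  \<open>flat 1 u + flat 2 u\<close>; the 3 is 1! + 2!.\<close>

lemma flat2_bound:
  assumes "\<delta> > 0"
  shows "z * (flat 2 (z / \<delta> - 1) / \<delta>) \<le> 3"
proof -
  define u where "u = z / \<delta> - 1"
  have "z * (flat 2 (z / \<delta> - 1) / \<delta>) = (u + 1) * flat 2 u"
    using assms by (simp add: u_def field_simps)
  also have "\<dots> = flat 1 u + flat 2 u"
    using flat_Suc[of u 1] by (simp add: algebra_simps numeral_2_eq_2)
  also have "\<dots> \<le> 3" using flat_le_fact[of 1 u] flat_le_fact[of 2 u] by (simp add: numeral_2_eq_2)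
  finally show ?thesis .
qed

text \<open>The derivative of the cutoff has one term for each plate. Each is paired with the linear
  bound on \<open>w\<close> at that plate and costs 3K. The result does not depend on \<delta>, as
  dominated convergence demands.\<close>

lemma cutoff'_mult_le:
  assumes "\<delta> > 0" "K \<ge> 0" "\<bar>w\<bar> \<le> K * z" "\<bar>w\<bar> \<le> K * (a - z)"
  shows "\<bar>cutoff' a \<delta> z * w\<bar> \<le> 6 * K"
proof -
  let ?u = "flat 2 (z / \<delta> - 1) / \<delta>" and ?v = "flat 2 ((a - z) / \<delta> - 1) / \<delta>"
  have uv: "?u \<ge> 0" "?v \<ge> 0" using assms by simp_all
  have "\<bar>cutoff' a \<delta> z * w\<bar> \<le> (?u + ?v) * \<bar>w\<bar>"
    using abs_cutoff'_le[OF assms(1), of a z]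
    by (simp add: abs_mult add_divide_distrib mult_right_mono)
  also have "\<dots> \<le> ?u * (K * z) + ?v * (K * (a - z))"
    unfolding distrib_right using assms uv by (intro add_mono mult_left_mono)
  also have "\<dots> = K * (z * ?u) + K * ((a - z) * ?v)" by (simp only: ac_simps)
  also have "\<dots> \<le> K * 3 + K * 3"
    using assms by (intro add_mono mult_left_mono flat2_bound)
  finally show ?thesis by simp
qed

lemma LIMSEQ_inverse_Suc: "(\<lambda>n. 1 / real (Suc n)) \<longlonglongrightarrow> 0"
  using LIMSEQ_inverse_real_of_nat by (simp add: inverse_eq_divide)

lemma cutoff_tendsto:
  assumes "0 < z" "z < a"
  shows "(\<lambda>n. cutoff a (1 / real (Suc n)) z) \<longlonglongrightarrow> 1"
proof -
  have *: "(\<lambda>n. flat 0 (t / (1 / real (Suc n)) - 1)) \<longlonglongrightarrow> 1" if "t > 0" for t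
  proof -
    have "filterlim (\<lambda>n. -1 + t * real (Suc n)) at_top sequentially"
      by (intro filterlim_tendsto_add_at_top[OF tendsto_const]
          filterlim_tendsto_pos_mult_at_top[OF tendsto_const that]
          filterlim_compose[OF filterlim_real_sequentially filterlim_Suc])
    then have l: "filterlim (\<lambda>n. t / (1 / real (Suc n)) - 1) at_top sequentially"
      by (simp add: algebra_simps)
    then have "(\<lambda>n. inverse (t / (1 / real (Suc n)) - 1)) \<longlonglongrightarrow> 0"
      by (rule tendsto_inverse_0_at_top)
    then have "(\<lambda>n. exp (- inverse (t / (1 / real (Suc n)) - 1))) \<longlonglongrightarrow> exp (- 0)"
      by (intro tendsto_intros)
    then have "(\<lambda>n. exp (- inverse (t / (1 / real (Suc n)) - 1))) \<longlonglongrightarrow> 1" by simp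
    then show ?thesis
    proof (rule Lim_transform_eventually)
      have "\<forall>\<^sub>F n in sequentially. 0 < t / (1 / real (Suc n)) - 1"
        using l[unfolded filterlim_at_top_dense, rule_format, of 0] .
      then show "\<forall>\<^sub>F n in sequentially. exp (- inverse (t / (1 / real (Suc n)) - 1)) =
          flat 0 (t / (1 / real (Suc n)) - 1)"
        by eventually_elim (simp add: flat_def inverse_eq_divide)
    qed
  qed
  show ?thesis
    using tendsto_mult[OF *[of z] *[of "a - z"]] assms by (simp add: cutoff_def)
qed

lemma cutoff'_tendsto:
  assumes "0 < z" "z < a"
  shows "(\<lambda>n. cutoff' a (1 / real (Suc n)) z) \<longlonglongrightarrow> 0"
proof -
  have *: "(\<lambda>n. flat 2 (t / (1 / real (Suc n)) - 1) / (1 / real (Suc n))) \<longlonglongrightarrow> 0" if "t > 0" for t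
  proof (rule Lim_null_comparison)
    have "(\<lambda>n. 1 / real (Suc n) / (t - 1 / real (Suc n))\<^sup>2) \<longlonglongrightarrow> 0 / (t - 0)\<^sup>2"
      using that by (intro tendsto_intros LIMSEQ_inverse_Suc) auto
    then show "(\<lambda>n. 1 / real (Suc n) / (t - 1 / real (Suc n))\<^sup>2) \<longlonglongrightarrow> 0" by simp
    \<comment> \<open>Dropping the exponential leaves the bound 1/u^2 with u = t/\<delta> - 1, so
      the quotient is of order \<delta> at a fixed distance \<open>t\<close> from the plate.\<close>
    have le: "norm (flat 2 (t / \<delta> - 1) / \<delta>) \<le> \<delta> / (t - \<delta>)\<^sup>2" if "0 < \<delta>" "\<delta> < t" for \<delta>
    proof -
      have u: "0 < t / \<delta> - 1" using that by (simp add: field_simps)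
      then have "flat 2 (t / \<delta> - 1) \<le> 1 / (t / \<delta> - 1)\<^sup>2" by (simp add: flat_def divide_right_mono)
      also have "\<dots> = \<delta> / (t - \<delta>)\<^sup>2 * \<delta>" using that by (simp add: field_simps power2_eq_square)
      finally show ?thesis using that by (simp add: pos_divide_le_eq)
    qed
    have "\<forall>\<^sub>F n in sequentially. 1 / real (Suc n) < t"
      using order_tendstoD(2)[OF LIMSEQ_inverse_Suc that] .
    then show "\<forall>\<^sub>F n in sequentially. norm (flat 2 (t / (1 / real (Suc n)) - 1) / (1 / real (Suc n)))
        \<le> 1 / real (Suc n) / (t - 1 / real (Suc n))\<^sup>2"
      by eventually_elim (rule le, simp_all)
  qed
  show ?thesis
  proof (rule Lim_null_comparison)
    show "(\<lambda>n. flat 2 (z / (1 / real (Suc n)) - 1) / (1 / real (Suc n)) +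
        flat 2 ((a - z) / (1 / real (Suc n)) - 1) / (1 / real (Suc n))) \<longlonglongrightarrow> 0"
      using tendsto_add[OF *[of z] *[of "a - z"]] assms by simp
    show "\<forall>\<^sub>F n in sequentially. norm (cutoff' a (1 / real (Suc n)) z) \<le>
        flat 2 (z / (1 / real (Suc n)) - 1) / (1 / real (Suc n)) +
        flat 2 ((a - z) / (1 / real (Suc n)) - 1) / (1 / real (Suc n))"
    proof (rule always_eventually, rule allI)
      fix n
      show "norm (cutoff' a (1 / real (Suc n)) z) \<le>
        flat 2 (z / (1 / real (Suc n)) - 1) / (1 / real (Suc n)) +
        flat 2 ((a - z) / (1 / real (Suc n)) - 1) / (1 / real (Suc n))"
        using abs_cutoff'_le[of "1 / real (Suc n)" a z]
        unfolding add_divide_distrib real_norm_def by simp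
    qed
  qed
qed

text \<open>The supply of admissible test functions: any smooth periodic function, in particular a
  mode, becomes one after multiplication by the cutoff.\<close>

lemma test_function_cutoff:
  fixes \<psi> :: "point \<Rightarrow> 'b::euclidean_space"
  assumes "smooth_on UNIV \<psi>" "lat_periodic L UNIV \<psi>" "\<delta> > 0"
  shows "test_function L a (\<lambda>p. cutoff a \<delta> (snd (snd p)) *\<^sub>R \<psi> p)"
  unfolding test_function_def
proof (intro conjI)
  show "smooth_on UNIV (\<lambda>p. cutoff a \<delta> (snd (snd p)) *\<^sub>R \<psi> p)"
    using assms by (auto simp: smooth_on_def intro!: Ck_on_bilinear[OF bounded_bilinear_scaleR] Ck_on_cutoff)
  show "lat_periodic L UNIV (\<lambda>p. cutoff a \<delta> (snd (snd p)) *\<^sub>R \<psi> p)"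
    using assms by (simp add: lat_periodic_def)
  show "\<exists>\<delta>'>0. \<forall>x y z. z < \<delta>' \<or> a - \<delta>' < z \<longrightarrow> cutoff a \<delta> (snd (snd (x, y, z))) *\<^sub>R \<psi> (x, y, z) = 0"
    using assms cutoff_eq_0[of \<delta>] by (intro exI[of _ \<delta>]) simp
qed

section \<open>Integration over the slab\<close>

locale slab =
  fixes L a :: real
  assumes L: "L > 0" and a: "a > 0"
begin

abbreviation M :: "point measure" where "M \<equiv> slab_measure L a"

abbreviation cell :: "point set" where "cell \<equiv> {0..L} \<times> {0..L} \<times> {0..a}"

abbreviation layer :: "point set" where "layer \<equiv> UNIV \<times> UNIV \<times> {0..a}"

lemma L2_eq: "L2 L a = square_integrable M"
  by (simp add: L2_def square_integrable_def)

lemma l2norm_eq: "l2norm L a = norm2 M"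
  by (rule ext) (simp add: l2norm_def norm2_def)

lemma cell_cbox: "cell = cbox (0, 0, 0) (L, L, a)"
  by (simp add: cbox_Pair_eq)

lemma cell_borel [measurable]: "cell \<in> sets borel"
  by (simp add: cell_cbox)

lemma space_M: "space M = cell"
  by (simp add: slab_measure_def space_restrict_space)

lemma finite_M: "finite_measure M"
  by (rule finite_measureI)
     (simp add: space_M, simp add: slab_measure_def emeasure_restrict_space cell_cbox emeasure_lborel_cbox_eq)

lemma measurable_M: "f \<in> borel_measurable borel \<Longrightarrow> f \<in> borel_measurable M"
  unfolding slab_measure_def by (intro measurable_restrict_space1) simp

lemma continuous_measurable_M:
  fixes f :: "point \<Rightarrow> 'b::euclidean_space"
  assumes "continuous_on cell f"
  shows "f \<in> borel_measurable M"
  using borel_measurable_continuous_on_restrict[OF assms]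
  by (simp add: slab_measure_def cong: measurable_cong_sets)

lemma integrable_M_iff:
  fixes f :: "point \<Rightarrow> 'b::euclidean_space"
  shows "integrable M f \<longleftrightarrow> integrable lborel (\<lambda>p. indicator cell p *\<^sub>R f p)"
  unfolding slab_measure_def by (rule integrable_restrict_space) simp

lemma integral_M:
  fixes f :: "point \<Rightarrow> 'b::euclidean_space"
  shows "integral\<^sup>L M f = (\<integral>p. indicator cell p *\<^sub>R f p \<partial>lborel)"
  unfolding slab_measure_def by (rule integral_restrict_space) simp

lemma continuous_integrable_M:
  fixes f :: "point \<Rightarrow> 'b::euclidean_space"
  assumes "continuous_on cell f"
  shows "integrable M f"
  unfolding integrable_M_iff
  using borel_integrable_compact[of cell f] assms by (simp add: cell_cbox)

lemma continuous_square_integrable_M: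
  fixes f :: "point \<Rightarrow> 'b::euclidean_space"
  assumes "continuous_on cell f"
  shows "f \<in> square_integrable M"
  unfolding square_integrable_def
  using assms by (auto intro!: continuous_measurable_M continuous_integrable_M continuous_intros)

lemma integral_M_HK:
  fixes f :: "point \<Rightarrow> 'b::euclidean_space"
  assumes "continuous_on cell f"
  shows "integral\<^sup>L M f = integral cell f"
  using set_borel_integral_eq_integral(2)[of cell f] borel_integrable_compact[of cell f] assms
  by (simp add: integral_M set_lebesgue_integral_def set_integrable_def cell_cbox)

lemma continuous_slice:
  assumes "continuous_on cell f" "x \<in> {0..L}"
  shows "continuous_on (cbox (0, 0) (L, a)) (\<lambda>q. f (x, q))"
proof -
  have "continuous_on (cbox (0, 0) (L, a)) (\<lambda>q. (x, q))" by (intro continuous_intros)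
  moreover have "(\<lambda>q. (x, q)) ` cbox (0, 0) (L, a) \<subseteq> cell"
    using assms(2) by (auto simp: cbox_Pair_eq)
  ultimately show ?thesis
    using continuous_on_compose[of "cbox (0, 0) (L, a)" "\<lambda>q. (x, q)" f] continuous_on_subset[OF assms(1)]
    by (simp add: o_def)
qed

lemma integral_M_iterated:
  fixes f :: "point \<Rightarrow> 'b::euclidean_space"
  assumes "continuous_on cell f"
  shows "integral\<^sup>L M f = integral {0..L} (\<lambda>x. integral {0..L} (\<lambda>y. integral {0..a} (\<lambda>z. f (x, y, z))))"
proof -
  have "integral\<^sup>L M f = integral {0..L} (\<lambda>x. integral ({0..L} \<times> {0..a}) (\<lambda>q. f (x, q)))"
    unfolding integral_M_HK[OF assms]
    using integral_prod_continuous[of 0 "(0,0)" L "(L,a)" f] assms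
    by (simp add: cbox_Pair_eq)
  also have "\<dots> = integral {0..L} (\<lambda>x. integral {0..L} (\<lambda>y. integral {0..a} (\<lambda>z. f (x, y, z))))"
  proof (rule integral_cong)
    fix x assume x: "x \<in> {0..L}"
    have "continuous_on (cbox (0,0) (L,a)) (\<lambda>q. f (x, q))"
      using assms x by (rule continuous_slice)
    from integral_prod_continuous[OF this]
    show "integral ({0..L} \<times> {0..a}) (\<lambda>q. f (x, q)) =
        integral {0..L} (\<lambda>y. integral {0..a} (\<lambda>z. f (x, y, z)))"
      by (simp add: cbox_Pair_eq)
  qed
  finally show ?thesis .
qed

text \<open>The order of integration is varied so that the variable of differentiation is innermost,
  where the fundamental theorem of calculus applies.\<close>

lemma integral_M_iterated_x:
  fixes f :: "point \<Rightarrow> 'b::euclidean_space"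
  assumes "continuous_on cell f"
  shows "integral\<^sup>L M f = integral ({0..L} \<times> {0..a}) (\<lambda>q. integral {0..L} (\<lambda>x. f (x, q)))"
proof -
  have "integral\<^sup>L M f = integral {0..L} (\<lambda>x. integral ({0..L} \<times> {0..a}) (\<lambda>q. f (x, q)))"
    unfolding integral_M_HK[OF assms]
    using integral_prod_continuous[of 0 "(0,0)" L "(L,a)" f] assms
    by (simp add: cbox_Pair_eq)
  also have "\<dots> = integral ({0..L} \<times> {0..a}) (\<lambda>q. integral {0..L} (\<lambda>x. f (x, q)))"
    using integral_swap_continuous[of 0 "(0,0)" L "(L,a)" "\<lambda>x q. f (x, q)"] assms
    by (simp add: cbox_Pair_eq)
  finally show ?thesis .
qed

lemma integral_M_iterated_y:
  fixes f :: "point \<Rightarrow> 'b::euclidean_space"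
  assumes "continuous_on cell f"
  shows "integral\<^sup>L M f = integral {0..L} (\<lambda>x. integral {0..a} (\<lambda>z. integral {0..L} (\<lambda>y. f (x, y, z))))"
  unfolding integral_M_iterated[OF assms]
proof (rule integral_cong)
  fix x assume x: "x \<in> {0..L}"
  have "continuous_on (cbox (0,0) (L,a)) (\<lambda>q. f (x, q))"
    using assms x by (rule continuous_slice)
  then have "continuous_on (cbox (0,0) (L,a)) (\<lambda>(y, z). f (x, y, z))"
    by (simp add: case_prod_unfold)
  from integral_swap_continuous[OF this]
  show "integral {0..L} (\<lambda>y. integral {0..a} (\<lambda>z. f (x, y, z))) =
      integral {0..a} (\<lambda>z. integral {0..L} (\<lambda>y. f (x, y, z)))"
    by simp
qed

lemma integral_M_prod:
  fixes f g h :: "real \<Rightarrow> complex"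
  assumes "continuous_on {0..L} f" "continuous_on {0..L} g" "continuous_on {0..a} h"
  shows "(\<integral>(x, y, z). f x * g y * h z \<partial>M) = integral {0..L} f * integral {0..L} g * integral {0..a} h"
proof -
  have "continuous_on cell (\<lambda>p. f (fst p) * g (fst (snd p)) * h (snd (snd p)))"
    by (intro continuous_intros continuous_on_compose2[OF assms(1)] continuous_on_compose2[OF assms(2)]
        continuous_on_compose2[OF assms(3)]) auto
  from integral_M_iterated[OF this] show ?thesis
    by (simp add: case_prod_unfold mult.assoc)
qed

text \<open>The faces lie in coordinate hyperplanes, which are null sets. Inside the open cell the
  cutoffs converge to 1 and the coordinates can be recovered from trigonometric functions.\<close>

lemma AE_M_interior: "AE (x, y, z) in M. 0 < x \<and> x < L \<and> 0 < y \<and> y < L \<and> 0 < z \<and> z < a"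
proof -
  have hyp: "AE p in lborel. (p::point) \<bullet> b \<noteq> c" if "b \<in> Basis" for b :: point and c :: real
  proof -
    have "{p::point. p \<bullet> b = c} \<in> sets borel" by measurable
    moreover have "negligible {p::point. p \<bullet> b = c}"
      using that by (rule negligible_standard_hyperplane)
    ultimately have "{p::point. p \<bullet> b = c} \<in> null_sets lborel"
      by (simp add: negligible_iff_null_sets null_sets_completion_iff)
    then show ?thesis by (rule AE_I') auto
  qed
  have "AE (p::point) in lborel. fst p \<noteq> (c::real)" "AE (p::point) in lborel. fst (snd p) \<noteq> (c::real)"
    "AE (p::point) in lborel. snd (snd p) \<noteq> (c::real)" for c
    using hyp[of "(1,0,0)" c] hyp[of "(0,1,0)" c] hyp[of "(0,0,1)" c]
    by (auto simp: Basis_prod_def inner_prod_def zero_prod_def)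
  note ae = this[of 0] this(1,2)[of L] this(3)[of a]
  have "AE p in lborel. p \<in> cell \<longrightarrow> (case p of (x, y, z) \<Rightarrow> 0 < x \<and> x < L \<and> 0 < y \<and> y < L \<and> 0 < z \<and> z < a)"
    using ae by eventually_elim auto
  then show ?thesis
    unfolding slab_measure_def by (subst AE_restrict_space_iff) auto
qed

lemma AE_M_z: "AE p in M. 0 < snd (snd p) \<and> snd (snd p) < a"
  using AE_M_interior by (rule eventually_mono) auto

subsection \<open>Integration by parts\<close>

text \<open>Derivatives are taken within the closed layer, hence one-sided at the plates, and are
  carried as an explicit witness with the direction as first argument. As \<open>layer\<close> is
  laterally unbounded, the periodic faces need no one-sided derivatives.\<close>

definition C1 :: "(point \<Rightarrow> 'b::euclidean_space) \<Rightarrow> (point \<Rightarrow> point \<Rightarrow> 'b) \<Rightarrow> bool" where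
  "C1 f D \<longleftrightarrow> lat_periodic L {0..a} f \<and>
     (\<forall>p\<in>layer. (f has_derivative (\<lambda>h. D h p)) (at p within layer)) \<and> (\<forall>h. continuous_on layer (D h))"

lemma C1_D:
  assumes "C1 f D"
  shows "p \<in> layer \<Longrightarrow> (f has_derivative (\<lambda>h. D h p)) (at p within layer)"
    and "continuous_on layer (D h)"
    and "z \<in> {0..a} \<Longrightarrow> f (x + L, y, z) = f (x, y, z)"
    and "z \<in> {0..a} \<Longrightarrow> f (x, y + L, z) = f (x, y, z)"
  using assms unfolding C1_def lat_periodic_def by blast+

lemma C1_continuous_layer: "C1 f D \<Longrightarrow> continuous_on layer f"
  by (rule has_derivative_continuous_on) (rule C1_D(1))

lemma C1_mult:
  fixes f g :: "point \<Rightarrow> complex"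
  assumes "C1 f D" "C1 g D'"
  shows "C1 (\<lambda>p. f p * g p) (\<lambda>h p. f p * D' h p + D h p * g p)"
  unfolding C1_def
proof (intro conjI ballI allI)
  show "lat_periodic L {0..a} (\<lambda>p. f p * g p)"
    by (simp add: lat_periodic_def C1_D(3,4)[OF assms(1)] C1_D(3,4)[OF assms(2)])
  show "((\<lambda>p. f p * g p) has_derivative (\<lambda>h. f p * D' h p + D h p * g p)) (at p within layer)"
    if "p \<in> layer" for p
    using that assms by (intro has_derivative_mult C1_D(1))
  show "continuous_on layer (\<lambda>p. f p * D' h p + D h p * g p)" for h
    using assms by (intro continuous_intros C1_continuous_layer C1_D(2))
qed

lemma C1_continuous: "C1 f D \<Longrightarrow> continuous_on cell f"
  by (rule continuous_on_subset[of layer], rule C1_continuous_layer) auto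

lemma C1_continuous': "C1 f D \<Longrightarrow> continuous_on cell (D h)"
  by (rule continuous_on_subset[of layer], rule C1_D(2)) auto

lemma C1_path:
  assumes f: "C1 f D" and T: "\<And>t. t \<in> T \<Longrightarrow> l t \<in> layer"
    and l: "\<And>t. (l has_derivative (\<lambda>s. s *\<^sub>R e)) (at t within T)" and t: "t \<in> T"
  shows "((\<lambda>t. f (l t)) has_vector_derivative D e (l t)) (at t within T)"
proof -
  have d: "(f has_derivative (\<lambda>h. D h (l t))) (at (l t) within layer)"
    using f T[OF t] by (auto simp: C1_def)
  have "(f has_derivative (\<lambda>h. D h (l t))) (at (l t) within l ` T)"
    by (rule has_derivative_subset[OF d]) (intro image_subsetI T)
  from has_derivative_in_compose[OF l this]
  have "((\<lambda>t. f (l t)) has_derivative (\<lambda>s. D (s *\<^sub>R e) (l t))) (at t within T)" .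
  then show ?thesis
    using linear_scale[OF has_derivative_linear[OF d], of _ e]
    by (simp add: has_vector_derivative_def)
qed

lemma integral_partial_x:
  fixes f :: "point \<Rightarrow> 'b::euclidean_space"
  assumes "C1 f D"
  shows "integral\<^sup>L M (D (1, 0, 0)) = 0"
proof -
  have "integral {0..L} (\<lambda>x. D (1, 0, 0) (x, q)) = 0" if "q \<in> {0..L} \<times> {0..a}" for q
  proof (rule integral_unique)
    have "((\<lambda>x. D (1, 0, 0) (x, q)) has_integral (f (L, q) - f (0, q))) {0..L}"
    proof (rule fundamental_theorem_of_calculus)
      show "((\<lambda>x. f (x, q)) has_vector_derivative D (1, 0, 0) (x, q)) (at x within {0..L})"
        if "x \<in> {0..L}" for x
        using that \<open>q \<in> _\<close> by (intro C1_path[OF assms]) (auto intro!: derivative_eq_intros simp: zero_prod_def)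
    qed (use L in simp)
    moreover have "f (L, q) = f (0, q)"
      using C1_D(3)[OF assms, of _ 0] that by auto
    ultimately show "((\<lambda>x. D (1, 0, 0) (x, q)) has_integral 0) {0..L}" by simp
  qed
  then have "integral ({0..L} \<times> {0..a}) (\<lambda>q. integral {0..L} (\<lambda>x. D (1, 0, 0) (x, q))) =
      integral ({0..L} \<times> {0..a}) (\<lambda>q. 0)"
    by (rule integral_cong)
  then show ?thesis by (simp add: integral_M_iterated_x C1_continuous'[OF assms])
qed

lemma integral_partial_y:
  fixes f :: "point \<Rightarrow> 'b::euclidean_space"
  assumes "C1 f D"
  shows "integral\<^sup>L M (D (0, 1, 0)) = 0"
proof -
  have "integral {0..L} (\<lambda>y. D (0, 1, 0) (x, y, z)) = 0" if "z \<in> {0..a}" for x z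
  proof (rule integral_unique)
    have "((\<lambda>y. D (0, 1, 0) (x, y, z)) has_integral (f (x, L, z) - f (x, 0, z))) {0..L}"
    proof (rule fundamental_theorem_of_calculus)
      show "((\<lambda>y. f (x, y, z)) has_vector_derivative D (0, 1, 0) (x, y, z)) (at y within {0..L})"
        if "y \<in> {0..L}" for y
        using that \<open>z \<in> _\<close> by (intro C1_path[OF assms]) (auto intro!: derivative_eq_intros simp: zero_prod_def)
    qed (use L in simp)
    moreover have "f (x, L, z) = f (x, 0, z)"
      using C1_D(4)[OF assms, of _ _ 0] that by auto
    ultimately show "((\<lambda>y. D (0, 1, 0) (x, y, z)) has_integral 0) {0..L}" by simp
  qed
  then have "integral {0..a} (\<lambda>z. integral {0..L} (\<lambda>y. D (0, 1, 0) (x, y, z))) = integral {0..a} (\<lambda>z. 0)" for x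
    by (intro integral_cong)
  then show ?thesis by (simp add: integral_M_iterated_y C1_continuous'[OF assms])
qed

lemma integral_partial_z:
  fixes f :: "point \<Rightarrow> 'b::euclidean_space"
  assumes "C1 f D" and bc: "\<And>x y z. z \<in> {0, a} \<Longrightarrow> f (x, y, z) = 0"
  shows "integral\<^sup>L M (D (0, 0, 1)) = 0"
proof -
  have "integral {0..a} (\<lambda>z. D (0, 0, 1) (x, y, z)) = 0" for x y
  proof (rule integral_unique)
    have "((\<lambda>z. D (0, 0, 1) (x, y, z)) has_integral (f (x, y, a) - f (x, y, 0))) {0..a}"
    proof (rule fundamental_theorem_of_calculus)
      show "((\<lambda>z. f (x, y, z)) has_vector_derivative D (0, 0, 1) (x, y, z)) (at z within {0..a})"
        if "z \<in> {0..a}" for z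
        using that by (intro C1_path[OF assms(1)]) (auto intro!: derivative_eq_intros simp: zero_prod_def)
    qed (use a in simp)
    then show "((\<lambda>z. D (0, 0, 1) (x, y, z)) has_integral 0) {0..a}" by (simp add: bc)
  qed
  then show ?thesis by (simp add: integral_M_iterated C1_continuous'[OF assms(1)])
qed

text \<open>The derivative of the product integrates to zero, laterally by periodicity and in z
  because the product vanishes on the plates. Only the product has to vanish there, so the boundary
  condition may come from either factor: a test function or a PEC field.\<close>

lemma integral_by_parts:
  fixes f g :: "point \<Rightarrow> complex"
  assumes f: "C1 f D" and g: "C1 g D'"
  shows "(\<integral>p. D (1, 0, 0) p * g p \<partial>M) = - (\<integral>p. f p * D' (1, 0, 0) p \<partial>M)"
    and "(\<integral>p. D (0, 1, 0) p * g p \<partial>M) = - (\<integral>p. f p * D' (0, 1, 0) p \<partial>M)"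
    and "(\<And>x y z. z \<in> {0, a} \<Longrightarrow> f (x, y, z) * g (x, y, z) = 0) \<Longrightarrow>
      (\<integral>p. D (0, 0, 1) p * g p \<partial>M) = - (\<integral>p. f p * D' (0, 0, 1) p \<partial>M)"
proof -
  note fg = C1_mult[OF f g]
  have add: "(\<integral>p. f p * D' h p + D h p * g p \<partial>M) = (\<integral>p. f p * D' h p \<partial>M) + (\<integral>p. D h p * g p \<partial>M)" for h
    by (intro Bochner_Integration.integral_add continuous_integrable_M continuous_intros
        C1_continuous[OF f] C1_continuous[OF g] C1_continuous'[OF f] C1_continuous'[OF g])
  show "(\<integral>p. D (1, 0, 0) p * g p \<partial>M) = - (\<integral>p. f p * D' (1, 0, 0) p \<partial>M)"
    using integral_partial_x[OF fg] unfolding add by (simp add: add_eq_0_iff)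
  show "(\<integral>p. D (0, 1, 0) p * g p \<partial>M) = - (\<integral>p. f p * D' (0, 1, 0) p \<partial>M)"
    using integral_partial_y[OF fg] unfolding add by (simp add: add_eq_0_iff)
  show "(\<integral>p. D (0, 0, 1) p * g p \<partial>M) = - (\<integral>p. f p * D' (0, 0, 1) p \<partial>M)"
    if "\<And>x y z. z \<in> {0, a} \<Longrightarrow> f (x, y, z) * g (x, y, z) = 0"
    using integral_partial_z[OF fg that] unfolding add by (simp add: add_eq_0_iff)
qed

text \<open>The curl read off a derivative witness. It agrees with \<open>curl\<close> where a full
  derivative exists, and it also makes sense on the plates, where only one-sided derivatives are
  given.\<close>

definition curl_of :: "(point \<Rightarrow> point \<Rightarrow> complex^3) \<Rightarrow> point \<Rightarrow> complex^3" where
  "curl_of D p = vector [D (0, 1, 0) p $ 3 - D (0, 0, 1) p $ 2,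
     D (0, 0, 1) p $ 1 - D (1, 0, 0) p $ 3, D (1, 0, 0) p $ 2 - D (0, 1, 0) p $ 1]"

lemma C1_component:
  fixes f :: "point \<Rightarrow> complex^3"
  shows "C1 f D \<Longrightarrow> C1 (\<lambda>p. f p $ j) (\<lambda>h p. D h p $ j)"
  unfolding C1_def lat_periodic_def
  by (auto intro!: bounded_linear.has_derivative[OF bounded_linear_vec_nth]
      bounded_linear.continuous_on[OF bounded_linear_vec_nth])

lemma curl_of_continuous:
  assumes "C1 f D"
  shows "continuous_on cell (curl_of D)"
proof -
  have "continuous_on cell (\<lambda>p. curl_of D p $ j)" for j
    using exhaust_3[of j] C1_continuous'[OF C1_component[OF assms]]
    by (auto simp: curl_of_def intro!: continuous_on_diff)
  then show ?thesis using Ck_on_vec[of 0 cell "curl_of D"] by simp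
qed

lemma bdot_3: "bdot u v = u $ 1 * v $ 1 + u $ 2 * v $ 2 + u $ 3 * v $ 3"
  by (simp add: bdot_def sum_3)

text \<open>Only two of the six terms contain z-derivatives, and these involve tangential components
  alone. Vanishing tangential components of either field therefore remove all boundary
  terms.\<close>

lemma integral_curl_by_parts:
  assumes f: "C1 f D" and g: "C1 g D'"
    and bc: "\<And>x y z. z \<in> {0, a} \<Longrightarrow> f (x, y, z) $ 1 * g (x, y, z) $ 2 = 0"
      "\<And>x y z. z \<in> {0, a} \<Longrightarrow> f (x, y, z) $ 2 * g (x, y, z) $ 1 = 0"
  shows "(\<integral>p. bdot (f p) (curl_of D' p) \<partial>M) = (\<integral>p. bdot (curl_of D p) (g p) \<partial>M)"
proof -
  note fj = C1_component[OF f] and gj = C1_component[OF g]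
  have i: "integrable M (\<lambda>p. f p $ i * D' h p $ j)" "integrable M (\<lambda>p. D h p $ i * g p $ j)" for i j h
    by (intro continuous_integrable_M continuous_intros C1_continuous[OF fj] C1_continuous[OF gj]
        C1_continuous'[OF fj] C1_continuous'[OF gj])+
  have "(\<integral>p. D (0, 0, 1) p $ 1 * g p $ 2 \<partial>M) = - (\<integral>p. f p $ 1 * D' (0, 0, 1) p $ 2 \<partial>M)"
    "(\<integral>p. D (0, 0, 1) p $ 2 * g p $ 1 \<partial>M) = - (\<integral>p. f p $ 2 * D' (0, 0, 1) p $ 1 \<partial>M)"
    using bc by (intro integral_by_parts(3)[OF fj gj]; blast)+
  note parts = integral_by_parts(1,2)[OF fj gj] this
  show ?thesis
    by (simp add: bdot_3 curl_of_def left_diff_distrib right_diff_distrib i parts)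
qed

definition grad_of :: "(point \<Rightarrow> point \<Rightarrow> complex) \<Rightarrow> point \<Rightarrow> complex^3" where
  "grad_of D p = vector [D (1, 0, 0) p, D (0, 1, 0) p, D (0, 0, 1) p]"

lemma integral_grad_by_parts:
  assumes f: "C1 f D" and g: "C1 g D'"
    and bc: "\<And>x y z. z \<in> {0, a} \<Longrightarrow> g (x, y, z) = 0"
  shows "(\<integral>p. bdot (f p) (grad_of D' p) \<partial>M) =
    - (\<integral>p. (D (1, 0, 0) p $ 1 + D (0, 1, 0) p $ 2 + D (0, 0, 1) p $ 3) * g p \<partial>M)"
proof -
  note fj = C1_component[OF f]
  have i: "integrable M (\<lambda>p. f p $ i * D' h p)" "integrable M (\<lambda>p. D h p $ i * g p)" for i h
    by (intro continuous_integrable_M continuous_intros C1_continuous[OF fj] C1_continuous[OF g]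
        C1_continuous'[OF fj] C1_continuous'[OF g])+
  have "(\<integral>p. D (0, 0, 1) p $ 3 * g p \<partial>M) = - (\<integral>p. f p $ 3 * D' (0, 0, 1) p \<partial>M)"
    using bc by (intro integral_by_parts(3)[OF fj g]) simp
  note parts = integral_by_parts(1,2)[OF fj g] this
  show ?thesis
    by (simp add: bdot_3 grad_of_def distrib_right i parts)
qed

section \<open>Classical curl and gradient in terms of derivative witnesses\<close>

lemma partial_eq: "(f has_derivative D) (at p) \<Longrightarrow> partial e f p = D e"
  unfolding partial_def by (simp flip: frechet_derivative_at)

lemma curl_eq:
  assumes "(f has_derivative (\<lambda>h. D h p)) (at p)"
  shows "curl f p = curl_of D p"
proof -
  have "partial e (\<lambda>q. f q $ j) p = D e p $ j" for e j
    by (rule partial_eq[OF bounded_linear.has_derivative[OF bounded_linear_vec_nth assms]])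
  then show ?thesis by (simp add: curl_def curl_of_def)
qed

lemma grad_eq:
  assumes "(f has_derivative (\<lambda>h. D h p)) (at p)"
  shows "grad f p = grad_of D p"
  by (simp add: grad_def grad_of_def partial_eq[OF assms])

lemma smooth_C1:
  assumes "smooth_on layer f" "lat_periodic L {0..a} f"
  obtains D where "C1 f D"
  using assms unfolding smooth_on_def C1_def
  by (auto dest!: spec[of _ "Suc 0"])

lemma smooth_UNIV_C1:
  assumes "smooth_on UNIV f" "lat_periodic L UNIV f"
  obtains D where "C1 f D" "\<And>p. (f has_derivative (\<lambda>h. D h p)) (at p)"
proof -
  have "Ck_on (Suc 0) UNIV f" using assms(1) by (simp only: smooth_on_def)
  then obtain D where "\<forall>p\<in>UNIV. (f has_derivative (\<lambda>h. D h p)) (at p)" "\<forall>h. Ck_on 0 UNIV (D h)"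
    unfolding Ck_on.simps(2) by blast
  then have D: "\<And>p. (f has_derivative (\<lambda>h. D h p)) (at p)" "\<And>h. continuous_on UNIV (D h)"
    unfolding Ck_on.simps(1) by blast+
  then have "C1 f D"
    using assms(2) unfolding C1_def lat_periodic_def
    by (auto intro: has_derivative_at_withinI continuous_on_subset[OF D(2)])
  with D show ?thesis using that by blast
qed

end

section \<open>The Fourier modes\<close>

text \<open>The lateral exponential as a function on the slab; without the factor 1/L it is
  multiplicative in \<open>m\<close>.\<close>

definition wave :: "real \<Rightarrow> int \<times> int \<Rightarrow> point \<Rightarrow> complex" where
  "wave L m p = exp (\<i> * complex_of_real (kvec L m \<bullet> (fst p, fst (snd p))))"

definition sine_mode :: "real \<Rightarrow> real \<Rightarrow> (int \<times> int) \<times> nat \<Rightarrow> point \<Rightarrow> complex" where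
  "sine_mode L a i p = phi L (fst i) (fst p, fst (snd p)) * complex_of_real (smode a (snd i) (snd (snd p)))"

definition cosine_mode :: "real \<Rightarrow> real \<Rightarrow> (int \<times> int) \<times> nat \<Rightarrow> point \<Rightarrow> complex" where
  "cosine_mode L a i p = phi L (fst i) (fst p, fst (snd p)) * complex_of_real (cmode a (snd i) (snd (snd p)))"

definition cweight :: "real \<Rightarrow> nat \<Rightarrow> real" where
  "cweight a n = (if n = 0 then 1 / sqrt a else sqrt (2 / a))"

lemma nu_0 [simp]: "nu a 0 = 0"
  by (simp add: nu_def)

lemma cmode_eq: "cmode a n z = cweight a n * cos (nu a n * z)"
  by (simp add: cmode_def cweight_def nu_def)

lemma phi_wave: "phi L m (fst p, fst (snd p)) = wave L m p / complex_of_real L"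
  by (simp add: phi_def wave_def)

lemma wave_prod:
  "wave L m (x, y, z) = exp (\<i> * complex_of_real (2 * pi / L * real_of_int (fst m) * x)) *
     exp (\<i> * complex_of_real (2 * pi / L * real_of_int (snd m) * y))"
  by (simp add: wave_def kvec_def inner_prod_def distrib_left flip: exp_add)

lemma wave_add: "wave L (m + m') p = wave L m p * wave L m' p"
  by (cases p) (simp add: wave_prod exp_add[symmetric] algebra_simps add_divide_distrib)

lemma cnj_wave: "cnj (wave L m p) = wave L (- m) p"
  by (simp add: wave_def exp_cnj kvec_def inner_prod_def algebra_simps)

lemma norm_wave [simp]: "norm (wave L m p) = 1"
  by (simp add: wave_def norm_exp_i_times)

lemma wave_continuous [continuous_intros]: "continuous_on S (wave L m)"
  unfolding wave_def by (intro continuous_intros)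

lemma sine_mode_continuous [continuous_intros]: "continuous_on S (sine_mode L a i)"
  unfolding sine_mode_def phi_wave smode_def divide_inverse by (intro continuous_intros)

lemma cosine_mode_continuous [continuous_intros]: "continuous_on S (cosine_mode L a i)"
  unfolding cosine_mode_def phi_wave cmode_eq divide_inverse by (intro continuous_intros)

lemma cnj_sine_mode: "cnj (sine_mode L a (m, n) p) = sine_mode L a (- m, n) p"
  by (simp add: sine_mode_def phi_wave cnj_wave)

lemma cnj_cosine_mode: "cnj (cosine_mode L a (m, n) p) = cosine_mode L a (- m, n) p"
  by (simp add: cosine_mode_def phi_wave cnj_wave)

context slab
begin

subsection \<open>Orthonormality\<close>

lemma integral_exp_lateral:
  "integral {0..L} (\<lambda>x. exp (\<i> * complex_of_real (2 * pi / L * real_of_int j * x))) = (if j = 0 then complex_of_real L else 0)"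
proof (cases "j = 0")
  case False
  define c where "c = \<i> * complex_of_real (2 * pi / L * real_of_int j)"
  have c: "c \<noteq> 0" using False L by (simp add: c_def)
  have "((\<lambda>x. exp (c * complex_of_real x)) has_integral (exp (c * complex_of_real L) / c - exp (c * complex_of_real 0) / c)) {0..L}"
  proof (rule fundamental_theorem_of_calculus)
    fix x
    have "((\<lambda>w. exp (c * w) / c) has_field_derivative exp (c * complex_of_real x)) (at (complex_of_real x))"
      using c by (auto intro!: derivative_eq_intros)
    then show "((\<lambda>x. exp (c * complex_of_real x) / c) has_vector_derivative exp (c * complex_of_real x)) (at x within {0..L})"
      by (rule has_vector_derivative_real_field)
  qed (use L in simp)
  moreover have "exp (c * complex_of_real L) = 1"
  proof -
    have "c * complex_of_real L = of_int (2 * j) * (of_real pi * \<i>)"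
      using L by (simp add: c_def field_simps)
    then show ?thesis by (auto simp: exp_eq_1)
  qed
  ultimately have "((\<lambda>x. exp (c * complex_of_real x)) has_integral 0) {0..L}" by simp
  then show ?thesis using False by (simp add: integral_unique c_def mult.assoc)
qed (use L in \<open>simp add: scaleR_conv_of_real\<close>)

lemma integral_cos_plate:
  "integral {0..a} (\<lambda>z. cos (pi * real_of_int j / a * z)) = (if j = 0 then a else 0)"
proof (cases "j = 0")
  case False
  define c where "c = pi * real_of_int j / a"
  have c: "c \<noteq> 0" using False a by (simp add: c_def)
  have "((\<lambda>z. cos (c * z)) has_integral (sin (c * a) / c - sin (c * 0) / c)) {0..a}"
  proof (rule fundamental_theorem_of_calculus)
    show "((\<lambda>z. sin (c * z) / c) has_vector_derivative cos (c * z)) (at z within {0..a})" for z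
      unfolding has_real_derivative_iff_has_vector_derivative[symmetric]
      using c by (auto intro!: derivative_eq_intros)
  qed (use a in simp)
  moreover have "sin (c * a) = 0"
    using a sin_int_times_real[of j pi] by (simp add: c_def mult.commute sin_zero_iff_int2)
  ultimately have "((\<lambda>z. cos (c * z)) has_integral 0) {0..a}" by simp
  then show ?thesis using False by (simp add: integral_unique c_def)
qed (use a in simp)

text \<open>In the product-to-sum formula the term with the sum of frequencies survives only for n =
  n' = 0. It doubles the integral there, which the different normalisation of \<open>cmode\<close>
  at 0 compensates.\<close>

lemma integral_cos_cos:
  "integral {0..a} (\<lambda>z. cos (nu a n * z) * cos (nu a n' * z)) =
    a / 2 * ((if n = n' then 1 else 0) + (if n + n' = 0 then 1 else 0))"
proof -
  have "cos (nu a n * z) * cos (nu a n' * z) =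
      (cos (pi * real_of_int (int n - int n') / a * z) + cos (pi * real_of_int (int n + int n') / a * z)) / 2" for z
    using a by (simp add: cos_times_cos nu_def diff_divide_distrib add_divide_distrib algebra_simps)
  moreover have "integral {0..a} (\<lambda>z. (cos (pi * real_of_int (int n - int n') / a * z) +
        cos (pi * real_of_int (int n + int n') / a * z)) / 2) =
      (integral {0..a} (\<lambda>z. cos (pi * real_of_int (int n - int n') / a * z)) +
       integral {0..a} (\<lambda>z. cos (pi * real_of_int (int n + int n') / a * z))) / 2"
    unfolding integral_divide
    by (subst Henstock_Kurzweil_Integration.integral_add)
       (use a in \<open>auto intro!: integrable_continuous_real continuous_intros\<close>)
  ultimately show ?thesis by (simp only: integral_cos_plate) (simp add: field_simps)
qed

lemma integral_sin_sin:
  "integral {0..a} (\<lambda>z. sin (nu a n * z) * sin (nu a n' * z)) =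
    a / 2 * ((if n = n' then 1 else 0) - (if n + n' = 0 then 1 else 0))"
proof -
  have "sin (nu a n * z) * sin (nu a n' * z) =
      (cos (pi * real_of_int (int n - int n') / a * z) - cos (pi * real_of_int (int n + int n') / a * z)) / 2" for z
    using a by (simp add: sin_times_sin nu_def diff_divide_distrib add_divide_distrib algebra_simps)
  moreover have "integral {0..a} (\<lambda>z. (cos (pi * real_of_int (int n - int n') / a * z) -
        cos (pi * real_of_int (int n + int n') / a * z)) / 2) =
      (integral {0..a} (\<lambda>z. cos (pi * real_of_int (int n - int n') / a * z)) -
       integral {0..a} (\<lambda>z. cos (pi * real_of_int (int n + int n') / a * z))) / 2"
    unfolding integral_divide
    by (subst Henstock_Kurzweil_Integration.integral_diff)
       (use a in \<open>auto intro!: integrable_continuous_real continuous_intros\<close>)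
  ultimately show ?thesis by (simp only: integral_cos_plate) (simp add: field_simps)
qed

lemma integral_wave_product:
  fixes h :: "real \<Rightarrow> real"
  assumes "continuous_on {0..a} h"
  shows "(\<integral>p. wave L m p * cnj (wave L m' p) * complex_of_real (h (snd (snd p))) \<partial>M) =
    (if m = m' then complex_of_real (L\<^sup>2 * integral {0..a} h) else 0)"
proof -
  have "(\<lambda>p. wave L m p * cnj (wave L m' p) * complex_of_real (h (snd (snd p)))) =
    (\<lambda>(x, y, z). exp (\<i> * complex_of_real (2 * pi / L * real_of_int (fst (m - m')) * x)) *
      exp (\<i> * complex_of_real (2 * pi / L * real_of_int (snd (m - m')) * y)) * complex_of_real (h z))"
    unfolding cnj_wave wave_add[symmetric] diff_conv_add_uminus[symmetric]
    by (auto simp: fun_eq_iff wave_prod)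
  moreover have "integral {0..a} (\<lambda>z. complex_of_real (h z)) = complex_of_real (integral {0..a} h)"
    using integral_linear[OF integrable_continuous_real[OF assms] bounded_linear_of_real]
    by (simp add: o_def)
  ultimately show ?thesis
    using assms
    by (simp only: integral_M_prod continuous_intros integral_exp_lateral)
       (auto simp: integral_M_prod integral_exp_lateral prod_eq_iff power2_eq_square intro!: continuous_intros)
qed

lemma inner2_weighted_waves:
  fixes h h' :: "real \<Rightarrow> real" and w w' :: real
  assumes "continuous_on {0..a} h" "continuous_on {0..a} h'"
  shows "inner2 M (\<lambda>p. wave L m p / complex_of_real L * complex_of_real (w * h (snd (snd p))))
      (\<lambda>p. wave L m' p / complex_of_real L * complex_of_real (w' * h' (snd (snd p)))) =
    (if m = m' then complex_of_real (w * w' * integral {0..a} (\<lambda>z. h z * h' z)) else 0)"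
proof -
  have c: "continuous_on {0..a} (\<lambda>z. h z * h' z)"
    using assms by (intro continuous_intros)
  have "inner2 M (\<lambda>p. wave L m p / complex_of_real L * complex_of_real (w * h (snd (snd p))))
      (\<lambda>p. wave L m' p / complex_of_real L * complex_of_real (w' * h' (snd (snd p)))) =
    (\<integral>p. complex_of_real (w * w' / L\<^sup>2) * (wave L m p * cnj (wave L m' p) *
        complex_of_real (h (snd (snd p)) * h' (snd (snd p)))) \<partial>M)"
    unfolding inner2_def
    by (intro Bochner_Integration.integral_cong refl) (simp add: power2_eq_square)
  also have "\<dots> = complex_of_real (w * w' / L\<^sup>2) *
      (if m = m' then complex_of_real (L\<^sup>2 * integral {0..a} (\<lambda>z. h z * h' z)) else 0)"
    unfolding integral_wave_product[OF c, symmetric] by simp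
  also have "\<dots> = (if m = m' then complex_of_real (w * w' * integral {0..a} (\<lambda>z. h z * h' z)) else 0)"
    using L by simp
  finally show ?thesis .
qed

lemma inner2_cosine_mode:
  "inner2 M (cosine_mode L a i) (cosine_mode L a j) = (if i = j then 1 else 0)"
proof -
  obtain m n m' n' where ij: "i = (m, n)" "j = (m', n')" by (cases i, cases j)
  have w: "cweight a n * cweight a n' * integral {0..a} (\<lambda>z. cos (nu a n * z) * cos (nu a n' * z)) =
      (if n = n' then 1 else 0)"
    unfolding integral_cos_cos using a by (auto simp: cweight_def)
  have "inner2 M (cosine_mode L a i) (cosine_mode L a j) = (if m = m' then complex_of_real
      (cweight a n * cweight a n' * integral {0..a} (\<lambda>z. cos (nu a n * z) * cos (nu a n' * z))) else 0)"
    unfolding ij cosine_mode_def[abs_def] phi_wave cmode_eq fst_conv snd_conv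
    by (rule inner2_weighted_waves) (intro continuous_intros)+
  then show ?thesis unfolding w by (simp add: ij)
qed

lemma inner2_sine_mode:
  assumes "snd i \<ge> 1"
  shows "inner2 M (sine_mode L a i) (sine_mode L a j) = (if i = j then 1 else 0)"
proof -
  obtain m n m' n' where ij: "i = (m, n)" "j = (m', n')" by (cases i, cases j)
  have w: "sqrt (2 / a) * sqrt (2 / a) * integral {0..a} (\<lambda>z. sin (nu a n * z) * sin (nu a n' * z)) =
      (if n = n' then 1 else 0)"
    unfolding integral_sin_sin using a assms by (auto simp: ij)
  have "inner2 M (sine_mode L a i) (sine_mode L a j) = (if m = m' then complex_of_real
      (sqrt (2 / a) * sqrt (2 / a) * integral {0..a} (\<lambda>z. sin (nu a n * z) * sin (nu a n' * z))) else 0)"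
    unfolding ij sine_mode_def[abs_def] phi_wave smode_def fst_conv snd_conv
    by (rule inner2_weighted_waves) (intro continuous_intros)+
  then show ?thesis unfolding w by (simp add: ij)
qed

subsection \<open>Completeness\<close>

text \<open>Cosine modes without normalisation. Multiplied by the lowest cosine in z or by a lateral
  sine or cosine they become combinations of at most two such modes.\<close>

definition raw_mode :: "(int \<times> int) \<times> nat \<Rightarrow> point \<Rightarrow> complex" where
  "raw_mode i p = wave L (fst i) p * complex_of_real (cos (nu a (snd i) * snd (snd p)))"

text \<open>Posed in L1 with a bilinear pairing. Conjugating a mode merely replaces \<open>m\<close>
  by \<open>- m\<close>, so for square-integrable functions this is also orthogonality to all
  modes.\<close>

definition annihilated :: "(point \<Rightarrow> complex) \<Rightarrow> bool" where
  "annihilated f \<longleftrightarrow> integrable M f \<and> (\<forall>i. (\<integral>p. f p * raw_mode i p \<partial>M) = 0)"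

text \<open>
  The functions that multiply the annihilator of the modes into itself form an algebra which is
  closed under bounded pointwise limits. It contains the coordinates, hence the indicators of all
  Borel sets, so an annihilated function has zero integral over every Borel set.
\<close>

definition multiplier :: "(point \<Rightarrow> real) \<Rightarrow> bool" where
  "multiplier h \<longleftrightarrow> h \<in> borel_measurable borel \<and> (\<exists>B. \<forall>p\<in>cell. \<bar>h p\<bar> \<le> B) \<and>
     (\<forall>f. annihilated f \<longrightarrow> annihilated (\<lambda>p. f p * complex_of_real (h p)))"

lemma raw_mode_continuous [continuous_intros]: "continuous_on S (raw_mode i)"
  unfolding raw_mode_def by (intro continuous_intros)

lemma norm_raw_mode: "norm (raw_mode i p) \<le> 1"
  by (simp add: raw_mode_def norm_mult)

lemma integrable_mult_bounded:
  assumes f: "integrable M f" and h: "h \<in> borel_measurable M" and B: "\<And>p. p \<in> cell \<Longrightarrow> norm (h p) \<le> B"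
  shows "integrable M (\<lambda>p. f p * h p :: complex)"
proof (rule Bochner_Integration.integrable_bound)
  show "integrable M (\<lambda>p. B * norm (f p))" using f by simp
  show "(\<lambda>p. f p * h p) \<in> borel_measurable M" using f h by simp
  show "AE p in M. norm (f p * h p) \<le> norm (B * norm (f p))"
  proof (rule AE_I2)
    fix p assume "p \<in> space M"
    then have "norm (h p) \<le> \<bar>B\<bar>" using B[of p] by (simp add: space_M)
    then show "norm (f p * h p) \<le> norm (B * norm (f p))"
      using mult_left_mono[of "norm (h p)" "\<bar>B\<bar>" "norm (f p)"]
      by (simp add: norm_mult abs_mult mult.commute)
  qed
qed

lemma integrable_raw_mode: "integrable M f \<Longrightarrow> integrable M (\<lambda>p. f p * raw_mode i p)"
  by (rule integrable_mult_bounded[where B = 1])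
     (auto intro!: continuous_measurable_M continuous_intros norm_raw_mode)

lemma annihilated_add: "annihilated f \<Longrightarrow> annihilated g \<Longrightarrow> annihilated (\<lambda>p. f p + g p)"
  unfolding annihilated_def
  by (simp add: distrib_right integrable_raw_mode)

lemma annihilated_cmult: "annihilated f \<Longrightarrow> annihilated (\<lambda>p. c * f p)"
  unfolding annihilated_def by (simp add: mult.assoc)

lemma multiplierD:
  assumes "multiplier h"
  shows "h \<in> borel_measurable borel" "h \<in> borel_measurable M" "annihilated f \<Longrightarrow> annihilated (\<lambda>p. f p * complex_of_real (h p))"
  using assms measurable_M by (auto simp: multiplier_def)

lemma multiplier_bound:
  assumes "multiplier h"
  shows "\<exists>B>0. \<forall>p\<in>cell. \<bar>h p\<bar> \<le> B"
proof -
  obtain B where "\<forall>p\<in>cell. \<bar>h p\<bar> \<le> B" using assms unfolding multiplier_def by blast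
  then have "\<forall>p\<in>cell. \<bar>h p\<bar> \<le> max B 1" by (auto simp: le_max_iff_disj)
  then show ?thesis by (intro exI[of _ "max B 1"]) auto
qed

lemma multiplier_const: "multiplier (\<lambda>p. c)"
  unfolding multiplier_def
  by (auto simp: mult.commute[of _ "complex_of_real c"] intro: annihilated_cmult)

lemma multiplier_mult:
  assumes "multiplier g" "multiplier h"
  shows "multiplier (\<lambda>p. g p * h p)"
proof -
  obtain B where B: "\<And>p. p \<in> cell \<Longrightarrow> \<bar>g p\<bar> \<le> B" "B > 0" using multiplier_bound[OF assms(1)] by blast
  obtain C where C: "\<And>p. p \<in> cell \<Longrightarrow> \<bar>h p\<bar> \<le> C" "C > 0" using multiplier_bound[OF assms(2)] by blast
  have "\<bar>g p * h p\<bar> \<le> B * C" if "p \<in> cell" for p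
    using B(1)[OF that] C(1)[OF that] by (auto simp: abs_mult intro!: mult_mono)
  moreover have "annihilated (\<lambda>p. f p * complex_of_real (g p * h p))" if "annihilated f" for f
    using multiplierD(3)[OF assms(2) multiplierD(3)[OF assms(1) that]] by (simp add: mult.assoc)
  moreover have "(\<lambda>p. g p * h p) \<in> borel_measurable borel"
    using multiplierD(1)[OF assms(1)] multiplierD(1)[OF assms(2)] by (rule borel_measurable_times)
  ultimately show ?thesis unfolding multiplier_def by blast
qed

lemma multiplier_add:
  assumes "multiplier g" "multiplier h"
  shows "multiplier (\<lambda>p. g p + h p)"
proof -
  obtain B where B: "\<And>p. p \<in> cell \<Longrightarrow> \<bar>g p\<bar> \<le> B" "B > 0" using multiplier_bound[OF assms(1)] by blast
  obtain C where C: "\<And>p. p \<in> cell \<Longrightarrow> \<bar>h p\<bar> \<le> C" "C > 0" using multiplier_bound[OF assms(2)] by blast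
  have "\<bar>g p + h p\<bar> \<le> B + C" if "p \<in> cell" for p
    using B(1)[OF that] C(1)[OF that] by linarith
  moreover have "annihilated (\<lambda>p. f p * complex_of_real (g p + h p))" if "annihilated f" for f
    using annihilated_add[OF multiplierD(3)[OF assms(1) that] multiplierD(3)[OF assms(2) that]]
    by (simp add: distrib_left)
  moreover have "(\<lambda>p. g p + h p) \<in> borel_measurable borel"
    using multiplierD(1)[OF assms(1)] multiplierD(1)[OF assms(2)] by (rule borel_measurable_add)
  ultimately show ?thesis unfolding multiplier_def by blast
qed

text \<open>Dominated convergence with majorant \<open>B * norm (f p)\<close>: the modes have
  modulus at most 1 and the multipliers are uniformly bounded on the cell.\<close>

lemma multiplier_limit:
  assumes s: "\<And>k. multiplier (s k)" and h: "h \<in> borel_measurable borel"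
    and B: "\<And>k p. p \<in> cell \<Longrightarrow> \<bar>s k p\<bar> \<le> B" and Bh: "\<And>p. p \<in> cell \<Longrightarrow> \<bar>h p\<bar> \<le> B"
    and lim: "AE p in M. (\<lambda>k. s k p) \<longlonglongrightarrow> h p"
  shows "multiplier h"
proof -
  note [measurable] = multiplierD(2)[OF s] measurable_M[OF h]
  have "annihilated (\<lambda>p. f p * complex_of_real (h p))" if f: "annihilated f" for f
  proof -
    have fi: "integrable M f" using f by (simp add: annihilated_def)
    then have [measurable]: "f \<in> borel_measurable M" by simp
    have hi: "integrable M (\<lambda>p. f p * complex_of_real (h p))"
      by (rule integrable_mult_bounded[OF fi, where B = B]) (auto intro: Bh)
    have "(\<integral>p. f p * complex_of_real (h p) * raw_mode i p \<partial>M) = 0" for i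
    proof -
      have [measurable]: "raw_mode i \<in> borel_measurable M"
        by (intro continuous_measurable_M continuous_intros)
      have "(\<lambda>k. \<integral>p. f p * complex_of_real (s k p) * raw_mode i p \<partial>M) \<longlonglongrightarrow>
          (\<integral>p. f p * complex_of_real (h p) * raw_mode i p \<partial>M)"
      proof (rule integral_dominated_convergence)
        show "integrable M (\<lambda>p. B * norm (f p))" using fi by simp
        show "AE p in M. (\<lambda>k. f p * complex_of_real (s k p) * raw_mode i p) \<longlonglongrightarrow>
            f p * complex_of_real (h p) * raw_mode i p"
          using lim by eventually_elim (intro tendsto_intros)
        show "AE p in M. norm (f p * complex_of_real (s k p) * raw_mode i p) \<le> B * norm (f p)" for k
        proof (rule AE_I2)
          fix p assume "p \<in> space M"
          then have "\<bar>s k p\<bar> * norm (raw_mode i p) \<le> B * 1"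
            using B[of p k] by (intro mult_mono norm_raw_mode) (auto simp: space_M)
          then show "norm (f p * complex_of_real (s k p) * raw_mode i p) \<le> B * norm (f p)"
            using mult_left_mono[of "\<bar>s k p\<bar> * norm (raw_mode i p)" "B * 1" "norm (f p)"]
            by (simp add: norm_mult mult.assoc mult.commute[of B])
        qed
      qed simp_all
      moreover have "(\<integral>p. f p * complex_of_real (s k p) * raw_mode i p \<partial>M) = 0" for k
        using multiplierD(3)[OF s f] unfolding annihilated_def by blast
      ultimately show ?thesis by (simp add: LIMSEQ_const_iff)
    qed
    with hi show ?thesis by (simp add: annihilated_def)
  qed
  then show ?thesis using h Bh unfolding multiplier_def by blast
qed

lemma multiplier_cong_AE:
  assumes "multiplier g" "h \<in> borel_measurable borel" "\<And>p. p \<in> cell \<Longrightarrow> \<bar>h p\<bar> \<le> B" "AE p in M. g p = h p"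
  shows "multiplier h"
proof -
  obtain C where C: "\<And>p. p \<in> cell \<Longrightarrow> \<bar>g p\<bar> \<le> C" "C > 0" using multiplier_bound[OF assms(1)] by blast
  show ?thesis
  proof (rule multiplier_limit[where s = "\<lambda>_. g"])
    show "AE p in M. (\<lambda>k. g p) \<longlonglongrightarrow> h p"
      using assms(4) by eventually_elim simp
    show "\<bar>g p\<bar> \<le> max B C" "\<bar>h p\<bar> \<le> max B C" if "p \<in> cell" for p
      using C(1)[OF that] assms(3)[OF that] by auto
  qed (use assms(1,2) in simp_all)
qed

text \<open>Polynomials in a multiplier are multipliers, because these form an algebra. On a compact
  interval containing the values of \<open>h\<close> on the cell, Weierstrass approximates
  \<open>g\<close> uniformly by polynomials, and the limit is again a multiplier.\<close>

lemma multiplier_compose: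
  fixes g :: "real \<Rightarrow> real"
  assumes h: "multiplier h" and "continuous_on UNIV g"
  shows "multiplier (\<lambda>p. g (h p))"
proof -
  obtain u where u: "\<And>p. p \<in> cell \<Longrightarrow> \<bar>h p\<bar> \<le> u" using multiplier_bound[OF h] by blast
  define l where "l = - u"
  have hb: "h p \<in> {l..u}" if "p \<in> cell" for p using u[OF that] by (auto simp: l_def)
  have g: "continuous_on {l..u} g" "g \<in> borel_measurable borel"
    using assms(2) by (auto intro: continuous_on_subset borel_measurable_continuous_onI)
  have poly: "multiplier (\<lambda>p. q (h p))" if "real_polynomial_function q" for q
    using that
  proof induction
    case (linear q)
    then have "q t = t * q 1" for t
      using linear_scale[OF bounded_linear.linear[OF linear], of t 1] by simp
    then have "(\<lambda>p. q (h p)) = (\<lambda>p. h p * q 1)" by (intro ext)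
    then show ?case using multiplier_mult[OF h multiplier_const] by (simp only:)
  qed (auto intro: multiplier_const multiplier_add multiplier_mult)
  have "\<forall>k. \<exists>q. real_polynomial_function q \<and> (\<forall>t\<in>{l..u}. \<bar>g t - q t\<bar> < 1 / real (Suc k))"
    using Stone_Weierstrass_real_polynomial_function[OF compact_Icc g(1), of "1 / real (Suc _)"]
    by (intro allI) (metis (full_types) of_nat_0_less_iff zero_less_Suc zero_less_divide_1_iff)
  from choice[OF this] obtain q where "\<forall>k. real_polynomial_function (q k) \<and>
      (\<forall>t\<in>{l..u}. \<bar>g t - q k t\<bar> < 1 / real (Suc k))" by (elim exE)
  then have q: "\<And>k. real_polynomial_function (q k)"
    and qg: "\<And>k t. t \<in> {l..u} \<Longrightarrow> \<bar>g t - q k t\<bar> < 1 / real (Suc k)"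
    by blast+
  obtain C where "\<forall>t\<in>{l..u}. \<bar>g t\<bar> \<le> C"
    using compact_imp_bounded[OF compact_continuous_image[OF g(1) compact_Icc]]
    by (auto simp: bounded_iff)
  then have C: "\<And>t. t \<in> {l..u} \<Longrightarrow> \<bar>g t\<bar> \<le> C" by blast
  show ?thesis
  proof (rule multiplier_limit)
    show "multiplier (\<lambda>p. q k (h p))" for k by (rule poly[OF q])
    show "(\<lambda>p. g (h p)) \<in> borel_measurable borel"
      using measurable_compose[OF multiplierD(1)[OF h] g(2)] by (simp add: o_def)
    show "\<bar>q k (h p)\<bar> \<le> C + 1" if "p \<in> cell" for k p
    proof -
      have "1 / real (Suc k) \<le> 1" by simp
      with qg[OF hb[OF that], of k] C[OF hb[OF that]] show ?thesis by linarith
    qed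
    show "\<bar>g (h p)\<bar> \<le> C + 1" if "p \<in> cell" for p
      using C[OF hb[OF that]] by simp
    show "AE p in M. (\<lambda>k. q k (h p)) \<longlonglongrightarrow> g (h p)"
    proof (rule AE_I2)
      fix p assume "p \<in> space M"
      then have p: "h p \<in> {l..u}" using hb by (simp add: space_M)
      have "(\<lambda>k. q k (h p) - g (h p)) \<longlonglongrightarrow> 0"
      proof (rule Lim_null_comparison[OF _ LIMSEQ_inverse_Suc])
        show "\<forall>\<^sub>F k in sequentially. norm (q k (h p) - g (h p)) \<le> 1 / real (Suc k)"
          using qg[OF p] by (intro always_eventually allI) (simp add: abs_minus_commute less_imp_le)
      qed
      then show "(\<lambda>k. q k (h p)) \<longlonglongrightarrow> g (h p)" by (simp add: LIM_zero_iff)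
    qed
  qed
qed

text \<open>Continuous ramps that start at level \<open>c\<close> with slope \<open>k\<close> and
  are capped at 1 converge pointwise to the indicator of the superlevel set.\<close>

lemma multiplier_greater:
  assumes h: "multiplier h"
  shows "multiplier (indicator {p. h p > c})"
proof -
  define g where "g k t = max 0 (min 1 (real k * (t - c)))" for k t
  show ?thesis
  proof (rule multiplier_limit[where s = "\<lambda>k p. g k (h p)" and B = 1])
    show "multiplier (\<lambda>p. g k (h p))" for k
      by (rule multiplier_compose[OF h]) (auto simp: g_def intro!: continuous_intros)
    show "indicator {p. h p > c} \<in> borel_measurable borel"
      using multiplierD(1)[OF h] by measurable
    show "AE p in M. (\<lambda>k. g k (h p)) \<longlonglongrightarrow> indicator {p. h p > c} p"
    proof (rule AE_I2)
      fix p
      show "(\<lambda>k. g k (h p)) \<longlonglongrightarrow> indicator {p. h p > c} p"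
      proof (cases "h p > c")
        case True
        obtain K where K: "1 / (h p - c) \<le> real K" using real_arch_simple by blast
        have "g k (h p) = 1" if "k \<ge> K" for k
        proof -
          have "1 / (h p - c) \<le> real k" using K that by linarith
          with True have "1 \<le> real k * (h p - c)" by (simp add: field_simps)
          then show ?thesis by (simp add: g_def)
        qed
        then have "\<forall>\<^sub>F k in sequentially. g k (h p) = 1"
          by (auto simp: eventually_sequentially)
        then show ?thesis using True by (simp add: tendsto_eventually)
      next
        case False
        then have "g k (h p) = 0" for k 
            using mult_nonneg_nonpos[of "real k" "h p - c"] by (simp add: g_def min_def max_def)
        with False show ?thesis by simp
      qed
    qed
  qed (auto simp: g_def)
qed

text \<open>Multiplication by such an \<open>h\<close> sends each mode to a combination of two
  modes, so the pairings of \<open>f * h\<close> with modes reduce to pairings of \<open>f\<close>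
  with modes.\<close>

lemma multiplier_of_products:
  assumes h: "continuous_on UNIV h" and B: "\<And>p. \<bar>h p\<bar> \<le> B"
    and prod: "\<And>i. \<exists>c d j k. \<forall>p. complex_of_real (h p) * raw_mode i p = c * raw_mode j p + d * raw_mode k p"
  shows "multiplier h"
proof -
  have hb: "h \<in> borel_measurable borel" using h by (rule borel_measurable_continuous_onI)
  have "annihilated (\<lambda>p. f p * complex_of_real (h p))" if f: "annihilated f" for f
  proof -
    have fi: "integrable M f" using f by (simp add: annihilated_def)
    have "(\<integral>p. f p * complex_of_real (h p) * raw_mode i p \<partial>M) = 0" for i
    proof -
      obtain c d j k where e: "\<And>p. complex_of_real (h p) * raw_mode i p = c * raw_mode j p + d * raw_mode k p"
        using prod[of i] by blast
      have "(\<integral>p. f p * complex_of_real (h p) * raw_mode i p \<partial>M) =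
          (\<integral>p. c * (f p * raw_mode j p) + d * (f p * raw_mode k p) \<partial>M)"
        by (simp add: mult.assoc e) (simp add: algebra_simps)
      also have "\<dots> = c * (\<integral>p. f p * raw_mode j p \<partial>M) + d * (\<integral>p. f p * raw_mode k p \<partial>M)"
        by (simp add: integrable_raw_mode fi)
      also have "\<dots> = 0" using f[unfolded annihilated_def] by (simp only: mult_zero_right add_0_left)
      finally show ?thesis .
    qed
    moreover have "integrable M (\<lambda>p. f p * complex_of_real (h p))"
      by (rule integrable_mult_bounded[OF fi, where B = B]) (use measurable_M[OF hb] B in auto)
    ultimately show ?thesis by (simp add: annihilated_def)
  qed
  with hb B show ?thesis unfolding multiplier_def by blast
qed

section \<open>Trigonometric functions and coordinates as multipliers\<close>

lemma cos_wave:
  "complex_of_real (cos (kvec L m \<bullet> (fst p, fst (snd p)))) = (wave L m p + wave L (- m) p) / 2"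
  unfolding cnj_wave[symmetric] by (simp add: wave_def cos_of_real[symmetric] cos_exp_eq exp_cnj)

lemma sin_wave:
  "complex_of_real (sin (kvec L m \<bullet> (fst p, fst (snd p)))) = (wave L m p - wave L (- m) p) / (2 * \<i>)"
  unfolding cnj_wave[symmetric] by (simp add: wave_def sin_of_real[symmetric] sin_exp_eq exp_cnj)

lemma multiplier_cos: "multiplier (\<lambda>p. cos (kvec L m \<bullet> (fst p, fst (snd p))))"
proof (rule multiplier_of_products[where B = 1])
  fix i :: "(int \<times> int) \<times> nat"
  show "\<exists>c d j k. \<forall>p. complex_of_real (cos (kvec L m \<bullet> (fst p, fst (snd p)))) * raw_mode i p =
      c * raw_mode j p + d * raw_mode k p"
    by (intro exI[of _ "1/2"] exI[of _ "(m + fst i, snd i)"] exI[of _ "(- m + fst i, snd i)"] allI)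
       (simp only: cos_wave raw_mode_def wave_add fst_conv snd_conv, simp add: algebra_simps add_divide_distrib)
qed (auto intro!: continuous_intros)

lemma multiplier_sin: "multiplier (\<lambda>p. sin (kvec L m \<bullet> (fst p, fst (snd p))))"
proof (rule multiplier_of_products[where B = 1])
  fix i :: "(int \<times> int) \<times> nat"
  show "\<exists>c d j k. \<forall>p. complex_of_real (sin (kvec L m \<bullet> (fst p, fst (snd p)))) * raw_mode i p =
      c * raw_mode j p + d * raw_mode k p"
    by (intro exI[of _ "1/(2*\<i>)"] exI[of _ "- (1/(2*\<i>))"] exI[of _ "(m + fst i, snd i)"]
          exI[of _ "(- m + fst i, snd i)"] allI)
       (simp only: sin_wave raw_mode_def wave_add fst_conv snd_conv, simp add: algebra_simps diff_divide_distrib)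
qed (auto intro!: continuous_intros)

lemma multiplier_cos_plate: "multiplier (\<lambda>p. cos (nu a 1 * snd (snd p)))"
proof (rule multiplier_of_products[where B = 1])
  fix i :: "(int \<times> int) \<times> nat"
  obtain m n where i: "i = (m, n)" by (cases i)
  show "\<exists>c d j k. \<forall>p. complex_of_real (cos (nu a 1 * snd (snd p))) * raw_mode i p =
      c * raw_mode j p + d * raw_mode k p"
  proof (cases n)
    case 0
    then show ?thesis
      by (intro exI[of _ 1] exI[of _ 0] exI[of _ "(m, 1)"] exI[of _ "(m, 0)"] allI)
         (simp add: i raw_mode_def nu_def)
  next
    case (Suc k)
    have e: "cos (nu a 1 * z) * cos (nu a n * z) = cos (nu a (Suc n) * z) / 2 + cos (nu a k * z) / 2" for z
      using a by (simp add: cos_times_cos nu_def Suc field_simps)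
    have "complex_of_real (cos (nu a 1 * snd (snd p))) * raw_mode i p =
      1/2 * raw_mode (m, Suc n) p + 1/2 * raw_mode (m, k) p" for p
    proof -
      have "complex_of_real (cos (nu a 1 * snd (snd p))) * raw_mode i p =
          wave L m p * complex_of_real (cos (nu a 1 * snd (snd p)) * cos (nu a n * snd (snd p)))"
        by (simp add: raw_mode_def i)
      then show ?thesis unfolding e by (simp add: raw_mode_def distrib_left)
    qed
    then show ?thesis by blast
  qed
qed (auto intro!: continuous_intros)

text \<open>Clipping the argument to [-1, 1] extends arccos continuously to the whole line, as
  \<open>multiplier_compose\<close> requires.\<close>

definition clipped_arccos :: "real \<Rightarrow> real" where
  "clipped_arccos t = arccos (max (-1) (min 1 t))"

lemma clipped_arccos_cos: "0 \<le> t \<Longrightarrow> t \<le> pi \<Longrightarrow> clipped_arccos (cos t) = t"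
  by (simp add: clipped_arccos_def arccos_cos min_absorb2 max_absorb2)

lemma clipped_arccos_cos': "pi \<le> t \<Longrightarrow> t \<le> 2 * pi \<Longrightarrow> clipped_arccos (cos t) = 2 * pi - t"
  using clipped_arccos_cos[of "2 * pi - t"] by (simp add: cos_diff)

lemma clipped_arccos_continuous: "continuous_on UNIV clipped_arccos"
  unfolding clipped_arccos_def
  by (rule continuous_on_compose2[OF continuous_on_arccos']) (auto intro!: continuous_intros)

text \<open>The cosine determines an angle in (0, 2 pi) up to reflection, and the sign of the sine
  tells the two halves apart. The indicator \<open>s\<close> of positive sine selects between the
  arccosine branch \<open>r\<close> and its reflection \<open>L - r\<close>.\<close>

lemma multiplier_lateral:
  assumes t: "\<And>p. kvec L m \<bullet> (fst p, fst (snd p)) = 2 * pi / L * t p" "t \<in> borel_measurable borel"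
    and bd: "\<And>p. p \<in> cell \<Longrightarrow> \<bar>t p\<bar> \<le> L" and int: "AE p in M. 0 < t p \<and> t p < L"
  shows "multiplier t"
proof -
  define s where "s = (indicator {p. sin (kvec L m \<bullet> (fst p, fst (snd p))) > 0} :: point \<Rightarrow> real)"
  define r where "r p = L / (2 * pi) * clipped_arccos (cos (kvec L m \<bullet> (fst p, fst (snd p))))" for p :: point
  have s: "multiplier s" unfolding s_def by (rule multiplier_greater[OF multiplier_sin])
  have r: "multiplier r"
    unfolding r_def
    by (intro multiplier_mult multiplier_const multiplier_compose[OF multiplier_cos] clipped_arccos_continuous)
  have "multiplier (\<lambda>p. s p * r p + (1 + -1 * s p) * (L + -1 * r p))"
    by (intro multiplier_add multiplier_mult multiplier_const s r)
  then show ?thesis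
  proof (rule multiplier_cong_AE[OF _ t(2) bd])
    show "AE p in M. s p * r p + (1 + -1 * s p) * (L + -1 * r p) = t p"
      using int
    proof eventually_elim
      case (elim p)
      define \<theta> where "\<theta> = 2 * pi / L * t p"
      have \<theta>: "0 < \<theta>" "\<theta> < 2 * pi" "t p = L / (2 * pi) * \<theta>"
        using elim L by (auto simp: \<theta>_def field_simps)
      show ?case
      proof (cases "\<theta> < pi")
        case True
        then have "sin \<theta> > 0" using \<theta> by (simp add: sin_gt_zero)
        then have "s p = 1" by (simp add: s_def indicator_def t(1) \<theta>_def)
        moreover have "r p = t p"
          using \<theta> True by (simp add: r_def t(1) \<theta>_def[symmetric] clipped_arccos_cos)
        ultimately show ?thesis by simp
      next
        case False
        then have "sin \<theta> \<le> 0" using \<theta> sin_le_zero[of \<theta>] by simp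
        then have "s p = 0" by (simp add: s_def indicator_def t(1) \<theta>_def)
        moreover have "r p = L - t p"
          using \<theta> False by (simp add: r_def t(1) \<theta>_def[symmetric] clipped_arccos_cos') (simp add: field_simps)
        ultimately show ?thesis by simp
      qed
    qed
  qed
qed

text \<open>The frequencies (1, 0) and (0, 1) make one full turn over a lateral period. In z the
  lowest cosine makes only half a turn over [0, a] and is injective there, so the arccosine alone
  recovers the height.\<close>

lemma multiplier_coordinates:
  "multiplier (\<lambda>p. fst p)" "multiplier (\<lambda>p. fst (snd p))" "multiplier (\<lambda>p. snd (snd p))"
proof -
  show "multiplier (\<lambda>p. fst p)"
  proof (rule multiplier_lateral[of "(1, 0)"])
    show "AE p in M. 0 < fst p \<and> fst p < L"
      using AE_M_interior by (rule eventually_mono) auto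
  qed (auto simp: kvec_def inner_prod_def borel_measurable_continuous_onI continuous_on_fst)
  show "multiplier (\<lambda>p. fst (snd p))"
  proof (rule multiplier_lateral[of "(0, 1)"])
    show "AE p in M. 0 < fst (snd p) \<and> fst (snd p) < L"
      using AE_M_interior by (rule eventually_mono) auto
  qed (auto simp: kvec_def inner_prod_def intro!: borel_measurable_continuous_onI continuous_intros)
  have "multiplier (\<lambda>p. a / pi * clipped_arccos (cos (nu a 1 * snd (snd p))))"
    by (intro multiplier_mult multiplier_const multiplier_compose[OF multiplier_cos_plate] clipped_arccos_continuous)
  then show "multiplier (\<lambda>p. snd (snd p))"
  proof (rule multiplier_cong_AE[where B = a])
    show "AE p in M. a / pi * clipped_arccos (cos (nu a 1 * snd (snd p))) = snd (snd p)"
      using AE_M_z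
    proof eventually_elim
      case (elim p)
      then have "clipped_arccos (cos (nu a 1 * snd (snd p))) = nu a 1 * snd (snd p)"
        by (intro clipped_arccos_cos) (auto simp: nu_def field_simps)
      with a show ?case by (simp add: nu_def)
    qed
  qed (auto intro!: borel_measurable_continuous_onI continuous_intros)
qed

text \<open>The Borel sets whose indicators are multipliers form a sigma-algebra: finite unions and
  complements by the algebra structure, countable unions by the limit lemma. It contains the
  superlevel sets of multipliers, so the coordinates are measurable for it.\<close>

lemma multiplier_borel:
  assumes "A \<in> sets borel"
  shows "multiplier (indicator A)"
proof -
  define \<Sigma> where "\<Sigma> = {S \<in> sets (borel :: point measure). multiplier (indicator S)}"
  have Un: "S \<union> T \<in> \<Sigma>" if "S \<in> \<Sigma>" "T \<in> \<Sigma>" for S T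
  proof -
    have "multiplier (\<lambda>p. indicator S p + indicator T p + -1 * (indicator S p * indicator T p))"
      using that by (intro multiplier_add multiplier_mult multiplier_const) (auto simp: \<Sigma>_def)
    moreover have "(\<lambda>p. indicator S p + indicator T p + -1 * (indicator S p * indicator T p)) =
        (indicator (S \<union> T) :: point \<Rightarrow> real)"
      by (auto simp: indicator_def fun_eq_iff)
    ultimately show ?thesis using that by (auto simp: \<Sigma>_def)
  qed
  have empty: "{} \<in> \<Sigma>"
    using multiplier_const[of 0] by (simp add: \<Sigma>_def indicator_def[abs_def])
  interpret sigma_algebra UNIV \<Sigma>
    unfolding sigma_algebra_iff2
  proof (intro conjI ballI allI impI empty)
    fix S assume S: "S \<in> \<Sigma>"
    then have "multiplier (\<lambda>p. 1 + -1 * indicator S p)"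
      by (intro multiplier_add multiplier_mult multiplier_const) (auto simp: \<Sigma>_def)
    moreover have "(\<lambda>p. 1 + -1 * indicator S p) = (indicator (UNIV - S) :: point \<Rightarrow> real)"
      by (auto simp: indicator_def fun_eq_iff)
    ultimately show "UNIV - S \<in> \<Sigma>" using S by (auto simp: \<Sigma>_def intro: borel_comp simp flip: Compl_eq_Diff_UNIV)
  next
    fix S :: "nat \<Rightarrow> point set" assume S: "range S \<subseteq> \<Sigma>"
    have fin: "(\<Union>i<k. S i) \<in> \<Sigma>" for k
      by (induction k) (use S in \<open>auto simp: lessThan_Suc empty intro: Un\<close>)
    have b: "(\<Union>i. S i) \<in> sets borel" using S by (intro sets.countable_UN) (auto simp: \<Sigma>_def)
    have "multiplier (indicator (\<Union>i. S i))"
    proof (rule multiplier_limit[where B = 1])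
      show "multiplier (indicator (\<Union>i<k. S i))" for k using fin by (simp add: \<Sigma>_def)
      show "AE p in M. (\<lambda>k. indicator (\<Union>i<k. S i) p) \<longlonglongrightarrow> (indicator (\<Union>i. S i) p :: real)"
        by (intro AE_I2 LIMSEQ_indicator_UN)
    qed (use b in \<open>auto simp: indicator_def\<close>)
    with b show "(\<Union>i. S i) \<in> \<Sigma>" by (simp add: \<Sigma>_def)
  qed auto
  define N where "N = sigma UNIV \<Sigma>"
  have N: "sets N = \<Sigma>" "space N = UNIV"
    by (simp_all add: N_def sets_measure_of_eq)
  have m: "h \<in> borel_measurable N" if h: "multiplier h" for h
  proof -
    have "{p. c < h p} \<in> sets borel" for c
      using multiplierD(1)[OF h] by measurable
    with multiplier_greater[OF h] show ?thesis
      by (simp add: borel_measurable_iff_greater N \<Sigma>_def)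
  qed
  \<comment> \<open>This is the identity map, so the preimage of \<open>A\<close> is
    \<open>A\<close> itself.\<close>
  have "(\<lambda>p. (fst p, fst (snd p), snd (snd p))) \<in> borel_measurable N"
    by (intro borel_measurable_Pair m multiplier_coordinates)
  from measurable_sets[OF this assms] have "A \<in> \<Sigma>" by (simp add: N vimage_def)
  then show ?thesis by (simp add: \<Sigma>_def)
qed

text \<open>After multiplication by the indicator of a Borel set, the pairing with the mode of index
  zero, which is the constant 1, is a set integral of \<open>f\<close>. All of these vanish.\<close>

lemma annihilated_AE_zero:
  assumes f: "annihilated f"
  shows "AE p in M. f p = 0"
proof (rule sigma_finite_measure.density_zero)
  show "sigma_finite_measure M" using finite_M by (rule finite_measure.axioms)
  show "integrable M f" using f by (simp add: annihilated_def)
  fix A assume "A \<in> sets M"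
  then have "A \<in> sets borel"
    by (auto simp: slab_measure_def sets_restrict_space)
  from multiplierD(3)[OF multiplier_borel[OF this] f]
  have "(\<integral>p. f p * complex_of_real (indicator A p) * raw_mode ((0, 0), 0) p \<partial>M) = 0"
    unfolding annihilated_def by blast
  moreover have "f p * complex_of_real (indicator A p) * raw_mode ((0, 0), 0) p = indicator A p *\<^sub>R f p" for p
    by (simp add: raw_mode_def wave_def kvec_def nu_def inner_prod_def indicator_def)
  ultimately show "set_lebesgue_integral M A f = 0"
    by (simp add: set_lebesgue_integral_def)
qed

section \<open>Completeness of the cosine and sine families\<close>

lemma cosine_mode_raw: "cosine_mode L a i p = complex_of_real (cweight a (snd i) / L) * raw_mode i p"
  by (simp add: cosine_mode_def raw_mode_def phi_wave cmode_eq)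

lemma cosine_complete:
  assumes f: "f \<in> square_integrable M" and 0: "\<And>i. inner2 M f (cosine_mode L a i) = 0"
  shows "AE p in M. f p = 0"
proof (rule annihilated_AE_zero)
  have "(\<integral>p. f p * raw_mode (m, n) p \<partial>M) = 0" for m n
  proof -
    have "inner2 M f (cosine_mode L a (- m, n)) =
        (\<integral>p. complex_of_real (cweight a n / L) * (f p * raw_mode (m, n) p) \<partial>M)"
      unfolding inner2_def cnj_cosine_mode unfolding cosine_mode_raw by (simp add: ac_simps)
    also have "\<dots> = complex_of_real (cweight a n / L) * (\<integral>p. f p * raw_mode (m, n) p \<partial>M)"
      by (rule integral_mult_right_zero)
    finally show ?thesis using 0[of "(- m, n)"] L a by (auto simp: cweight_def split: if_splits)
  qed
  then show "annihilated f"
    using finite_measure_square_integrable(1)[OF finite_M f] unfolding annihilated_def by (auto simp: split_paired_all)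
qed

text \<open>Reduction to cosines: the lowest sine times a cosine is a difference of two sines, so
  \<open>f\<close> times the lowest sine is annihilated. That sine is positive strictly between the
  plates, hence \<open>f\<close> itself vanishes.\<close>

lemma sine_complete:
  assumes f: "f \<in> square_integrable M" and 0: "\<And>i. snd i \<ge> 1 \<Longrightarrow> inner2 M f (sine_mode L a i) = 0"
  shows "AE p in M. f p = 0"
proof -
  define u where "u m j p = f p * (wave L m p * complex_of_real (sin (nu a j * snd (snd p))))" for m j p
  note fi = finite_measure_square_integrable(1)[OF finite_M f]
  have ui: "integrable M (u m j)" for m j
    unfolding u_def
    by (rule integrable_mult_bounded[OF fi, where B = 1])
       (auto intro!: continuous_measurable_M continuous_intros simp: norm_mult)
  have u0: "(\<integral>p. u m j p \<partial>M) = 0" for m j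
  proof (cases "j = 0")
    case False
    have "inner2 M f (sine_mode L a (- m, j)) =
        (\<integral>p. complex_of_real (sqrt (2 / a) / L) * u m j p \<partial>M)"
      unfolding inner2_def cnj_sine_mode u_def
      by (simp add: sine_mode_def phi_wave smode_def ac_simps)
    also have "\<dots> = complex_of_real (sqrt (2 / a) / L) * (\<integral>p. u m j p \<partial>M)"
      by (rule integral_mult_right_zero)
    finally show ?thesis using 0[of "(- m, j)"] False L a by auto
  qed (simp add: u_def nu_def)
  define g where "g p = f p * complex_of_real (sin (nu a 1 * snd (snd p)))" for p
  have "annihilated g"
    unfolding annihilated_def
  proof (intro conjI allI)
    show "integrable M g"
      unfolding g_def
      by (rule integrable_mult_bounded[OF fi, where B = 1])
         (auto intro!: continuous_measurable_M continuous_intros)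
    fix i :: "(int \<times> int) \<times> nat"
    obtain m n where i: "i = (m, n)" by (cases i)
    have g: "g p * raw_mode i p = f p * (wave L m p *
        complex_of_real (sin (nu a 1 * snd (snd p)) * cos (nu a n * snd (snd p))))" for p
      by (simp add: g_def raw_mode_def i)
    show "(\<integral>p. g p * raw_mode i p \<partial>M) = 0"
    proof (cases n)
      case 0
      then have "g p * raw_mode i p = u m 1 p" for p
        unfolding g by (simp add: u_def nu_def)
      then show ?thesis by (simp add: u0)
    next
      case (Suc k)
      \<comment> \<open>For n = 1 the lower neighbour has index 0 and vanishes; \<open>u0\<close>
        includes index 0 for this reason.\<close>
      have e: "sin (nu a 1 * z) * cos (nu a n * z) = (sin (nu a (Suc n) * z) - sin (nu a k * z)) / 2" for z
        using a by (simp add: sin_times_cos nu_def Suc field_simps)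
      have "g p * raw_mode i p = 1/2 * (u m (Suc n) p - u m k p)" for p
        unfolding g e by (simp add: u_def algebra_simps diff_divide_distrib)
      then have "(\<integral>p. g p * raw_mode i p \<partial>M) = (\<integral>p. 1/2 * (u m (Suc n) p - u m k p) \<partial>M)"
        by (simp only:)
      also have "\<dots> = 0" unfolding integral_mult_right_zero by (simp add: u0 ui)
      finally show ?thesis .
    qed
  qed
  then have "AE p in M. g p = 0" by (rule annihilated_AE_zero)
  then show ?thesis
    using AE_M_z
  proof eventually_elim
    case (elim p)
    then have "sin (nu a 1 * snd (snd p)) > 0"
      by (intro sin_gt_zero) (auto simp: nu_def field_simps)
    with elim(1) show ?case by (simp add: g_def)
  qed
qed

sublocale cosines: orthonormal_basis M UNIV "cosine_mode L a"
proof (rule orthonormal_basis.intro)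
  show "AE p in M. f p = 0"
    if "f \<in> square_integrable M" "\<And>i. i \<in> UNIV \<Longrightarrow> inner2 M f (cosine_mode L a i) = 0" for f
    using that by (intro cosine_complete) auto
qed (rule finite_M inner2_cosine_mode continuous_square_integrable_M cosine_mode_continuous)+

sublocale sines: orthonormal_basis M "UNIV \<times> {1..}" "sine_mode L a"
proof (rule orthonormal_basis.intro)
  show "AE p in M. f p = 0"
    if "f \<in> square_integrable M" "\<And>i. i \<in> UNIV \<times> {1..} \<Longrightarrow> inner2 M f (sine_mode L a i) = 0" for f
    using that by (intro sine_complete) (auto simp: mem_Times_iff)
  show "inner2 M (sine_mode L a i) (sine_mode L a j) = (if i = j then 1 else 0)"
    if "i \<in> UNIV \<times> {1..}" for i j
    using that by (intro inner2_sine_mode) auto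
qed (rule finite_M continuous_square_integrable_M sine_mode_continuous)+

end

section \<open>Vector fields\<close>

lemma norm_vec3: "(norm (v :: complex^3))\<^sup>2 = (norm (v $ 1))\<^sup>2 + (norm (v $ 2))\<^sup>2 + (norm (v $ 3))\<^sup>2"
  by (simp add: norm_vec_def L2_set_def sum_3)

text \<open>The 3 is the number of components, each product being bounded by the product of the
  norms. The estimate serves only to pass to limits, so the size of the constant does not
  matter.\<close>

lemma norm_bdot_le: "norm (bdot u v) \<le> 3 * (norm u * norm v)"
proof -
  have "norm (bdot u v) \<le> (\<Sum>j\<in>UNIV. norm (u $ j) * norm (v $ j))"
    unfolding bdot_def by (rule order_trans[OF norm_sum]) (simp add: norm_mult)
  also have "\<dots> \<le> (\<Sum>j\<in>(UNIV :: 3 set). norm u * norm v)"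
    by (intro sum_mono mult_mono component_le_norm_cart Finite_Cartesian_Product.norm_nth_le) auto
  finally show ?thesis by (simp add: sum_3)
qed

lemma bdot_diff_left: "bdot (u - v) w = bdot u w - bdot v w"
  by (simp add: bdot_def left_diff_distrib sum_subtractf)

lemma measurable_component:
  "f \<in> borel_measurable N \<Longrightarrow> (\<lambda>p. (f p :: complex^'n) $ j) \<in> borel_measurable N"
  by (rule borel_measurable_continuous_on[OF linear_continuous_on[OF bounded_linear_vec_nth]])

lemma square_integrable_component:
  "f \<in> square_integrable N \<Longrightarrow> (\<lambda>p. (f p :: complex^'n) $ j) \<in> square_integrable N"
  by (rule square_integrable_bound[where g = f and C = 1])
     (auto intro: measurable_component square_integrable_measurable simp: Finite_Cartesian_Product.norm_nth_le)

lemma square_integrable_vec: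
  fixes f :: "'a \<Rightarrow> complex^3"
  assumes "\<And>j. (\<lambda>p. f p $ j) \<in> square_integrable N"
  shows "f \<in> square_integrable N"
proof -
  have "(\<lambda>p. axis j (f p $ j) :: complex^3) \<in> borel_measurable N" for j
    by (rule borel_measurable_continuous_on[OF linear_continuous_on[OF bounded_linear_axis]],
        rule square_integrable_measurable, rule assms)
  then have "(\<lambda>p. \<Sum>j\<in>UNIV. axis j (f p $ j) :: complex^3) \<in> borel_measurable N"
    by (intro borel_measurable_sum)
  moreover have "(\<Sum>j\<in>UNIV. axis j (f p $ j)) = f p" for p
    unfolding axis_sum[symmetric] by (simp add: vec_eq_iff)
  ultimately have "f \<in> borel_measurable N" by simp
  moreover have "integrable N (\<lambda>p. (norm (f p))\<^sup>2)"
    unfolding norm_vec3 by (intro Bochner_Integration.integrable_add square_integrable_norm assms)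
  ultimately show ?thesis by (simp add: square_integrable_def)
qed

lemma norm2_vec:
  fixes f :: "'a \<Rightarrow> complex^3"
  assumes "f \<in> square_integrable N"
  shows "(norm2 N f)\<^sup>2 = (norm2 N (\<lambda>p. f p $ 1))\<^sup>2 + (norm2 N (\<lambda>p. f p $ 2))\<^sup>2 + (norm2 N (\<lambda>p. f p $ 3))\<^sup>2"
  unfolding norm2_sq norm_vec3
  using square_integrable_norm[OF square_integrable_component[OF assms]] by simp

lemma integrable_bdot:
  assumes "f \<in> square_integrable N" "g \<in> square_integrable N"
  shows "integrable N (\<lambda>p. bdot (f p) (g p))"
  unfolding bdot_def using assms
  by (intro Bochner_Integration.integrable_sum square_integrable_mult square_integrable_component)

lemma norm_integral_bdot_le:
  assumes "f \<in> square_integrable N" "g \<in> square_integrable N"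
  shows "norm (\<integral>p. bdot (f p) (g p) \<partial>N) \<le> 3 * (norm2 N f * norm2 N g)"
proof -
  have "norm (\<integral>p. bdot (f p) (g p) \<partial>N) \<le> (\<integral>p. norm (bdot (f p) (g p)) \<partial>N)"
    by (rule integral_norm_bound)
  also have "\<dots> \<le> (\<integral>p. 3 * (norm (f p) * norm (g p)) \<partial>N)"
    using assms by (intro integral_mono norm_bdot_le integrable_norm integrable_bdot
        integrable_mult_right square_integrable_mult_norm)
  also have "\<dots> \<le> 3 * (norm2 N f * norm2 N g)"
    using integral_mult_norm_le[OF assms] by simp
  finally show ?thesis .
qed

lemma norm_le_mult_imp_zero:
  assumes "\<And>\<epsilon>. \<epsilon> > 0 \<Longrightarrow> norm (x :: complex) \<le> C * \<epsilon>"
  shows "x = 0"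
proof -
  have "norm x \<le> 0 + e" if "e > 0" for e
  proof -
    \<comment> \<open>The sign of \<open>C\<close> is unknown, and \<bar>C\<bar> + 1 is a positive
      number above it.\<close>
    have "norm x \<le> C * (e / (\<bar>C\<bar> + 1))" using assms[of "e / (\<bar>C\<bar> + 1)"] that by simp
    also have "\<dots> \<le> (\<bar>C\<bar> + 1) * (e / (\<bar>C\<bar> + 1))" using that by (intro mult_right_mono) auto
    finally show ?thesis by simp
  qed
  then have "norm x \<le> 0" by (rule field_le_epsilon)
  then show ?thesis by simp
qed

subsection \<open>Derivatives of the modes\<close>

definition dlateral :: "real \<Rightarrow> (int \<times> int) \<times> nat \<Rightarrow> point \<Rightarrow> complex" where
  "dlateral L i h = \<i> * complex_of_real (kvec L (fst i) \<bullet> (fst h, fst (snd h)))"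

definition dsine :: "real \<Rightarrow> real \<Rightarrow> (int \<times> int) \<times> nat \<Rightarrow> point \<Rightarrow> point \<Rightarrow> complex" where
  "dsine L a i h p = dlateral L i h * sine_mode L a i p
     + complex_of_real (nu a (snd i) * snd (snd h)) * cosine_mode L a i p"

definition dcosine :: "real \<Rightarrow> real \<Rightarrow> (int \<times> int) \<times> nat \<Rightarrow> point \<Rightarrow> point \<Rightarrow> complex" where
  "dcosine L a i h p = dlateral L i h * cosine_mode L a i p
     - complex_of_real (nu a (snd i) * snd (snd h)) * sine_mode L a i p"

lemma wave_has_derivative:
  "(wave L m has_derivative (\<lambda>h. \<i> * complex_of_real (kvec L m \<bullet> (fst h, fst (snd h))) * wave L m p)) (at p within S)"
proof -
  have "((\<lambda>p. \<i> * complex_of_real (kvec L m \<bullet> (fst p, fst (snd p)))) has_derivative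
      (\<lambda>h. \<i> * complex_of_real (kvec L m \<bullet> (fst h, fst (snd h))))) (at p within S)"
    by (intro bounded_linear_imp_has_derivative bounded_linear_const_mult
        bounded_linear_compose[OF bounded_linear_of_real]
        bounded_linear_compose[OF bounded_linear_inner_right]
        bounded_linear_Pair bounded_linear_fst bounded_linear_compose[OF bounded_linear_fst bounded_linear_snd])
  from has_derivative_compose[OF this DERIV_exp[unfolded has_field_derivative_def]]
  show ?thesis by (simp add: wave_def[abs_def] mult.commute)
qed

lemma smode_has_derivative:
  fixes p :: point
  shows "((\<lambda>p. complex_of_real (smode a n (snd (snd p)))) has_derivative
     (\<lambda>h. complex_of_real (nu a n * snd (snd h) * cmode a n (snd (snd p))))) (at p within S)"
proof -
  have s: "((\<lambda>p::point. snd (snd p)) has_derivative (\<lambda>h. snd (snd h))) (at p within S)"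
    by (intro derivative_intros)
  have "(smode a n has_field_derivative nu a n * cmode a n z) (at z)" for z
    unfolding smode_def[abs_def] cmode_def
    by (cases "n = 0") (auto intro!: derivative_eq_intros)
  from has_derivative_compose[OF s this[unfolded has_field_derivative_def]]
  have "((\<lambda>p. smode a n (snd (snd p))) has_derivative
     (\<lambda>h. nu a n * snd (snd h) * cmode a n (snd (snd p)))) (at p within S)"
    by (simp add: ac_simps)
  then show ?thesis by (rule has_derivative_of_real)
qed

lemma cmode_has_derivative:
  fixes p :: point
  shows "((\<lambda>p. complex_of_real (cmode a n (snd (snd p)))) has_derivative
     (\<lambda>h. - complex_of_real (nu a n * snd (snd h) * smode a n (snd (snd p))))) (at p within S)"
proof -
  have s: "((\<lambda>p::point. snd (snd p)) has_derivative (\<lambda>h. snd (snd h))) (at p within S)"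
    by (intro derivative_intros)
  have "(cmode a n has_field_derivative - (nu a n * smode a n z)) (at z)" for z
    unfolding smode_def cmode_def[abs_def]
    by (cases "n = 0") (auto intro!: derivative_eq_intros)
  from has_derivative_compose[OF s this[unfolded has_field_derivative_def]]
  have "((\<lambda>p. cmode a n (snd (snd p))) has_derivative
     (\<lambda>h. - (nu a n * snd (snd h) * smode a n (snd (snd p))))) (at p within S)"
    by (simp add: ac_simps)
  from has_derivative_of_real[OF this] show ?thesis by simp
qed

lemma sine_mode_has_derivative:
  "(sine_mode L a i has_derivative (\<lambda>h. dsine L a i h p)) (at p within S)"
  unfolding sine_mode_def[abs_def] phi_wave divide_inverse
  by (rule has_derivative_eq_rhs[OF has_derivative_mult[OF has_derivative_mult_left[OF wave_has_derivative]
        smode_has_derivative]])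
     (simp add: fun_eq_iff dsine_def dlateral_def sine_mode_def cosine_mode_def phi_wave divide_inverse algebra_simps)

lemma cosine_mode_has_derivative:
  "(cosine_mode L a i has_derivative (\<lambda>h. dcosine L a i h p)) (at p within S)"
  unfolding cosine_mode_def[abs_def] phi_wave divide_inverse
  by (rule has_derivative_eq_rhs[OF has_derivative_mult[OF has_derivative_mult_left[OF wave_has_derivative]
        cmode_has_derivative]])
     (simp add: fun_eq_iff dcosine_def dlateral_def sine_mode_def cosine_mode_def phi_wave divide_inverse algebra_simps)

text \<open>A sine mode and the cosine mode of the same index span a space closed under directional
  derivatives, as \<open>Ck_on_closed_family\<close> requires.\<close>

definition mode_comb :: "real \<Rightarrow> real \<Rightarrow> (int \<times> int) \<times> nat \<Rightarrow> complex \<Rightarrow> complex \<Rightarrow> point \<Rightarrow> complex" where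
  "mode_comb L a i c d p = c * sine_mode L a i p + d * cosine_mode L a i p"

lemma mode_comb_has_derivative:
  "(mode_comb L a i c d has_derivative
     (\<lambda>h. mode_comb L a i (dlateral L i h * c - complex_of_real (nu a (snd i) * snd (snd h)) * d)
       (complex_of_real (nu a (snd i) * snd (snd h)) * c + dlateral L i h * d) p)) (at p within S)"
  unfolding mode_comb_def[abs_def]
  by (rule has_derivative_eq_rhs[OF has_derivative_add[OF has_derivative_mult_right[OF sine_mode_has_derivative]
        has_derivative_mult_right[OF cosine_mode_has_derivative]]])
     (simp add: fun_eq_iff dsine_def dcosine_def algebra_simps)

lemma Ck_on_mode_comb: "Ck_on k S (mode_comb L a i c d)"
proof (rule Ck_on_closed_family)
  show "mode_comb L a i c d \<in> {mode_comb L a i c d |c d. True}" by blast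
  fix f assume "f \<in> {mode_comb L a i c d |c d. True}"
  then obtain c d where f: "f = mode_comb L a i c d" by blast
  show "\<exists>D. (\<forall>p\<in>S. (f has_derivative (\<lambda>h. D h p)) (at p within S)) \<and>
      (\<forall>h. D h \<in> {mode_comb L a i c d |c d. True})"
    unfolding f
    by (intro exI[of _ "\<lambda>h. mode_comb L a i (dlateral L i h * c - complex_of_real (nu a (snd i) * snd (snd h)) * d)
       (complex_of_real (nu a (snd i) * snd (snd h)) * c + dlateral L i h * d)"] conjI ballI
       mode_comb_has_derivative) blast
qed

lemma Ck_on_sine_mode: "Ck_on k S (sine_mode L a i)"
  using Ck_on_mode_comb[of k S L a i 1 0] by (simp add: mode_comb_def[abs_def])

lemma Ck_on_cosine_mode: "Ck_on k S (cosine_mode L a i)"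
  using Ck_on_mode_comb[of k S L a i 0 1] by (simp add: mode_comb_def[abs_def])

lemma wave_periodic:
  assumes "L \<noteq> 0"
  shows "wave L m (x + L, y, z) = wave L m (x, y, z)" "wave L m (x, y + L, z) = wave L m (x, y, z)"
proof -
  have "exp (\<i> * complex_of_real (2 * pi / L * real_of_int j * (t + L))) =
      exp (\<i> * complex_of_real (2 * pi / L * real_of_int j * t))" for j t
  proof -
    have "\<i> * complex_of_real (2 * pi / L * real_of_int j * (t + L)) =
        \<i> * complex_of_real (2 * pi / L * real_of_int j * t) + of_int (2 * j) * (of_real pi * \<i>)"
      using assms by (simp add: field_simps)
    moreover have "exp (of_int (2 * j) * (of_real pi * \<i>)) = (1 :: complex)"
      by (auto simp: exp_eq_1)
    ultimately show ?thesis by (simp add: exp_add)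
  qed
  then show "wave L m (x + L, y, z) = wave L m (x, y, z)" "wave L m (x, y + L, z) = wave L m (x, y, z)"
    unfolding wave_prod by (simp_all only:)
qed

context slab
begin

lemma modes_periodic: "lat_periodic L Z (sine_mode L a i)" "lat_periodic L Z (cosine_mode L a i)"
  unfolding lat_periodic_def sine_mode_def cosine_mode_def phi_wave
  using L by (simp_all add: wave_periodic)

lemma C1_I:
  assumes "lat_periodic L {0..a} f"
    and "\<And>p. p \<in> layer \<Longrightarrow> (f has_derivative (\<lambda>h. D h p)) (at p within layer)"
    and "\<And>h. continuous_on layer (D h)"
  shows "C1 f D"
  unfolding C1_def using assms by blast

lemma C1_sine_mode: "C1 (sine_mode L a i) (dsine L a i)"
proof (rule C1_I[OF modes_periodic(1) sine_mode_has_derivative])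
  show "continuous_on layer (dsine L a i h)" for h
    unfolding dsine_def[abs_def] by (intro continuous_intros)
qed

lemma C1_cosine_mode: "C1 (cosine_mode L a i) (dcosine L a i)"
proof (rule C1_I[OF modes_periodic(2) cosine_mode_has_derivative])
  show "continuous_on layer (dcosine L a i h)" for h
    unfolding dcosine_def[abs_def] by (intro continuous_intros)
qed

lemma C1_zero: "C1 (\<lambda>p. 0) (\<lambda>h p. 0)"
  by (simp add: C1_def lat_periodic_def)

lemma C1_cmult:
  fixes c :: complex
  assumes "C1 f D"
  shows "C1 (\<lambda>p. c * f p) (\<lambda>h p. c * D h p)"
proof (rule C1_I)
  show "lat_periodic L {0..a} (\<lambda>p. c * f p)" by (simp add: lat_periodic_def C1_D[OF assms])
qed (intro has_derivative_mult_right continuous_intros C1_D[OF assms] | assumption)+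

lemma C1_add:
  assumes "C1 f D" "C1 g D'"
  shows "C1 (\<lambda>p. f p + g p) (\<lambda>h p. D h p + D' h p)"
proof (rule C1_I)
  show "lat_periodic L {0..a} (\<lambda>p. f p + g p)"
    by (simp add: lat_periodic_def C1_D[OF assms(1)] C1_D[OF assms(2)])
qed (intro has_derivative_add continuous_intros C1_D[OF assms(1)] C1_D[OF assms(2)] | assumption)+

lemma C1_sum: "(\<And>i. i \<in> S \<Longrightarrow> C1 (f i) (D i)) \<Longrightarrow> C1 (\<lambda>p. \<Sum>i\<in>S. f i p) (\<lambda>h p. \<Sum>i\<in>S. D i h p)"
  by (induction S rule: infinite_finite_induct) (auto intro: C1_zero C1_add)

lemma C1_axis:
  assumes "C1 f D"
  shows "C1 (\<lambda>p. axis j (f p) :: complex^3) (\<lambda>h p. axis j (D h p))"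
proof (rule C1_I)
  show "lat_periodic L {0..a} (\<lambda>p. axis j (f p) :: complex^3)"
    by (simp add: lat_periodic_def C1_D[OF assms])
qed (intro bounded_linear.has_derivative[OF bounded_linear_axis] C1_D[OF assms]
      bounded_linear.continuous_on[OF bounded_linear_axis] | assumption)+

lemma C1_vec:
  fixes f :: "point \<Rightarrow> complex^3"
  assumes "\<And>j. C1 (\<lambda>p. f p $ j) (\<lambda>h p. D h p $ j)"
  shows "C1 f D"
proof -
  have "C1 (\<lambda>p. \<Sum>j\<in>UNIV. axis j (f p $ j)) (\<lambda>h p. \<Sum>j\<in>UNIV. axis j (D h p $ j))"
    by (intro C1_sum C1_axis assms)
  then show ?thesis by (simp add: axis_sum[symmetric])
qed

lemma square_integrable_C1: "C1 f D \<Longrightarrow> f \<in> square_integrable M"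
  by (intro continuous_square_integrable_M C1_continuous)

lemma square_integrable_curl_of: "C1 f D \<Longrightarrow> curl_of D \<in> square_integrable M"
  by (intro continuous_square_integrable_M curl_of_continuous)

subsection \<open>Weak curl and divergence\<close>

lemma test_function_C1:
  assumes "test_function L a \<Phi>"
  shows "\<exists>D. C1 \<Phi> D \<and> (\<forall>p. (\<Phi> has_derivative (\<lambda>h. D h p)) (at p))"
proof -
  have s: "smooth_on UNIV \<Phi>" "lat_periodic L UNIV \<Phi>"
    using assms unfolding test_function_def by blast+
  obtain D where D: "C1 \<Phi> D" "\<And>p. (\<Phi> has_derivative (\<lambda>h. D h p)) (at p)"
    using smooth_UNIV_C1[OF s] by blast
  then show ?thesis by blast
qed

lemma test_function_plates: "test_function L a \<Phi> \<Longrightarrow> z \<in> {0, a} \<Longrightarrow> \<Phi> (x, y, z) = 0"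
  unfolding test_function_def by auto

text \<open>Test fields come with a derivative witness here, so that integration by parts, phrased
  with \<open>curl_of\<close>, applies directly.\<close>

lemma weak_curl_iff:
  "weak_curl L a E F \<longleftrightarrow> (\<forall>\<Phi> D. test_function L a \<Phi> \<longrightarrow> C1 \<Phi> D \<longrightarrow> (\<forall>p. (\<Phi> has_derivative (\<lambda>h. D h p)) (at p)) \<longrightarrow>
     (\<integral>p. bdot (E p) (curl_of D p) \<partial>M) = (\<integral>p. bdot (F p) (\<Phi> p) \<partial>M))"
proof -
  have eq: "curl \<Phi> = curl_of D" if "\<forall>p. (\<Phi> has_derivative (\<lambda>h. D h p)) (at p)" for \<Phi> D
    using that curl_eq by blast
  show ?thesis
    unfolding weak_curl_def
  proof (intro iffI allI impI)
    fix \<Phi> :: "point \<Rightarrow> complex^3" assume *: "\<forall>\<Phi> D. test_function L a \<Phi> \<longrightarrow> C1 \<Phi> D \<longrightarrow> (\<forall>p. (\<Phi> has_derivative (\<lambda>h. D h p)) (at p)) \<longrightarrow>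
        (\<integral>p. bdot (E p) (curl_of D p) \<partial>M) = (\<integral>p. bdot (F p) (\<Phi> p) \<partial>M)"
      and \<Phi>: "test_function L a \<Phi>"
    from test_function_C1[OF \<Phi>]
    obtain D where D: "C1 \<Phi> D" "\<forall>p. (\<Phi> has_derivative (\<lambda>h. D h p)) (at p)"
      by blast
    with * \<Phi> eq[of \<Phi> D] show "(\<integral>p. bdot (E p) (curl \<Phi> p) \<partial>M) = (\<integral>p. bdot (F p) (\<Phi> p) \<partial>M)"
      by simp
  next
    fix \<Phi> :: "point \<Rightarrow> complex^3" and D assume *: "\<forall>\<Phi>. test_function L a \<Phi> \<longrightarrow>
        (\<integral>p. bdot (E p) (curl \<Phi> p) \<partial>M) = (\<integral>p. bdot (F p) (\<Phi> p) \<partial>M)"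
      and \<Phi>: "test_function L a \<Phi>" "\<forall>p. (\<Phi> has_derivative (\<lambda>h. D h p)) (at p)"
    from *[rule_format, OF \<Phi>(1)]
    show "(\<integral>p. bdot (E p) (curl_of D p) \<partial>M) = (\<integral>p. bdot (F p) (\<Phi> p) \<partial>M)"
      unfolding eq[OF \<Phi>(2)] .
  qed
qed

text \<open>The test field vanishes on the plates and thereby removes all boundary terms, whatever
  the values of \<open>G\<close> there.\<close>

lemma weak_curl_C1:
  assumes G: "C1 G D"
  shows "weak_curl L a G (curl_of D)"
  unfolding weak_curl_iff
proof (intro allI impI)
  fix \<Phi> :: "point \<Rightarrow> complex^3" and D' assume \<Phi>: "test_function L a \<Phi>" "C1 \<Phi> D'"
  show "(\<integral>p. bdot (G p) (curl_of D' p) \<partial>M) = (\<integral>p. bdot (curl_of D p) (\<Phi> p) \<partial>M)"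
    by (rule integral_curl_by_parts[OF G \<Phi>(2)]) (simp_all add: test_function_plates[OF \<Phi>(1)])
qed

lemma weak_curl_diff:
  assumes "weak_curl L a E F" "weak_curl L a E' F'"
    and "E \<in> square_integrable M" "F \<in> square_integrable M" "E' \<in> square_integrable M" "F' \<in> square_integrable M"
  shows "weak_curl L a (\<lambda>p. E p - E' p) (\<lambda>p. F p - F' p)"
  unfolding weak_curl_iff
proof (intro allI impI)
  fix \<Phi> :: "point \<Rightarrow> complex^3" and D assume \<Phi>: "test_function L a \<Phi>" "C1 \<Phi> D" "\<forall>p. (\<Phi> has_derivative (\<lambda>h. D h p)) (at p)"
  show "(\<integral>p. bdot (E p - E' p) (curl_of D p) \<partial>M) = (\<integral>p. bdot (F p - F' p) (\<Phi> p) \<partial>M)"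
    using assms(1,2)[unfolded weak_curl_iff, rule_format, OF \<Phi>(1,2) \<Phi>(3)[rule_format]] assms(3-)
      square_integrable_C1[OF \<Phi>(2)] square_integrable_curl_of[OF \<Phi>(2)]
    by (simp add: bdot_diff_left integrable_bdot)
qed

lemma cutoff_integral_tendsto:
  fixes f :: "point \<Rightarrow> complex"
  assumes f: "integrable M f"
  shows "(\<lambda>k. \<integral>p. complex_of_real (cutoff a (1 / real (Suc k)) (snd (snd p))) * f p \<partial>M) \<longlonglongrightarrow> (\<integral>p. f p \<partial>M)"
proof (rule integral_dominated_convergence)
  show "integrable M (\<lambda>p. norm (f p))" using f by simp
  show "f \<in> borel_measurable M" using f by simp
  show "(\<lambda>p. complex_of_real (cutoff a (1 / real (Suc k)) (snd (snd p))) * f p) \<in> borel_measurable M" for k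
  proof -
    have "(\<lambda>p::point. cutoff a (1 / real (Suc k)) (snd (snd p))) \<in> borel_measurable M"
      using Ck_on_cutoff[of 0 cell a "1 / real (Suc k)"] by (intro continuous_measurable_M) simp
    with f show ?thesis by simp
  qed
  show "AE p in M. (\<lambda>k. complex_of_real (cutoff a (1 / real (Suc k)) (snd (snd p))) * f p) \<longlonglongrightarrow> f p"
    using AE_M_z
  proof eventually_elim
    case (elim p)
    have "(\<lambda>k. complex_of_real (cutoff a (1 / real (Suc k)) (snd (snd p))) * f p) \<longlonglongrightarrow> complex_of_real 1 * f p"
      using elim by (intro tendsto_intros cutoff_tendsto) auto
    then show ?case by simp
  qed
  show "AE p in M. norm (complex_of_real (cutoff a (1 / real (Suc k)) (snd (snd p))) * f p) \<le> norm (f p)" for k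
    using cutoff_bounds by (intro AE_I2) (simp add: norm_mult mult_left_le_one_le)
qed

text \<open>Test with a mode along one axis times the cutoff. When two weak curls of one field are
  compared, no derivative of the test field remains, so the cutoff is removed by dominated
  convergence and completeness of the cosines applies to each component of the difference.\<close>

lemma weak_curl_unique:
  assumes F: "F \<in> square_integrable M" "F' \<in> square_integrable M"
    and w: "weak_curl L a E F" "weak_curl L a E F'"
  shows "AE p in M. F p = F' p"
proof -
  have "AE p in M. F p $ j - F' p $ j = 0" for j
  proof (rule cosine_complete)
    show sq: "(\<lambda>p. F p $ j - F' p $ j) \<in> square_integrable M"
      using F by (intro square_integrable_diff square_integrable_component)
    fix i :: "(int \<times> int) \<times> nat"
    obtain m n where i: "i = (m, n)" by (cases i)
    let ?c = "cosine_mode L a (- m, n)"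
    have csq: "?c \<in> square_integrable M"
      by (intro continuous_square_integrable_M continuous_intros)
    have "(\<integral>p. complex_of_real (cutoff a (1 / real (Suc k)) (snd (snd p))) * ((F p $ j - F' p $ j) * ?c p) \<partial>M) = 0" for k
    proof -
      let ?\<Phi> = "\<lambda>p. cutoff a (1 / real (Suc k)) (snd (snd p)) *\<^sub>R (axis j (?c p) :: complex^3)"
      have \<Phi>: "test_function L a ?\<Phi>"
        by (rule test_function_cutoff)
           (use modes_periodic(2)[of UNIV "(- m, n)"] in \<open>auto simp: smooth_on_def lat_periodic_def
             intro!: Ck_on_linear[OF bounded_linear_axis] Ck_on_cosine_mode\<close>)
      obtain D where D: "C1 ?\<Phi> D" using test_function_C1[OF \<Phi>] by blast
      have b: "bdot v (?\<Phi> p) = complex_of_real (cutoff a (1 / real (Suc k)) (snd (snd p))) * (v $ j * ?c p)" for v p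
        unfolding bdot_def
        by (simp add: axis_def if_distrib scaleR_conv_of_real[where 'a = complex] cong: if_cong)
      have "(\<integral>p. bdot (F p) (?\<Phi> p) \<partial>M) = (\<integral>p. bdot (F' p) (?\<Phi> p) \<partial>M)"
        using w(1)[unfolded weak_curl_def, rule_format, OF \<Phi>] w(2)[unfolded weak_curl_def, rule_format, OF \<Phi>]
        by (rule trans[OF sym])
      then have "(\<integral>p. bdot (F p - F' p) (?\<Phi> p) \<partial>M) = 0"
        using F square_integrable_C1[OF D] by (simp add: bdot_diff_left integrable_bdot)
      then show ?thesis unfolding b by simp
    qed
    then have "(\<integral>p. (F p $ j - F' p $ j) * ?c p \<partial>M) = 0"
      using cutoff_integral_tendsto[OF square_integrable_mult[OF sq csq]] by (simp add: LIMSEQ_const_iff)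
    then show "inner2 M (\<lambda>p. F p $ j - F' p $ j) (cosine_mode L a i) = 0"
      by (simp add: inner2_def i cnj_cosine_mode)
  qed
  then have "AE p in M. \<forall>j. F p $ j - F' p $ j = 0"
    by (intro AE_all_countable[THEN iffD2] allI)
  then show ?thesis by (rule eventually_mono) (simp add: vec_eq_iff)
qed

section \<open>The chosen weak curl and its norm\<close>

lemma H_curl_I: "E \<in> square_integrable M \<Longrightarrow> F \<in> square_integrable M \<Longrightarrow> weak_curl L a E F \<Longrightarrow> E \<in> H_curl L a"
  unfolding H_curl_def L2_eq by blast

lemma wcurl:
  assumes "E \<in> H_curl L a"
  shows "wcurl L a E \<in> square_integrable M" "weak_curl L a E (wcurl L a E)"
proof -
  have "\<exists>F. F \<in> L2 L a \<and> weak_curl L a E F" using assms unfolding H_curl_def by blast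
  from someI_ex[OF this] show "wcurl L a E \<in> square_integrable M" "weak_curl L a E (wcurl L a E)"
    unfolding wcurl_def L2_eq by blast+
qed

text \<open>Uniqueness makes the norm independent of the choice in \<open>wcurl\<close>, so any
  explicit weak curl can be used to compute it.\<close>

lemma norm2_wcurl:
  assumes "E \<in> square_integrable M" "F \<in> square_integrable M" "weak_curl L a E F"
  shows "norm2 M (wcurl L a E) = norm2 M F"
proof -
  note w = wcurl[OF H_curl_I[OF assms]]
  show ?thesis
    using weak_curl_unique[OF w(1) assms(2) w(2) assms(3)] w(1) assms(2)
    by (intro norm2_cong_AE square_integrable_measurable)
qed

section \<open>Testing up to the plates\<close>

lemma smooth_PEC_C1:
  assumes "G \<in> smooth_PEC L a"
  obtains D where "C1 G D"
  using assms smooth_C1 unfolding smooth_PEC_def by blast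

text \<open>For a smooth PEC field \<open>G\<close> the boundary terms vanish because of
  \<open>G\<close>, so \<Psi> is unrestricted on the plates. Both sides are continuous in the graph
  norm of the curl, in which such \<open>G\<close> approximate \<open>E\<close>.\<close>

lemma H0_curl_test:
  assumes E: "E \<in> H0_curl L a" and \<Psi>: "C1 \<Psi> D'"
  shows "(\<integral>p. bdot (wcurl L a E p) (\<Psi> p) \<partial>M) = (\<integral>p. bdot (E p) (curl_of D' p) \<partial>M)"
proof -
  have EH: "E \<in> H_curl L a" using E by (simp add: H0_curl_def)
  then have Esq: "E \<in> square_integrable M" by (simp add: H_curl_def L2_eq)
  note w = wcurl[OF EH]
  note \<Psi>sq = square_integrable_C1[OF \<Psi>] square_integrable_curl_of[OF \<Psi>]
  let ?x = "(\<integral>p. bdot (wcurl L a E p) (\<Psi> p) \<partial>M) - (\<integral>p. bdot (E p) (curl_of D' p) \<partial>M)"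
  have "norm ?x \<le> 3 * (norm2 M \<Psi> + norm2 M (curl_of D')) * \<epsilon>" if \<epsilon>: "\<epsilon> > 0" for \<epsilon>
  proof -
    obtain G where G: "G \<in> smooth_PEC L a" "hcurl_norm L a (\<lambda>p. E p - G p) < \<epsilon>"
      using E \<epsilon> by (auto simp: H0_curl_def)
    then obtain D where D: "C1 G D" using smooth_PEC_C1 by blast
    note Gsq = square_integrable_C1[OF D] square_integrable_curl_of[OF D]
    define P where "P p = E p - G p" for p
    define Q where "Q p = wcurl L a E p - curl_of D p" for p
    \<comment> \<open>As \<open>Q\<close> is a weak curl of \<open>P\<close>, the graph norm of
      \<open>P\<close>, defined through \<open>wcurl\<close>, controls the norms of both.\<close>
    have PQ: "P \<in> square_integrable M" "Q \<in> square_integrable M" "weak_curl L a P Q"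
      unfolding P_def Q_def
      using Esq w Gsq weak_curl_C1[OF D] by (auto intro!: square_integrable_diff weak_curl_diff)
    have "hcurl_norm L a P = sqrt ((norm2 M P)\<^sup>2 + (norm2 M Q)\<^sup>2)"
      by (simp add: hcurl_norm_def l2norm_eq norm2_wcurl[OF PQ])
    moreover have "hcurl_norm L a P < \<epsilon>" using G(2) by (simp add: P_def[abs_def])
    ultimately have small: "norm2 M P \<le> \<epsilon>" "norm2 M Q \<le> \<epsilon>"
      using real_sqrt_sum_squares_ge1[of "norm2 M P" "norm2 M Q"]
        real_sqrt_sum_squares_ge2[of "norm2 M Q" "norm2 M P"] by linarith+
    have "(\<integral>p. bdot (G p) (curl_of D' p) \<partial>M) = (\<integral>p. bdot (curl_of D p) (\<Psi> p) \<partial>M)"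
      using G(1) by (intro integral_curl_by_parts[OF D \<Psi>]) (auto simp: smooth_PEC_def)
    then have "?x = (\<integral>p. bdot (Q p) (\<Psi> p) \<partial>M) - (\<integral>p. bdot (P p) (curl_of D' p) \<partial>M)"
      unfolding P_def Q_def using Esq w Gsq \<Psi>sq by (simp add: bdot_diff_left integrable_bdot)
    also have "norm \<dots> \<le> 3 * (norm2 M Q * norm2 M \<Psi>) + 3 * (norm2 M P * norm2 M (curl_of D'))"
      by (rule order_trans[OF norm_triangle_ineq4 add_mono]) (intro norm_integral_bdot_le PQ \<Psi>sq)+
    also have "\<dots> \<le> 3 * (\<epsilon> * norm2 M \<Psi>) + 3 * (\<epsilon> * norm2 M (curl_of D'))"
      using small by (intro add_mono mult_left_mono mult_right_mono) auto
    finally show ?thesis by (simp add: algebra_simps)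
  qed
  then have "?x = 0" by (rule norm_le_mult_imp_zero)
  then show ?thesis by simp
qed

text \<open>At the lower plate the sine is bounded by its argument. Since \<open>nu a n * a\<close>
  is a multiple of pi, the reflection z -> a - z preserves the modulus of the sine and carries the
  bound to the upper plate.\<close>

lemma smode_le:
  assumes "z \<in> {0..a}"
  shows "\<bar>smode a n z\<bar> \<le> sqrt (2 / a) * nu a n * z" "\<bar>smode a n z\<bar> \<le> sqrt (2 / a) * nu a n * (a - z)"
proof -
  have nn: "nu a n \<ge> 0" using a by (simp add: nu_def)
  have le: "\<bar>sin (nu a n * t)\<bar> \<le> nu a n * t" if "t \<ge> 0" for t
    using abs_sin_x_le_abs_x[of "nu a n * t"] that nn by (simp add: abs_mult)
  have "\<bar>sin (nu a n * z)\<bar> = \<bar>sin (nu a n * (a - z))\<bar>"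
  proof -
    have e: "nu a n * z = real n * pi - nu a n * (a - z)" using a by (simp add: nu_def field_simps)
    have "sin (nu a n * z) = - (cos (real n * pi) * sin (nu a n * (a - z)))"
      unfolding e by (subst sin_diff) simp
    then show ?thesis by (simp add: abs_mult cos_npi power_abs)
  qed
  with le[of z] le[of "a - z"] assms a
  show "\<bar>smode a n z\<bar> \<le> sqrt (2 / a) * nu a n * z" "\<bar>smode a n z\<bar> \<le> sqrt (2 / a) * nu a n * (a - z)"
    by (simp_all add: smode_def abs_mult mult.assoc mult_left_mono)
qed

text \<open>The gradient of cutoff times mode splits into the cut-off gradient of the mode, whose
  pairing with \<open>E\<close> converges to the uncut one, and a term with the derivative of the
  cutoff, which gives \<open>r k\<close>. The latter is dominated because the sine vanishes linearly
  at the plates, and it tends to 0 pointwise between them.\<close>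

lemma weak_div_test:
  assumes E: "E \<in> square_integrable M" and div: "weak_div_free L a E"
  shows "(\<integral>p. bdot (E p) (grad_of (dsine L a i) p) \<partial>M) = 0"
proof -
  obtain m n where i: "i = (m, n)" by (cases i)
  let ?s = "sine_mode L a i" and ?\<eta> = "\<lambda>k::nat. cutoff a (1 / real (Suc k))"
    and ?\<eta>' = "\<lambda>k::nat. cutoff' a (1 / real (Suc k))"
  define g where "g p = bdot (E p) (grad_of (dsine L a i) p)" for p
  define r where "r k p = E p $ 3 * (complex_of_real (?\<eta>' k (snd (snd p))) * ?s p)" for k p
  have gradsq: "grad_of (dsine L a i) \<in> square_integrable M"
  proof (rule square_integrable_vec)
    fix j :: 3
    show "(\<lambda>p. grad_of (dsine L a i) p $ j) \<in> square_integrable M"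
      using exhaust_3[of j] C1_continuous'[OF C1_sine_mode[of i]]
      by (auto simp: grad_of_def intro!: continuous_square_integrable_M)
  qed
  have gi: "integrable M g" unfolding g_def by (intro integrable_bdot E gradsq)
  have E3: "integrable M (\<lambda>p. E p $ 3)"
    using finite_measure_square_integrable(1)[OF finite_M square_integrable_component[OF E]] .
  define K where "K = sqrt (2 / a) * nu a n"
  have K: "K \<ge> 0" using a by (simp add: K_def nu_def)
  \<comment> \<open>The slope bounds for \<open>smode\<close> give 6K, and 1/L is the modulus of
    \<open>phi\<close>.\<close>
  have rb: "norm (r k p) \<le> 6 * K / L * norm (E p $ 3)" if "p \<in> cell" for k p
  proof -
    have "\<bar>?\<eta>' k (snd (snd p)) * smode a n (snd (snd p))\<bar> \<le> 6 * K"
      using that smode_le[of "snd (snd p)" n] K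
      by (intro cutoff'_mult_le) (simp_all add: K_def mem_Times_iff)
    then have "norm (complex_of_real (?\<eta>' k (snd (snd p))) * ?s p) \<le> 6 * K / L"
      using L by (simp add: sine_mode_def phi_wave i norm_mult norm_divide abs_mult divide_right_mono)
    from mult_left_mono[OF this norm_ge_zero[of "E p $ 3"]]
    show ?thesis unfolding r_def norm_mult[of "E p $ 3"] by (simp only: mult.commute)
  qed
  have \<eta>'m: "(\<lambda>p::point. ?\<eta>' k (snd (snd p))) \<in> borel_measurable M" for k
  proof -
    have "continuous_on cell (\<lambda>p. ?\<eta>' k (snd (snd p)))"
      unfolding cutoff'_def by (intro continuous_intros flat_continuous) auto
    then show ?thesis by (rule continuous_measurable_M)
  qed
  have rm: "r k \<in> borel_measurable M" for k
    unfolding r_def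
    using E3 \<eta>'m[of k] continuous_measurable_M[OF sine_mode_continuous]
    by (intro borel_measurable_times borel_measurable_of_real) auto
  have ri: "integrable M (r k)" for k
  proof (rule Bochner_Integration.integrable_bound)
    show "integrable M (\<lambda>p. 6 * K / L * norm (E p $ 3))" using E3 by simp
    show "AE p in M. norm (r k p) \<le> norm (6 * K / L * norm (E p $ 3))"
      using rb K L by (intro AE_I2) (auto simp: space_M abs_of_nonneg)
  qed (rule rm)
  have eq: "(\<integral>p. complex_of_real (?\<eta> k (snd (snd p))) * g p \<partial>M) + (\<integral>p. r k p \<partial>M) = 0" for k
  proof -
    let ?\<phi> = "\<lambda>p. ?\<eta> k (snd (snd p)) *\<^sub>R ?s p"
    have "test_function L a ?\<phi>"
      by (rule test_function_cutoff) (auto simp: smooth_on_def intro!: Ck_on_sine_mode modes_periodic)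
    then have 0: "(\<integral>p. bdot (E p) (grad ?\<phi> p) \<partial>M) = 0"
      using div by (simp add: weak_div_free_def)
    have "(?\<phi> has_derivative (\<lambda>h. ?\<eta> k (snd (snd p)) *\<^sub>R dsine L a i h p + (?\<eta>' k (snd (snd p)) * snd (snd h)) *\<^sub>R ?s p)) (at p)" for p
    proof (rule has_derivative_scaleR[OF _ sine_mode_has_derivative])
      have "((\<lambda>p::point. snd (snd p)) has_derivative (\<lambda>h. snd (snd h))) (at p)"
        by (intro derivative_intros)
      from has_derivative_compose[OF this cutoff_has_derivative[unfolded has_field_derivative_def]]
      show "((\<lambda>p. ?\<eta> k (snd (snd p))) has_derivative (\<lambda>h. ?\<eta>' k (snd (snd p)) * snd (snd h))) (at p)"
        by simp
    qed
    then have "grad ?\<phi> p = grad_of (\<lambda>h p. ?\<eta> k (snd (snd p)) *\<^sub>R dsine L a i h p +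
        (?\<eta>' k (snd (snd p)) * snd (snd h)) *\<^sub>R ?s p) p" for p
      by (rule grad_eq)
    then have "bdot (E p) (grad ?\<phi> p) = complex_of_real (?\<eta> k (snd (snd p))) * g p + r k p" for p
      by (simp add: g_def r_def bdot_3 grad_of_def scaleR_conv_of_real algebra_simps)
    moreover have "integrable M (\<lambda>p. complex_of_real (?\<eta> k (snd (snd p))) * g p)"
    proof -
      have "(\<lambda>p::point. complex_of_real (?\<eta> k (snd (snd p)))) \<in> borel_measurable M"
        using Ck_on_cutoff[of 0 cell a "1 / real (Suc k)"]
        by (intro continuous_measurable_M continuous_intros) simp
      from integrable_mult_bounded[OF gi this, of 1] show ?thesis
        using cutoff_bounds by (simp add: mult.commute abs_of_nonneg)
    qed
    ultimately show ?thesis using 0 ri[of k] by simp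
  qed
  have "(\<lambda>k. \<integral>p. r k p \<partial>M) \<longlonglongrightarrow> (\<integral>p. 0 \<partial>M)"
  proof (rule integral_dominated_convergence)
    show "integrable M (\<lambda>p. 6 * K / L * norm (E p $ 3))" using E3 by simp
    show "AE p in M. norm (r k p) \<le> 6 * K / L * norm (E p $ 3)" for k
      using rb by (intro AE_I2) (auto simp: space_M)
    show "AE p in M. (\<lambda>k. r k p) \<longlonglongrightarrow> 0"
      using AE_M_z
    proof eventually_elim
      case (elim p)
      have "(\<lambda>k. r k p) \<longlonglongrightarrow> E p $ 3 * (complex_of_real 0 * ?s p)"
        unfolding r_def using elim by (intro tendsto_intros cutoff'_tendsto) auto
      then show ?case by simp
    qed
  qed (use rm in auto)
  from tendsto_add[OF cutoff_integral_tendsto[OF gi] this] show ?thesis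
    unfolding eq by (simp add: LIMSEQ_const_iff g_def[abs_def])
qed

end

section \<open>Reconstruction from coefficients\<close>

type_synonym index = "(int \<times> int) \<times> nat"

abbreviation (input) positive_indices :: "index set" where "positive_indices \<equiv> UNIV \<times> {1..}"

section \<open>Summation over the index set\<close>

lemma summable_on_nonneg_le:
  fixes f g :: "'a \<Rightarrow> real"
  assumes "g summable_on A" "\<And>x. x \<in> A \<Longrightarrow> 0 \<le> f x" "\<And>x. x \<in> A \<Longrightarrow> f x \<le> g x"
  shows "f summable_on A"
proof -
  have "(\<lambda>x. norm (g x)) summable_on A"
    using assms(1) order_trans[OF assms(2,3)] by (subst summable_on_cong[of A _ g]) auto
  then have "(\<lambda>x. norm (f x)) summable_on A"
  proof (rule Infinite_Sum.abs_summable_on_comparison_test)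
    show "norm (f x) \<le> norm (g x)" if "x \<in> A" for x
      using assms(2,3)[OF that] by simp
  qed
  then show ?thesis by (rule abs_summable_summable)
qed

lemma index_split: "UNIV = positive_indices \<union> (\<lambda>m. (m, 0)) ` UNIV" "positive_indices \<inter> (\<lambda>m. (m, 0)) ` UNIV = {}"
proof -
  have "i \<in> positive_indices \<or> i \<in> (\<lambda>m. (m, 0)) ` UNIV" for i :: index
    by (cases i; cases "snd i") auto
  then show "UNIV = positive_indices \<union> (\<lambda>m. (m, 0)) ` UNIV" by blast
qed auto

text \<open>The coefficient conditions treat n = 0 and n at least 1 separately, whereas cosine
  expansions run over all indices; this joins the two.\<close>

lemma summable_on_index_split:
  fixes g :: "index \<Rightarrow> real"
  assumes "g summable_on positive_indices" "(\<lambda>m. g (m, 0)) summable_on UNIV"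
  shows "g summable_on UNIV" "infsum g UNIV = infsum g positive_indices + (\<Sum>\<^sub>\<infinity>m. g (m, 0))"
proof -
  have inj: "inj (\<lambda>m :: int \<times> int. (m, 0 :: nat))" by (simp add: inj_def)
  have s: "g summable_on (\<lambda>m. (m, 0)) ` UNIV"
    using assms(2) by (simp add: summable_on_reindex[OF inj] o_def)
  show "g summable_on UNIV"
    unfolding index_split(1) by (intro summable_on_Un_disjoint assms s index_split)
  have "infsum g (positive_indices \<union> (\<lambda>m. (m, 0)) ` UNIV) = infsum g positive_indices + (\<Sum>\<^sub>\<infinity>m. g (m, 0))"
    using infsum_Un_disjoint[OF assms(1) s index_split(2)] infsum_reindex[OF inj, of g] by (simp add: o_def)
  then show "infsum g UNIV = infsum g positive_indices + (\<Sum>\<^sub>\<infinity>m. g (m, 0))"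
    unfolding index_split(1)[symmetric] .
qed

lemma summable_on_zero_index:
  fixes g :: "index \<Rightarrow> real"
  assumes "g summable_on UNIV"
  shows "(\<lambda>m. g (m, 0)) summable_on UNIV"
proof -
  have inj: "inj (\<lambda>m :: int \<times> int. (m, 0 :: nat))" by (simp add: inj_def)
  have "g summable_on (\<lambda>m. (m, 0)) ` UNIV"
    using assms by (rule summable_on_subset_banach) simp
  then show ?thesis by (simp add: summable_on_reindex[OF inj] o_def)
qed

text \<open>
  With \<open>b = \<i>b'\<close> this is \<open>\<bar>K \<times> e\<bar>\<^sup>2 = \<bar>K\<bar>\<^sup>2\<bar>e\<bar>\<^sup>2 - \<bar>K \<cdot> e\<bar>\<^sup>2\<close> for the real vector \<open>K = (k\<^sub>1, k\<^sub>2, -\<nu>)\<close> and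
  \<open>e = (a\<^sub>1, a\<^sub>2, b')\<close>.
\<close>

lemma curl_symbol_norm:
  fixes k1 k2 \<nu> :: real and a1 a2 b :: complex
  assumes "\<i> * (complex_of_real k1 * a1 + complex_of_real k2 * a2) - complex_of_real \<nu> * b = 0"
  shows "(norm (\<i> * complex_of_real k2 * b - complex_of_real \<nu> * a2))\<^sup>2
       + (norm (complex_of_real \<nu> * a1 - \<i> * complex_of_real k1 * b))\<^sup>2
       + (norm (\<i> * complex_of_real k1 * a2 - \<i> * complex_of_real k2 * a1))\<^sup>2
     = (k1\<^sup>2 + k2\<^sup>2 + \<nu>\<^sup>2) * ((norm a1)\<^sup>2 + (norm a2)\<^sup>2 + (norm b)\<^sup>2)"
proof -
  have "(norm (\<i> * complex_of_real k2 * b - complex_of_real \<nu> * a2))\<^sup>2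
       + (norm (complex_of_real \<nu> * a1 - \<i> * complex_of_real k1 * b))\<^sup>2
       + (norm (\<i> * complex_of_real k1 * a2 - \<i> * complex_of_real k2 * a1))\<^sup>2
       + (norm (\<i> * (complex_of_real k1 * a1 + complex_of_real k2 * a2) - complex_of_real \<nu> * b))\<^sup>2
     = (k1\<^sup>2 + k2\<^sup>2 + \<nu>\<^sup>2) * ((norm a1)\<^sup>2 + (norm a2)\<^sup>2 + (norm b)\<^sup>2)"
    unfolding cmod_power2 by (simp add: power2_eq_square algebra_simps)
  then show ?thesis using assms by simp
qed

lemma norm_kvec_sq: "(norm (kvec L m))\<^sup>2 = (fst (kvec L m))\<^sup>2 + (snd (kvec L m))\<^sup>2"
  by (cases "kvec L m") (simp add: norm_Pair)

lemma norm_vec2: "(norm (v :: complex^2))\<^sup>2 = (norm (v $ 1))\<^sup>2 + (norm (v $ 2))\<^sup>2"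
  by (simp add: norm_vec_def L2_set_def sum_2)

text \<open>The Fourier symbol of the curl. The first two entries multiply cosine modes and the
  third multiplies sine modes, so the third has a meaning for n at least 1 only.\<close>

definition curl_coeff :: "real \<Rightarrow> real \<Rightarrow> coeffs \<Rightarrow> index \<Rightarrow> complex^3" where
  "curl_coeff L a = (\<lambda>(\<alpha>, \<beta>) (m, n). vector
     [\<i> * complex_of_real (snd (kvec L m)) * \<beta> m n - complex_of_real (nu a n) * \<alpha> m n $ 2,
      complex_of_real (nu a n) * \<alpha> m n $ 1 - \<i> * complex_of_real (fst (kvec L m)) * \<beta> m n,
      \<i> * complex_of_real (fst (kvec L m)) * \<alpha> m n $ 2 - \<i> * complex_of_real (snd (kvec L m)) * \<alpha> m n $ 1])"

context slab
begin

definition field_coeff :: "coeffs \<Rightarrow> index \<Rightarrow> complex^3" where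
  "field_coeff = (\<lambda>(\<alpha>, \<beta>) (m, n). vector [\<alpha> m n $ 1, \<alpha> m n $ 2, \<beta> m n])"

lemma C_PEC_D:
  assumes c: "(\<alpha>, \<beta>) \<in> C_PEC L a"
  shows "\<alpha> m 0 = 0"
    and "(\<lambda>(m, n). (1 + lam L a m n) * ((norm (\<alpha> m n))\<^sup>2 + (norm (\<beta> m n))\<^sup>2)) summable_on positive_indices"
    and "(\<lambda>m. (1 + (norm (kvec L m))\<^sup>2) * (norm (\<beta> m 0))\<^sup>2) summable_on UNIV"
    and "n \<ge> 1 \<Longrightarrow> \<i> * (complex_of_real (fst (kvec L m)) * \<alpha> m n $ 1 + complex_of_real (snd (kvec L m)) * \<alpha> m n $ 2)
        - complex_of_real (nu a n) * \<beta> m n = 0"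
  using c unfolding C_PEC_def by blast+

lemma curl_coeff_norm:
  assumes c: "(\<alpha>, \<beta>) \<in> C_PEC L a" and n: "n \<ge> 1"
  shows "(norm (curl_coeff L a (\<alpha>, \<beta>) (m, n) $ 1))\<^sup>2 + (norm (curl_coeff L a (\<alpha>, \<beta>) (m, n) $ 2))\<^sup>2
      + (norm (curl_coeff L a (\<alpha>, \<beta>) (m, n) $ 3))\<^sup>2
    = lam L a m n * ((norm (\<alpha> m n))\<^sup>2 + (norm (\<beta> m n))\<^sup>2)"
  using curl_symbol_norm[OF C_PEC_D(4)[OF c n]]
  by (simp add: curl_coeff_def lam_def norm_kvec_sq norm_vec2)

lemma curl_coeff_norm_0:
  assumes c: "(\<alpha>, \<beta>) \<in> C_PEC L a"
  shows "(norm (curl_coeff L a (\<alpha>, \<beta>) (m, 0) $ 1))\<^sup>2 + (norm (curl_coeff L a (\<alpha>, \<beta>) (m, 0) $ 2))\<^sup>2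
    = (norm (kvec L m))\<^sup>2 * (norm (\<beta> m 0))\<^sup>2"
  by (simp add: curl_coeff_def norm_kvec_sq norm_mult power_mult_distrib algebra_simps)

lemma lam_nonneg: "0 \<le> lam L a m n"
  by (simp add: lam_def)

text \<open>The squared entries are bounded by the terms of the two series in \<open>C_PEC\<close>.
  For the curl this rests on the divergence constraint when n is at least 1 and on the direct
  formula when n = 0.\<close>

lemma coeff_summable:
  assumes c: "(\<alpha>, \<beta>) \<in> C_PEC L a"
  shows "(\<lambda>i. (norm (field_coeff (\<alpha>, \<beta>) i $ 1))\<^sup>2) summable_on positive_indices"
    and "(\<lambda>i. (norm (field_coeff (\<alpha>, \<beta>) i $ 2))\<^sup>2) summable_on positive_indices"
    and "(\<lambda>i. (norm (field_coeff (\<alpha>, \<beta>) i $ 3))\<^sup>2) summable_on UNIV"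
    and "(\<lambda>i. (norm (curl_coeff L a (\<alpha>, \<beta>) i $ 1))\<^sup>2) summable_on UNIV"
    and "(\<lambda>i. (norm (curl_coeff L a (\<alpha>, \<beta>) i $ 2))\<^sup>2) summable_on UNIV"
    and "(\<lambda>i. (norm (curl_coeff L a (\<alpha>, \<beta>) i $ 3))\<^sup>2) summable_on positive_indices"
proof -
  have field: "(norm (field_coeff (\<alpha>, \<beta>) (m, n) $ j))\<^sup>2 \<le> (1 + lam L a m n) * ((norm (\<alpha> m n))\<^sup>2 + (norm (\<beta> m n))\<^sup>2)" for m n j
  proof -
    have "(norm (field_coeff (\<alpha>, \<beta>) (m, n) $ j))\<^sup>2 \<le> 1 * ((norm (\<alpha> m n))\<^sup>2 + (norm (\<beta> m n))\<^sup>2)"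
      using exhaust_3[of j] by (auto simp: field_coeff_def norm_vec2)
    also have "\<dots> \<le> (1 + lam L a m n) * ((norm (\<alpha> m n))\<^sup>2 + (norm (\<beta> m n))\<^sup>2)"
      using lam_nonneg by (intro mult_right_mono) auto
    finally show ?thesis .
  qed
  have curl: "(norm (curl_coeff L a (\<alpha>, \<beta>) (m, n) $ j))\<^sup>2 \<le> (1 + lam L a m n) * ((norm (\<alpha> m n))\<^sup>2 + (norm (\<beta> m n))\<^sup>2)"
    if "n \<ge> 1" for m n j
  proof -
    have "(norm (curl_coeff L a (\<alpha>, \<beta>) (m, n) $ j))\<^sup>2 \<le> lam L a m n * ((norm (\<alpha> m n))\<^sup>2 + (norm (\<beta> m n))\<^sup>2)"
      unfolding curl_coeff_norm[OF c that, symmetric] using exhaust_3[of j] by auto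
    also have "\<dots> \<le> (1 + lam L a m n) * ((norm (\<alpha> m n))\<^sup>2 + (norm (\<beta> m n))\<^sup>2)"
      by (intro mult_right_mono) auto
    finally show ?thesis .
  qed
  have pos: "(\<lambda>i. (norm (field_coeff (\<alpha>, \<beta>) i $ j))\<^sup>2) summable_on positive_indices"
    "(\<lambda>i. (norm (curl_coeff L a (\<alpha>, \<beta>) i $ j))\<^sup>2) summable_on positive_indices" for j
    by (rule summable_on_nonneg_le[OF C_PEC_D(2)[OF c]]; auto intro: field curl)+
  show "(\<lambda>i. (norm (field_coeff (\<alpha>, \<beta>) i $ 1))\<^sup>2) summable_on positive_indices"
    "(\<lambda>i. (norm (field_coeff (\<alpha>, \<beta>) i $ 2))\<^sup>2) summable_on positive_indices"
    "(\<lambda>i. (norm (curl_coeff L a (\<alpha>, \<beta>) i $ 3))\<^sup>2) summable_on positive_indices"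
    by (rule pos)+
  have "(\<lambda>m. (norm (field_coeff (\<alpha>, \<beta>) (m, 0) $ 3))\<^sup>2) summable_on UNIV"
    by (rule summable_on_nonneg_le[OF C_PEC_D(3)[OF c]]) (auto simp: field_coeff_def algebra_simps)
  then show "(\<lambda>i. (norm (field_coeff (\<alpha>, \<beta>) i $ 3))\<^sup>2) summable_on UNIV"
    by (rule summable_on_index_split(1)[OF pos(1)])
  have z: "(norm (curl_coeff L a (\<alpha>, \<beta>) (m, 0) $ j))\<^sup>2 \<le> (1 + (norm (kvec L m))\<^sup>2) * (norm (\<beta> m 0))\<^sup>2"
    if "j \<noteq> 3" for m j
  proof -
    have "(norm (curl_coeff L a (\<alpha>, \<beta>) (m, 0) $ j))\<^sup>2 \<le> (norm (kvec L m))\<^sup>2 * (norm (\<beta> m 0))\<^sup>2"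
      unfolding curl_coeff_norm_0[OF c, symmetric] using exhaust_3[of j] that by auto
    also have "\<dots> \<le> (1 + (norm (kvec L m))\<^sup>2) * (norm (\<beta> m 0))\<^sup>2"
      by (intro mult_right_mono) auto
    finally show ?thesis .
  qed
  have z': "(\<lambda>m. (norm (curl_coeff L a (\<alpha>, \<beta>) (m, 0) $ j))\<^sup>2) summable_on UNIV" if "j \<noteq> 3" for j
    by (rule summable_on_nonneg_le[OF C_PEC_D(3)[OF c]]) (auto intro: z[OF that])
  show "(\<lambda>i. (norm (curl_coeff L a (\<alpha>, \<beta>) i $ 1))\<^sup>2) summable_on UNIV"
    "(\<lambda>i. (norm (curl_coeff L a (\<alpha>, \<beta>) i $ 2))\<^sup>2) summable_on UNIV"
    by (intro summable_on_index_split(1)[OF pos(2) z']; simp)+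
qed

subsection \<open>The reconstruction class\<close>

definition field_expands :: "(point \<Rightarrow> complex^3) \<Rightarrow> (index \<Rightarrow> complex^3) \<Rightarrow> bool" where
  "field_expands E c \<longleftrightarrow> sines.expands (\<lambda>p. E p $ 1) (\<lambda>i. c i $ 1) \<and> sines.expands (\<lambda>p. E p $ 2) (\<lambda>i. c i $ 2) \<and>
     cosines.expands (\<lambda>p. E p $ 3) (\<lambda>i. c i $ 3)"

definition curl_expands :: "(point \<Rightarrow> complex^3) \<Rightarrow> (index \<Rightarrow> complex^3) \<Rightarrow> bool" where
  "curl_expands F c \<longleftrightarrow> cosines.expands (\<lambda>p. F p $ 1) (\<lambda>i. c i $ 1) \<and> cosines.expands (\<lambda>p. F p $ 2) (\<lambda>i. c i $ 2) \<and>
     sines.expands (\<lambda>p. F p $ 3) (\<lambda>i. c i $ 3)"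

text \<open>\<open>recon\<close> takes one norm of the tangential pair. It is the root of the sum of
  the squared component norms, so it tends to 0 exactly when both scalar series converge.\<close>

lemma recon_iff: "E \<in> recon L a x \<longleftrightarrow> E \<in> square_integrable M \<and> field_expands E (field_coeff x)"
proof -
  obtain \<alpha> \<beta> where x: "x = (\<alpha>, \<beta>)" by (cases x)
  let ?f = "\<lambda>S (x, y, z). E_par E (x, y, z)
             - (\<Sum>(m, n)\<in>S. (phi L m (x, y) * complex_of_real (smode a n z)) *s \<alpha> m n)"
  let ?g = "\<lambda>j S p. E p $ j - (\<Sum>i\<in>S. field_coeff x i $ j * sine_mode L a i p)"
  have comp: "?f S p $ 1 = ?g 1 S p" "?f S p $ 2 = ?g 2 S p" for S p
    by (cases p, simp add: E_par_def field_coeff_def x sine_mode_def case_prod_unfold sum_component mult.commute)+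
  have 3: "(\<lambda>(x, y, z). E (x, y, z) $ 3 - (\<Sum>(m, n)\<in>S. \<beta> m n * phi L m (x, y) * complex_of_real (cmode a n z))) =
      (\<lambda>p. E p $ 3 - (\<Sum>i\<in>S. field_coeff x i $ 3 * cosine_mode L a i p))" for S
    by (auto simp: fun_eq_iff field_coeff_def x cosine_mode_def case_prod_unfold mult.assoc)
  have par: "((\<lambda>S. norm2 M (?f S)) \<longlongrightarrow> 0) (finite_subsets_at_top positive_indices) \<longleftrightarrow>
      ((\<lambda>S. norm2 M (?g 1 S)) \<longlongrightarrow> 0) (finite_subsets_at_top positive_indices) \<and>
      ((\<lambda>S. norm2 M (?g 2 S)) \<longlongrightarrow> 0) (finite_subsets_at_top positive_indices)"
    if E: "E \<in> square_integrable M"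
  proof -
    have g: "?g j S \<in> square_integrable M" for j S
      by (intro square_integrable_diff square_integrable_component E square_integrable_sum
          square_integrable_cmult continuous_square_integrable_M sine_mode_continuous)
    have n: "norm2 M (?f S) = sqrt ((norm2 M (?g 1 S))\<^sup>2 + (norm2 M (?g 2 S))\<^sup>2)" for S
    proof -
      have "(norm2 M (?f S))\<^sup>2 = (norm2 M (?g 1 S))\<^sup>2 + (norm2 M (?g 2 S))\<^sup>2"
        unfolding norm2_sq norm_vec2 comp using square_integrable_norm[OF g] by simp
      from real_sqrt_unique[OF this norm2_nonneg] show ?thesis by (rule sym)
    qed
    show ?thesis
    proof (intro iffI conjI)
      assume l: "((\<lambda>S. norm2 M (?f S)) \<longlongrightarrow> 0) (finite_subsets_at_top positive_indices)"
      show "((\<lambda>S. norm2 M (?g 1 S)) \<longlongrightarrow> 0) (finite_subsets_at_top positive_indices)"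
        by (rule Lim_null_comparison[OF always_eventually l]) (auto simp: n real_sqrt_sum_squares_ge1)
      show "((\<lambda>S. norm2 M (?g 2 S)) \<longlongrightarrow> 0) (finite_subsets_at_top positive_indices)"
        by (rule Lim_null_comparison[OF always_eventually l]) (auto simp: n real_sqrt_sum_squares_ge2)
    next
      assume "((\<lambda>S. norm2 M (?g 1 S)) \<longlongrightarrow> 0) (finite_subsets_at_top positive_indices) \<and>
        ((\<lambda>S. norm2 M (?g 2 S)) \<longlongrightarrow> 0) (finite_subsets_at_top positive_indices)"
      then have "((\<lambda>S. sqrt ((norm2 M (?g 1 S))\<^sup>2 + (norm2 M (?g 2 S))\<^sup>2)) \<longlongrightarrow> sqrt (0\<^sup>2 + 0\<^sup>2))
          (finite_subsets_at_top positive_indices)"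
        by (intro tendsto_intros) auto
      then show "((\<lambda>S. norm2 M (?f S)) \<longlongrightarrow> 0) (finite_subsets_at_top positive_indices)"
        by (simp add: n)
    qed
  qed
  show ?thesis
    unfolding recon_def x case_prod_conv mem_Collect_eq L2_eq l2norm_eq 3[unfolded x] field_expands_def
      sines.expands_def cosines.expands_def
    using par[unfolded x] by blast
qed

lemma field_expands_unique:
  assumes "E \<in> square_integrable M" "field_expands E c" "E' \<in> square_integrable M" "field_expands E' c"
  shows "AE p in M. E p = E' p"
proof -
  note sq = square_integrable_component[OF assms(1)] square_integrable_component[OF assms(3)]
  have "AE p in M. E p $ 1 = E' p $ 1" "AE p in M. E p $ 2 = E' p $ 2" "AE p in M. E p $ 3 = E' p $ 3"
    using assms(2,4) sines.expands_unique_AE[OF sq(1) _ sq(2)] cosines.expands_unique_AE[OF sq(1) _ sq(2)]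
    unfolding field_expands_def by blast+
  then show ?thesis by eventually_elim (simp add: vec_eq_iff forall_3)
qed

lemma field_expands_cong_AE:
  assumes E: "E \<in> square_integrable M" "field_expands E c" and E': "E' \<in> square_integrable M"
    and ae: "AE p in M. E p = E' p"
  shows "field_expands E' c"
proof -
  have "AE p in M. E p $ j = E' p $ j" for j using ae by eventually_elim simp
  with E(2) show ?thesis
    using sines.expands_cong_AE[OF square_integrable_component[OF E(1)] _ square_integrable_component[OF E']]
      cosines.expands_cong_AE[OF square_integrable_component[OF E(1)] _ square_integrable_component[OF E']]
    unfolding field_expands_def by blast
qed

text \<open>An expansion fixes the field almost everywhere and survives changes on null sets, so
  every nonempty value of \<open>recon\<close> is a full equivalence class.\<close>

lemma recon_class:
  assumes E: "E \<in> recon L a x"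
  shows "recon L a x = ae_eq L a `` {E}"
proof (intro set_eqI iffI)
  fix F assume "F \<in> recon L a x"
  with E show "F \<in> ae_eq L a `` {E}"
    using field_expands_unique by (auto simp: recon_iff ae_eq_def L2_eq)
next
  fix F assume "F \<in> ae_eq L a `` {E}"
  with E show "F \<in> recon L a x"
    using field_expands_cong_AE by (auto simp: recon_iff ae_eq_def L2_eq)
qed

lemma recon_inj:
  assumes x: "x \<in> C_PEC L a" "y \<in> C_PEC L a" and E: "E \<in> recon L a x" "E \<in> recon L a y"
  shows "x = y"
proof -
  obtain \<alpha> \<beta> \<alpha>' \<beta>' where xy: "x = (\<alpha>, \<beta>)" "y = (\<alpha>', \<beta>')" by (cases x, cases y)
  have sq: "(\<lambda>p. E p $ j) \<in> square_integrable M" for j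
    using E by (auto simp: recon_iff intro: square_integrable_component)
  have e: "field_expands E (field_coeff x)" "field_expands E (field_coeff y)"
    using E by (auto simp: recon_iff)
  have pos: "field_coeff x i $ 1 = field_coeff y i $ 1" "field_coeff x i $ 2 = field_coeff y i $ 2"
    if "i \<in> positive_indices" for i
    using e that sines.expands_coeff[OF sq] unfolding field_expands_def by metis+
  have "\<alpha> m n $ 1 = \<alpha>' m n $ 1" "\<alpha> m n $ 2 = \<alpha>' m n $ 2" if "n \<ge> 1" for m n
    using pos[of "(m, n)"] that by (simp_all add: field_coeff_def xy)
  \<comment> \<open>No sine mode sees the entries at n = 0; they agree by the convention built into
    \<open>C_PEC\<close>.\<close>
  moreover have "\<alpha> m 0 = \<alpha>' m 0" for m
    using C_PEC_D(1) x xy by metis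
  ultimately have "\<alpha> m n = \<alpha>' m n" for m n
    by (cases "n = 0") (auto simp: vec_eq_iff forall_2)
  moreover have "field_coeff x i $ 3 = field_coeff y i $ 3" for i
    using e cosines.expands_coeff[OF sq] unfolding field_expands_def by (metis UNIV_I)
  from this[of "(_, _)"] have "\<beta> m n = \<beta>' m n" for m n
    by (simp add: field_coeff_def xy)
  ultimately show ?thesis by (auto simp: xy fun_eq_iff)
qed

section \<open>Partial sums as smooth approximants\<close>

definition partial_field :: "(index \<Rightarrow> complex^3) \<Rightarrow> index set \<Rightarrow> point \<Rightarrow> complex^3" where
  "partial_field c S p = vector [\<Sum>i\<in>S. c i $ 1 * sine_mode L a i p, \<Sum>i\<in>S. c i $ 2 * sine_mode L a i p,
     \<Sum>i\<in>S. c i $ 3 * cosine_mode L a i p]"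

definition dpartial_field :: "(index \<Rightarrow> complex^3) \<Rightarrow> index set \<Rightarrow> point \<Rightarrow> point \<Rightarrow> complex^3" where
  "dpartial_field c S h p = vector [\<Sum>i\<in>S. c i $ 1 * dsine L a i h p, \<Sum>i\<in>S. c i $ 2 * dsine L a i h p,
     \<Sum>i\<in>S. c i $ 3 * dcosine L a i h p]"

lemma C1_partial_field: "C1 (partial_field c S) (dpartial_field c S)"
proof (rule C1_vec)
  fix j :: 3
  have "C1 (\<lambda>p. \<Sum>i\<in>S. c i $ k * sine_mode L a i p) (\<lambda>h p. \<Sum>i\<in>S. c i $ k * dsine L a i h p)"
    "C1 (\<lambda>p. \<Sum>i\<in>S. c i $ k * cosine_mode L a i p) (\<lambda>h p. \<Sum>i\<in>S. c i $ k * dcosine L a i h p)" for k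
    by (intro C1_sum C1_cmult C1_sine_mode C1_cosine_mode)+
  then show "C1 (\<lambda>p. partial_field c S p $ j) (\<lambda>h p. dpartial_field c S h p $ j)"
    using exhaust_3[of j] by (auto simp: partial_field_def dpartial_field_def)
qed

lemma sine_mode_plates: "z \<in> {0, a} \<Longrightarrow> sine_mode L a i (x, y, z) = 0"
  using a by (auto simp: sine_mode_def smode_def nu_def mult.commute[of pi])

lemma partial_field_smooth_PEC: "partial_field c S \<in> smooth_PEC L a"
proof -
  have "Ck_on k layer (partial_field c S)" for k
  proof (rule Ck_on_vec)
    fix j :: 3
    have "Ck_on k layer (\<lambda>p. \<Sum>i\<in>S. c i $ l * sine_mode L a i p)"
      "Ck_on k layer (\<lambda>p. \<Sum>i\<in>S. c i $ l * cosine_mode L a i p)" for l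
      by (intro Ck_on_sum Ck_on_mult Ck_on_const Ck_on_sine_mode Ck_on_cosine_mode)+
    then show "Ck_on k layer (\<lambda>p. partial_field c S p $ j)"
      using exhaust_3[of j] by (auto simp: partial_field_def)
  qed
  moreover have "lat_periodic L {0..a} (partial_field c S)"
    using C1_partial_field[of c S] unfolding C1_def by blast
  moreover have "partial_field c S (x, y, z) $ 1 = 0 \<and> partial_field c S (x, y, z) $ 2 = 0"
    if "z \<in> {0, a}" for x y z
    by (simp add: partial_field_def sine_mode_plates[OF that])
  ultimately show ?thesis unfolding smooth_PEC_def smooth_on_def by blast
qed

lemma dlateral_simps [simp]:
  "dlateral L i (1, 0, 0) = \<i> * complex_of_real (fst (kvec L (fst i)))"
  "dlateral L i (0, 1, 0) = \<i> * complex_of_real (snd (kvec L (fst i)))"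
  "dlateral L i (0, 0, 1) = 0"
  by (simp_all add: dlateral_def inner_prod_def)

lemma curl_of_partial_field:
  "curl_of (dpartial_field (field_coeff x) S) p =
    vector [\<Sum>i\<in>S. curl_coeff L a x i $ 1 * cosine_mode L a i p, \<Sum>i\<in>S. curl_coeff L a x i $ 2 * cosine_mode L a i p,
      \<Sum>i\<in>S. curl_coeff L a x i $ 3 * sine_mode L a i p]"
proof -
  have "curl_of (dpartial_field (field_coeff x) S) p $ 1 = (\<Sum>i\<in>S. curl_coeff L a x i $ 1 * cosine_mode L a i p)"
    "curl_of (dpartial_field (field_coeff x) S) p $ 2 = (\<Sum>i\<in>S. curl_coeff L a x i $ 2 * cosine_mode L a i p)"
    "curl_of (dpartial_field (field_coeff x) S) p $ 3 = (\<Sum>i\<in>S. curl_coeff L a x i $ 3 * sine_mode L a i p)"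
    unfolding curl_of_def dpartial_field_def vector_3 sum_subtractf[symmetric]
    by (cases x, intro sum.cong refl,
        simp add: field_coeff_def curl_coeff_def dsine_def dcosine_def case_prod_unfold algebra_simps)+
  then show ?thesis by (simp add: vec_eq_iff forall_3)
qed

lemma sine_mode_0 [simp]: "sine_mode L a (m, 0) p = 0"
  by (simp add: sine_mode_def smode_def)

text \<open>For each index all three terms are multiples of one sine mode, and the total factor is
  the left side of the divergence constraint. For n = 0, where no constraint is imposed, the sine
  mode vanishes.\<close>

lemma div_partial_field:
  assumes "x \<in> C_PEC L a"
  shows "dpartial_field (field_coeff x) S (1, 0, 0) p $ 1 + dpartial_field (field_coeff x) S (0, 1, 0) p $ 2
    + dpartial_field (field_coeff x) S (0, 0, 1) p $ 3 = 0"
proof -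
  obtain \<alpha> \<beta> where x: "x = (\<alpha>, \<beta>)" by (cases x)
  have "field_coeff x i $ 1 * dsine L a i (1, 0, 0) p + field_coeff x i $ 2 * dsine L a i (0, 1, 0) p
      + field_coeff x i $ 3 * dcosine L a i (0, 0, 1) p = 0" for i
  proof -
    obtain m n where i: "i = (m, n)" by (cases i)
    have "field_coeff x i $ 1 * dsine L a i (1, 0, 0) p + field_coeff x i $ 2 * dsine L a i (0, 1, 0) p
      + field_coeff x i $ 3 * dcosine L a i (0, 0, 1) p =
      (\<i> * (complex_of_real (fst (kvec L m)) * \<alpha> m n $ 1 + complex_of_real (snd (kvec L m)) * \<alpha> m n $ 2)
        - complex_of_real (nu a n) * \<beta> m n) * sine_mode L a i p"
      by (simp add: field_coeff_def x i dsine_def dcosine_def algebra_simps)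
    also have "\<dots> = 0"
      using C_PEC_D(4)[OF assms[unfolded x], of n m] by (cases "n = 0") (simp_all add: i)
    finally show ?thesis .
  qed
  then show ?thesis by (simp add: dpartial_field_def sum.distrib[symmetric])
qed

text \<open>Sine series are indexed by n at least 1, cosine series by all n. Admitting the vanishing
  sine modes at n = 0 puts both on one filter, so that one finite set can serve all
  components.\<close>

lemma sines_tendsto:
  assumes "sines.expands f c"
  shows "((\<lambda>S. norm2 M (\<lambda>p. f p - (\<Sum>i\<in>S. c i * sine_mode L a i p))) \<longlongrightarrow> 0) (finite_subsets_at_top UNIV)"
proof -
  have "filterlim (\<lambda>S. S \<inter> positive_indices) (finite_subsets_at_top positive_indices) (finite_subsets_at_top UNIV)"
    unfolding filterlim_iff eventually_finite_subsets_at_top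
  proof (intro allI impI)
    fix P :: "index set \<Rightarrow> bool"
    assume "\<exists>X. finite X \<and> X \<subseteq> positive_indices \<and> (\<forall>Y. finite Y \<and> X \<subseteq> Y \<and> Y \<subseteq> positive_indices \<longrightarrow> P Y)"
    then obtain X where X: "finite X" "X \<subseteq> positive_indices"
      "\<forall>Y. finite Y \<and> X \<subseteq> Y \<and> Y \<subseteq> positive_indices \<longrightarrow> P Y" by (elim exE conjE)
    have "P (Y \<inter> positive_indices)" if "finite Y" "X \<subseteq> Y" for Y
      using X(3)[rule_format, of "Y \<inter> positive_indices"] that X(2) by blast
    with X(1) show "\<exists>X. finite X \<and> X \<subseteq> UNIV \<and> (\<forall>Y. finite Y \<and> X \<subseteq> Y \<and> Y \<subseteq> UNIV \<longrightarrow> P (Y \<inter> positive_indices))"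
      by blast
  qed
  from filterlim_compose[OF assms[unfolded sines.expands_def] this]
  have "((\<lambda>S. norm2 M (\<lambda>p. f p - (\<Sum>i\<in>S \<inter> positive_indices. c i * sine_mode L a i p))) \<longlongrightarrow> 0) (finite_subsets_at_top UNIV)" .
  then show ?thesis
  proof (rule Lim_transform_eventually)
    have "(\<Sum>i\<in>S \<inter> positive_indices. c i * sine_mode L a i p) = (\<Sum>i\<in>S. c i * sine_mode L a i p)" if "finite S" for S p
      using that
    proof (intro sum.mono_neutral_left ballI)
      fix i assume "i \<in> S - S \<inter> positive_indices"
      then show "c i * sine_mode L a i p = 0" by (cases i; cases "snd i") auto
    qed auto
    then show "\<forall>\<^sub>F S in finite_subsets_at_top UNIV.
        norm2 M (\<lambda>p. f p - (\<Sum>i\<in>S \<inter> positive_indices. c i * sine_mode L a i p)) =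
        norm2 M (\<lambda>p. f p - (\<Sum>i\<in>S. c i * sine_mode L a i p))"
      by (intro eventually_finite_subsets_at_top_weakI) simp
  qed
qed

lemma norm2_vec_tendsto:
  fixes f :: "'s \<Rightarrow> point \<Rightarrow> complex^3"
  assumes "\<And>S. f S \<in> square_integrable M" and lim: "\<And>j. ((\<lambda>S. norm2 M (\<lambda>p. f S p $ j)) \<longlongrightarrow> 0) F"
  shows "((\<lambda>S. norm2 M (f S)) \<longlongrightarrow> 0) F"
proof -
  have n: "norm2 M (f S) = sqrt ((norm2 M (\<lambda>p. f S p $ 1))\<^sup>2 + (norm2 M (\<lambda>p. f S p $ 2))\<^sup>2 + (norm2 M (\<lambda>p. f S p $ 3))\<^sup>2)" for S
    using real_sqrt_unique[OF norm2_vec[OF assms(1)] norm2_nonneg] by (rule sym)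
  have "((\<lambda>S. sqrt ((norm2 M (\<lambda>p. f S p $ 1))\<^sup>2 + (norm2 M (\<lambda>p. f S p $ 2))\<^sup>2 + (norm2 M (\<lambda>p. f S p $ 3))\<^sup>2)) \<longlongrightarrow>
      sqrt (0\<^sup>2 + 0\<^sup>2 + 0\<^sup>2)) F"
    by (intro tendsto_intros lim)
  then show ?thesis by (simp add: n)
qed

text \<open>Field and curl converge along the same net, so a single partial sum is close to
  \<open>E\<close> while its classical curl is close to \<open>F\<close>: an approximation in the
  graph norm.\<close>

lemma approximation:
  assumes E: "E \<in> square_integrable M" "field_expands E (field_coeff x)"
    and F: "F \<in> square_integrable M" "curl_expands F (curl_coeff L a x)" and \<epsilon>: "\<epsilon> > 0"
  obtains S where "norm2 M (\<lambda>p. E p - partial_field (field_coeff x) S p) < \<epsilon>"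
    and "norm2 M (\<lambda>p. F p - curl_of (dpartial_field (field_coeff x) S) p) < \<epsilon>"
proof -
  let ?U = "partial_field (field_coeff x)" and ?D = "dpartial_field (field_coeff x)"
  note C1 = C1_partial_field[of "field_coeff x"]
  have "((\<lambda>S. norm2 M (\<lambda>p. E p - ?U S p)) \<longlongrightarrow> 0) (finite_subsets_at_top UNIV)"
  proof (rule norm2_vec_tendsto)
    show "(\<lambda>p. E p - ?U S p) \<in> square_integrable M" for S
      by (intro square_integrable_diff E square_integrable_C1[OF C1])
    show "((\<lambda>S. norm2 M (\<lambda>p. (E p - ?U S p) $ j)) \<longlongrightarrow> 0) (finite_subsets_at_top UNIV)" for j
      using exhaust_3[of j] E(2) sines_tendsto
      by (auto simp: partial_field_def field_expands_def cosines.expands_def)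
  qed
  moreover have "((\<lambda>S. norm2 M (\<lambda>p. F p - curl_of (?D S) p)) \<longlongrightarrow> 0) (finite_subsets_at_top UNIV)"
  proof (rule norm2_vec_tendsto)
    show "(\<lambda>p. F p - curl_of (?D S) p) \<in> square_integrable M" for S
      by (intro square_integrable_diff F square_integrable_curl_of[OF C1])
    show "((\<lambda>S. norm2 M (\<lambda>p. (F p - curl_of (?D S) p) $ j)) \<longlongrightarrow> 0) (finite_subsets_at_top UNIV)" for j
      using exhaust_3[of j] F(2) sines_tendsto
      by (auto simp: curl_of_partial_field curl_expands_def cosines.expands_def)
  qed
  ultimately have "\<forall>\<^sub>F S in finite_subsets_at_top UNIV. norm2 M (\<lambda>p. E p - ?U S p) < \<epsilon> \<and>
      norm2 M (\<lambda>p. F p - curl_of (?D S) p) < \<epsilon>"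
    using \<epsilon> by (intro eventually_conj order_tendstoD(2))
  from eventually_happens[OF this] show ?thesis using that by auto
qed

lemma grad_test_function:
  assumes "test_function L a \<phi>"
  obtains D where "C1 \<phi> D" "grad \<phi> = grad_of D" "grad_of D \<in> square_integrable M"
proof -
  obtain D where D: "C1 \<phi> D" "\<forall>p. (\<phi> has_derivative (\<lambda>h. D h p)) (at p)"
    using test_function_C1[OF assms] by blast
  have "grad_of D \<in> square_integrable M"
  proof (rule square_integrable_vec)
    fix j :: 3
    show "(\<lambda>p. grad_of D p $ j) \<in> square_integrable M"
      using exhaust_3[of j] C1_continuous'[OF D(1)]
      by (auto simp: grad_of_def intro!: continuous_square_integrable_M)
  qed
  moreover have "grad \<phi> = grad_of D" by (intro ext grad_eq D(2)[rule_format])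
  ultimately show ?thesis using D(1) that by blast
qed

text \<open>The weak curl and the vanishing divergence pass to the limit because they are identities
  continuous in L2. Membership in \<open>H0_curl\<close> holds because the partial sums are
  themselves smooth PEC approximants.\<close>

lemma reconstructed_field:
  assumes x: "x \<in> C_PEC L a" and E: "E \<in> square_integrable M" "field_expands E (field_coeff x)"
    and F: "F \<in> square_integrable M" "curl_expands F (curl_coeff L a x)"
  shows "weak_curl L a E F" "E \<in> V_PEC L a"
proof -
  let ?U = "partial_field (field_coeff x)" and ?D = "dpartial_field (field_coeff x)"
  note C1 = C1_partial_field[of "field_coeff x"]
  note sq = square_integrable_C1[OF C1] square_integrable_curl_of[OF C1]
  show w: "weak_curl L a E F"
    unfolding weak_curl_iff
  proof (intro allI impI)
    fix \<Phi> :: "point \<Rightarrow> complex^3" and D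
    assume \<Phi>: "test_function L a \<Phi>" "C1 \<Phi> D" "\<forall>p. (\<Phi> has_derivative (\<lambda>h. D h p)) (at p)"
    note \<Phi>sq = square_integrable_C1[OF \<Phi>(2)] square_integrable_curl_of[OF \<Phi>(2)]
    let ?x = "(\<integral>p. bdot (E p) (curl_of D p) \<partial>M) - (\<integral>p. bdot (F p) (\<Phi> p) \<partial>M)"
    have "norm ?x \<le> 3 * (norm2 M (curl_of D) + norm2 M \<Phi>) * \<epsilon>" if "\<epsilon> > 0" for \<epsilon>
    proof -
      obtain S where S: "norm2 M (\<lambda>p. E p - ?U S p) < \<epsilon>" "norm2 M (\<lambda>p. F p - curl_of (?D S) p) < \<epsilon>"
        using approximation[OF E F \<open>\<epsilon> > 0\<close>] .
      have "(\<integral>p. bdot (?U S p) (curl_of D p) \<partial>M) = (\<integral>p. bdot (curl_of (?D S) p) (\<Phi> p) \<partial>M)"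
        by (rule weak_curl_C1[OF C1, unfolded weak_curl_iff, rule_format, OF \<Phi>(1,2) \<Phi>(3)[rule_format]])
      then have "?x = (\<integral>p. bdot (E p - ?U S p) (curl_of D p) \<partial>M) - (\<integral>p. bdot (F p - curl_of (?D S) p) (\<Phi> p) \<partial>M)"
        using E F sq \<Phi>sq by (simp add: bdot_diff_left integrable_bdot)
      also have "norm \<dots> \<le> 3 * (norm2 M (\<lambda>p. E p - ?U S p) * norm2 M (curl_of D)) +
          3 * (norm2 M (\<lambda>p. F p - curl_of (?D S) p) * norm2 M \<Phi>)"
        by (rule order_trans[OF norm_triangle_ineq4 add_mono])
           (intro norm_integral_bdot_le square_integrable_diff E F sq \<Phi>sq)+
      also have "\<dots> \<le> 3 * (\<epsilon> * norm2 M (curl_of D)) + 3 * (\<epsilon> * norm2 M \<Phi>)"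
        using S by (intro add_mono mult_left_mono mult_right_mono) auto
      finally show ?thesis by (simp add: algebra_simps)
    qed
    then have "?x = 0" by (rule norm_le_mult_imp_zero)
    then show "(\<integral>p. bdot (E p) (curl_of D p) \<partial>M) = (\<integral>p. bdot (F p) (\<Phi> p) \<partial>M)" by simp
  qed
  have "\<exists>G\<in>smooth_PEC L a. hcurl_norm L a (\<lambda>p. E p - G p) < \<epsilon>" if \<epsilon>: "\<epsilon> > 0" for \<epsilon>
  proof -
    \<comment> \<open>Halves, because the graph norm is at most the sum of the two L2 norms.\<close>
    obtain S where S: "norm2 M (\<lambda>p. E p - ?U S p) < \<epsilon> / 2" "norm2 M (\<lambda>p. F p - curl_of (?D S) p) < \<epsilon> / 2"
      using approximation[OF E F half_gt_zero[OF \<epsilon>]] .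
    have "norm2 M (wcurl L a (\<lambda>p. E p - ?U S p)) = norm2 M (\<lambda>p. F p - curl_of (?D S) p)"
      using E F sq w weak_curl_C1[OF C1]
      by (intro norm2_wcurl square_integrable_diff weak_curl_diff) auto
    then have "hcurl_norm L a (\<lambda>p. E p - ?U S p) \<le>
        norm2 M (\<lambda>p. E p - ?U S p) + norm2 M (\<lambda>p. F p - curl_of (?D S) p)"
      by (simp add: hcurl_norm_def l2norm_eq sqrt_sum_squares_le_sum)
    with S show ?thesis
      by (intro bexI[OF _ partial_field_smooth_PEC[of "field_coeff x" S]]) simp
  qed
  then have H0: "E \<in> H0_curl L a"
    unfolding H0_curl_def using H_curl_I[OF E(1) F(1) w] by blast
  have "(\<integral>p. bdot (E p) (grad \<phi> p) \<partial>M) = 0" if \<phi>: "test_function L a \<phi>" for \<phi>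
  proof -
    obtain D where D: "C1 \<phi> D" "grad \<phi> = grad_of D" "grad_of D \<in> square_integrable M"
      using grad_test_function[OF \<phi>] .
    have "norm (\<integral>p. bdot (E p) (grad \<phi> p) \<partial>M) \<le> 3 * norm2 M (grad_of D) * \<epsilon>" if "\<epsilon> > 0" for \<epsilon>
    proof -
      obtain S where S: "norm2 M (\<lambda>p. E p - ?U S p) < \<epsilon>" "norm2 M (\<lambda>p. F p - curl_of (?D S) p) < \<epsilon>"
        using approximation[OF E F \<open>\<epsilon> > 0\<close>] .
      have "(\<integral>p. bdot (?U S p) (grad_of D p) \<partial>M) = 0"
        by (subst integral_grad_by_parts[OF C1 D(1) test_function_plates[OF \<phi>]])
           (simp_all add: div_partial_field[OF x])
      then have "(\<integral>p. bdot (E p) (grad \<phi> p) \<partial>M) = (\<integral>p. bdot (E p - ?U S p) (grad_of D p) \<partial>M)"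
        using E sq D by (simp add: bdot_diff_left integrable_bdot)
      also have "norm \<dots> \<le> 3 * (norm2 M (\<lambda>p. E p - ?U S p) * norm2 M (grad_of D))"
        by (intro norm_integral_bdot_le square_integrable_diff E sq D)
      also have "\<dots> \<le> 3 * (\<epsilon> * norm2 M (grad_of D))"
        using S by (intro mult_left_mono mult_right_mono) auto
      finally show ?thesis by (simp add: algebra_simps)
    qed
    then show ?thesis by (rule norm_le_mult_imp_zero)
  qed
  with H0 show "E \<in> V_PEC L a" by (simp add: V_PEC_def weak_div_free_def)
qed

section \<open>Existence of the reconstructed field and the norm of its curl\<close>

lemma vector_square_integrable:
  fixes f g h :: "point \<Rightarrow> complex"
  assumes "f \<in> square_integrable M" "g \<in> square_integrable M" "h \<in> square_integrable M"
  shows "(\<lambda>p. vector [f p, g p, h p] :: complex^3) \<in> square_integrable M"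
proof (rule square_integrable_vec)
  fix j :: 3
  show "(\<lambda>p. (vector [f p, g p, h p] :: complex^3) $ j) \<in> square_integrable M"
    using exhaust_3[of j] assms by auto
qed

lemma curl_field_exists:
  assumes "x \<in> C_PEC L a"
  obtains F where "F \<in> square_integrable M" "curl_expands F (curl_coeff L a x)"
proof -
  obtain \<alpha> \<beta> where x: "x = (\<alpha>, \<beta>)" by (cases x)
  note s = coeff_summable[OF assms[unfolded x], folded x]
  obtain f g h where "f \<in> square_integrable M" "cosines.expands f (\<lambda>i. curl_coeff L a x i $ 1)"
    "g \<in> square_integrable M" "cosines.expands g (\<lambda>i. curl_coeff L a x i $ 2)"
    "h \<in> square_integrable M" "sines.expands h (\<lambda>i. curl_coeff L a x i $ 3)"
    using cosines.expands_exists[OF s(4)] cosines.expands_exists[OF s(5)] sines.expands_exists[OF s(6)] by metis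
  then show ?thesis
    by (intro that[of "\<lambda>p. vector [f p, g p, h p]"]) (simp_all add: vector_square_integrable curl_expands_def)
qed

lemma recon_nonempty:
  assumes "x \<in> C_PEC L a"
  obtains E where "E \<in> recon L a x"
proof -
  obtain \<alpha> \<beta> where x: "x = (\<alpha>, \<beta>)" by (cases x)
  note s = coeff_summable[OF assms[unfolded x], folded x]
  obtain f g h where "f \<in> square_integrable M" "sines.expands f (\<lambda>i. field_coeff x i $ 1)"
    "g \<in> square_integrable M" "sines.expands g (\<lambda>i. field_coeff x i $ 2)"
    "h \<in> square_integrable M" "cosines.expands h (\<lambda>i. field_coeff x i $ 3)"
    using sines.expands_exists[OF s(1)] sines.expands_exists[OF s(2)] cosines.expands_exists[OF s(3)] by metis
  then show ?thesis
    by (intro that[of "\<lambda>p. vector [f p, g p, h p]"])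
       (simp add: recon_iff vector_square_integrable field_expands_def)
qed

lemma recon_V_PEC:
  assumes x: "x \<in> C_PEC L a" and E: "E \<in> recon L a x"
  shows "E \<in> V_PEC L a"
proof -
  obtain F where "F \<in> square_integrable M" "curl_expands F (curl_coeff L a x)"
    using curl_field_exists[OF x] .
  then show ?thesis using reconstructed_field(2)[OF x] E by (simp add: recon_iff)
qed

text \<open>Parseval for the three components of the curl, regrouped by n: for n at least 1 the
  divergence constraint turns the three squares into \<lambda> times the squared coefficients, and
  for n = 0 only \<open>\<beta>\<close> is left.\<close>

lemma wcurl_norm:
  assumes c: "(\<alpha>, \<beta>) \<in> C_PEC L a" and E: "E \<in> recon L a (\<alpha>, \<beta>)"
  shows "(l2norm L a (wcurl L a E))\<^sup>2 =
    (\<Sum>\<^sub>\<infinity>(m, n) \<in> positive_indices. lam L a m n * ((norm (\<alpha> m n))\<^sup>2 + (norm (\<beta> m n))\<^sup>2))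
      + (\<Sum>\<^sub>\<infinity>m. (norm (kvec L m))\<^sup>2 * (norm (\<beta> m 0))\<^sup>2)"
proof -
  let ?c = "\<lambda>j i. (norm (curl_coeff L a (\<alpha>, \<beta>) i $ j))\<^sup>2"
  obtain F where F: "F \<in> square_integrable M" "curl_expands F (curl_coeff L a (\<alpha>, \<beta>))"
    using curl_field_exists[OF c] .
  note s = coeff_summable[OF c]
  have Esq: "E \<in> square_integrable M" "field_expands E (field_coeff (\<alpha>, \<beta>))"
    using E by (auto simp: recon_iff)
  have "(l2norm L a (wcurl L a E))\<^sup>2 = (norm2 M F)\<^sup>2"
    unfolding l2norm_eq norm2_wcurl[OF Esq(1) F(1) reconstructed_field(1)[OF c Esq F]] ..
  also have "\<dots> = infsum (?c 1) UNIV + infsum (?c 2) UNIV + infsum (?c 3) positive_indices"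
    using F(2) cosines.expands_parseval[OF square_integrable_component[OF F(1)]]
      sines.expands_parseval[OF square_integrable_component[OF F(1)]]
    unfolding norm2_vec[OF F(1)] curl_expands_def by (metis infsumI)
  also have "\<dots> = infsum (\<lambda>i. ?c 1 i + ?c 2 i) UNIV + infsum (?c 3) positive_indices"
    using s by (simp add: infsum_add)
  \<comment> \<open>The third component is a sine series without terms at n = 0, so only the first
    two are split.\<close>
  also have "infsum (\<lambda>i. ?c 1 i + ?c 2 i) UNIV =
      infsum (\<lambda>i. ?c 1 i + ?c 2 i) positive_indices + (\<Sum>\<^sub>\<infinity>m. ?c 1 (m, 0) + ?c 2 (m, 0))"
    using summable_on_add[OF s(4,5)]
    by (intro summable_on_index_split(2) summable_on_zero_index)
       (auto intro: summable_on_subset_banach)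
  also have "(\<Sum>\<^sub>\<infinity>m. ?c 1 (m, 0) + ?c 2 (m, 0)) = (\<Sum>\<^sub>\<infinity>m. (norm (kvec L m))\<^sup>2 * (norm (\<beta> m 0))\<^sup>2)"
    by (simp only: curl_coeff_norm_0[OF c])
  also have "infsum (\<lambda>i. ?c 1 i + ?c 2 i) positive_indices + (\<Sum>\<^sub>\<infinity>m. (norm (kvec L m))\<^sup>2 * (norm (\<beta> m 0))\<^sup>2)
      + infsum (?c 3) positive_indices =
      infsum (\<lambda>i. ?c 1 i + ?c 2 i + ?c 3 i) positive_indices + (\<Sum>\<^sub>\<infinity>m. (norm (kvec L m))\<^sup>2 * (norm (\<beta> m 0))\<^sup>2)"
    using summable_on_subset_banach[OF summable_on_add[OF s(4,5)] subset_UNIV] s(6)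
    by (subst (2) infsum_add) auto
  also have "infsum (\<lambda>i. ?c 1 i + ?c 2 i + ?c 3 i) positive_indices =
      (\<Sum>\<^sub>\<infinity>(m, n) \<in> positive_indices. lam L a m n * ((norm (\<alpha> m n))\<^sup>2 + (norm (\<beta> m n))\<^sup>2))"
    using curl_coeff_norm[OF c] by (intro infsum_cong) auto
  finally show ?thesis .
qed

section \<open>From fields to coefficients\<close>

lemma kvec_minus: "kvec L (- m) = - kvec L m"
  by (simp add: kvec_def prod_eq_iff)

text \<open>The coefficients are the inner products with the modes. The divergence test gives the
  constraint, the curl test identifies the coefficients of the weak curl with
  \<open>curl_coeff\<close>, and Parseval for the field and its curl together gives summability with
  weight 1 + \<lambda>.\<close>

lemma V_PEC_recon:
  assumes E: "E \<in> V_PEC L a"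
  obtains x where "x \<in> C_PEC L a" "E \<in> recon L a x"
proof -
  have H0: "E \<in> H0_curl L a" and div: "weak_div_free L a E" using E by (auto simp: V_PEC_def)
  then have EH: "E \<in> H_curl L a" by (simp add: H0_curl_def)
  then have Esq: "E \<in> square_integrable M" by (simp add: H_curl_def L2_eq)
  define W where "W = wcurl L a E"
  have W: "W \<in> square_integrable M" unfolding W_def by (rule wcurl(1)[OF EH])
  define \<alpha> :: "int \<times> int \<Rightarrow> nat \<Rightarrow> complex^2" where
    "\<alpha> m n = vector [inner2 M (\<lambda>p. E p $ 1) (sine_mode L a (m, n)), inner2 M (\<lambda>p. E p $ 2) (sine_mode L a (m, n))]" for m n
  define \<beta> where "\<beta> m n = inner2 M (\<lambda>p. E p $ 3) (cosine_mode L a (m, n))" for m n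
  note Ej = square_integrable_component[OF Esq]
  have ssq: "sine_mode L a i \<in> square_integrable M" "cosine_mode L a i \<in> square_integrable M" for i
    using square_integrable_C1[OF C1_sine_mode] square_integrable_C1[OF C1_cosine_mode] by auto
  \<comment> \<open>Inner products carry a conjugate, so the bilinear test integrals use modes with
    \<open>- m\<close>; this flips the sign of \<open>kvec\<close> in the computations
    below.\<close>
  have coef: "(\<integral>p. E p $ 1 * sine_mode L a (- m, n) p \<partial>M) = \<alpha> m n $ 1"
    "(\<integral>p. E p $ 2 * sine_mode L a (- m, n) p \<partial>M) = \<alpha> m n $ 2"
    "(\<integral>p. E p $ 3 * cosine_mode L a (- m, n) p \<partial>M) = \<beta> m n" for m n
    by (simp_all add: \<alpha>_def \<beta>_def inner2_def cnj_sine_mode cnj_cosine_mode)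
  have int: "integrable M (\<lambda>p. E p $ j * sine_mode L a i p)" "integrable M (\<lambda>p. E p $ j * cosine_mode L a i p)" for i j
    by (intro square_integrable_mult Ej ssq)+
  \<comment> \<open>This covers every n, being trivial at n = 0 where the sine modes and
    \<open>nu\<close> vanish, so \<open>curl_symbol_norm\<close> applies without a case
    distinction.\<close>
  have div0: "\<i> * (complex_of_real (fst (kvec L m)) * \<alpha> m n $ 1 + complex_of_real (snd (kvec L m)) * \<alpha> m n $ 2)
        - complex_of_real (nu a n) * \<beta> m n = 0" for m n
  proof -
    have "bdot (E p) (grad_of (dsine L a (- m, n)) p) =
        - (\<i> * complex_of_real (fst (kvec L m))) * (E p $ 1 * sine_mode L a (- m, n) p)
        + - (\<i> * complex_of_real (snd (kvec L m))) * (E p $ 2 * sine_mode L a (- m, n) p)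
        + complex_of_real (nu a n) * (E p $ 3 * cosine_mode L a (- m, n) p)" for p
      by (simp add: bdot_3 grad_of_def dsine_def kvec_minus algebra_simps)
    then have "(\<integral>p. bdot (E p) (grad_of (dsine L a (- m, n)) p) \<partial>M) =
        - (\<i> * complex_of_real (fst (kvec L m))) * \<alpha> m n $ 1
        + - (\<i> * complex_of_real (snd (kvec L m))) * \<alpha> m n $ 2
        + complex_of_real (nu a n) * \<beta> m n"
      by (simp only: Bochner_Integration.integral_add integrable_mult_right int integral_mult_right_zero coef
          Bochner_Integration.integrable_add)
    with weak_div_test[OF Esq div, of "(- m, n)"] show ?thesis by (simp add: algebra_simps)
  qed
  have axis: "bdot v (axis j w) = v $ j * w" for v :: "complex^3" and j w
    unfolding bdot_def by (simp add: axis_def if_distrib cong: if_cong)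
  \<comment> \<open>Cosine modes do not vanish on the plates. That they may be used for testing here
    is the PEC condition on the field, through \<open>H0_curl_test\<close>.\<close>
  have W12: "inner2 M (\<lambda>p. W p $ 1) (cosine_mode L a (m, n)) = curl_coeff L a (\<alpha>, \<beta>) (m, n) $ 1"
    "inner2 M (\<lambda>p. W p $ 2) (cosine_mode L a (m, n)) = curl_coeff L a (\<alpha>, \<beta>) (m, n) $ 2" for m n
  proof -
    have t: "inner2 M (\<lambda>p. W p $ j) (cosine_mode L a (m, n)) =
        (\<integral>p. bdot (E p) (curl_of (\<lambda>h p. axis j (dcosine L a (- m, n) h p)) p) \<partial>M)" for j
      using H0_curl_test[OF H0 C1_axis[OF C1_cosine_mode], of j "(- m, n)"]
      by (simp add: axis inner2_def cnj_cosine_mode W_def)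
    have "bdot (E p) (curl_of (\<lambda>h p. axis 1 (dcosine L a (- m, n) h p)) p) =
        - complex_of_real (nu a n) * (E p $ 2 * sine_mode L a (- m, n) p)
        + \<i> * complex_of_real (snd (kvec L m)) * (E p $ 3 * cosine_mode L a (- m, n) p)" for p
      by (simp add: bdot_3 curl_of_def axis_def dcosine_def kvec_minus algebra_simps)
    then show "inner2 M (\<lambda>p. W p $ 1) (cosine_mode L a (m, n)) = curl_coeff L a (\<alpha>, \<beta>) (m, n) $ 1"
      unfolding t
      by (simp only: Bochner_Integration.integral_add integrable_mult_right int integral_mult_right_zero coef)
         (simp add: curl_coeff_def)
    have "bdot (E p) (curl_of (\<lambda>h p. axis 2 (dcosine L a (- m, n) h p)) p) =
        complex_of_real (nu a n) * (E p $ 1 * sine_mode L a (- m, n) p)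
        + - (\<i> * complex_of_real (fst (kvec L m))) * (E p $ 3 * cosine_mode L a (- m, n) p)" for p
      by (simp add: bdot_3 curl_of_def axis_def dcosine_def kvec_minus algebra_simps)
    then show "inner2 M (\<lambda>p. W p $ 2) (cosine_mode L a (m, n)) = curl_coeff L a (\<alpha>, \<beta>) (m, n) $ 2"
      unfolding t
      by (simp only: Bochner_Integration.integral_add integrable_mult_right int integral_mult_right_zero coef)
         (simp add: curl_coeff_def)
  qed
  have W3: "inner2 M (\<lambda>p. W p $ 3) (sine_mode L a (m, n)) = curl_coeff L a (\<alpha>, \<beta>) (m, n) $ 3" for m n
  proof -
    have t: "inner2 M (\<lambda>p. W p $ 3) (sine_mode L a (m, n)) =
        (\<integral>p. bdot (E p) (curl_of (\<lambda>h p. axis 3 (dsine L a (- m, n) h p)) p) \<partial>M)"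
      using H0_curl_test[OF H0 C1_axis[OF C1_sine_mode], of 3 "(- m, n)"]
      by (simp add: axis inner2_def cnj_sine_mode W_def)
    have "bdot (E p) (curl_of (\<lambda>h p. axis 3 (dsine L a (- m, n) h p)) p) =
        - (\<i> * complex_of_real (snd (kvec L m))) * (E p $ 1 * sine_mode L a (- m, n) p)
        + \<i> * complex_of_real (fst (kvec L m)) * (E p $ 2 * sine_mode L a (- m, n) p)" for p
      by (simp add: bdot_3 curl_of_def axis_def dsine_def kvec_minus algebra_simps)
    then show ?thesis
      unfolding t
      by (simp only: Bochner_Integration.integral_add integrable_mult_right int integral_mult_right_zero coef)
         (simp add: curl_coeff_def)
  qed
  have fc: "field_coeff (\<alpha>, \<beta>) i $ 1 = inner2 M (\<lambda>p. E p $ 1) (sine_mode L a i)"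
    "field_coeff (\<alpha>, \<beta>) i $ 2 = inner2 M (\<lambda>p. E p $ 2) (sine_mode L a i)"
    "field_coeff (\<alpha>, \<beta>) i $ 3 = inner2 M (\<lambda>p. E p $ 3) (cosine_mode L a i)" for i
    by (cases i, simp add: field_coeff_def \<alpha>_def \<beta>_def)+
  have cc: "curl_coeff L a (\<alpha>, \<beta>) i $ 1 = inner2 M (\<lambda>p. W p $ 1) (cosine_mode L a i)"
    "curl_coeff L a (\<alpha>, \<beta>) i $ 2 = inner2 M (\<lambda>p. W p $ 2) (cosine_mode L a i)"
    "curl_coeff L a (\<alpha>, \<beta>) i $ 3 = inner2 M (\<lambda>p. W p $ 3) (sine_mode L a i)" for i
    by (cases i, simp add: W12 W3)+
  have sine_sum: "(\<lambda>i. (norm (inner2 M f (sine_mode L a i)))\<^sup>2) summable_on positive_indices"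
    and cosine_sum: "(\<lambda>i. (norm (inner2 M f (cosine_mode L a i)))\<^sup>2) summable_on UNIV"
    if "f \<in> square_integrable M" for f
    using sines.expands_parseval[OF that sines.expands_inner2[OF that]]
      cosines.expands_parseval[OF that cosines.expands_inner2[OF that]]
    by (auto simp: summable_on_def)
  have cosine_sum': "(\<lambda>i. (norm (inner2 M f (cosine_mode L a i)))\<^sup>2) summable_on positive_indices"
    if "f \<in> square_integrable M" for f
    using cosine_sum[OF that] by (rule summable_on_subset_banach) simp
  note Wj = square_integrable_component[OF W]
  \<comment> \<open>Six summable series are added: the squares of the field coefficients supply the
    1 in the weight, those of the curl coefficients the \<lambda>.\<close>
  have "(\<lambda>i. (norm (field_coeff (\<alpha>, \<beta>) i $ 1))\<^sup>2 + (norm (field_coeff (\<alpha>, \<beta>) i $ 2))\<^sup>2 + (norm (field_coeff (\<alpha>, \<beta>) i $ 3))\<^sup>2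
      + ((norm (curl_coeff L a (\<alpha>, \<beta>) i $ 1))\<^sup>2 + (norm (curl_coeff L a (\<alpha>, \<beta>) i $ 2))\<^sup>2 + (norm (curl_coeff L a (\<alpha>, \<beta>) i $ 3))\<^sup>2))
      summable_on positive_indices"
    unfolding fc cc by (intro summable_on_add sine_sum cosine_sum' Ej Wj)
  also have "?this \<longleftrightarrow> (\<lambda>(m, n). (1 + lam L a m n) * ((norm (\<alpha> m n))\<^sup>2 + (norm (\<beta> m n))\<^sup>2)) summable_on positive_indices"
  proof (rule summable_on_cong)
    fix i :: index
    obtain m n where i: "i = (m, n)" by (cases i)
    show "(norm (field_coeff (\<alpha>, \<beta>) i $ 1))\<^sup>2 + (norm (field_coeff (\<alpha>, \<beta>) i $ 2))\<^sup>2 + (norm (field_coeff (\<alpha>, \<beta>) i $ 3))\<^sup>2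
      + ((norm (curl_coeff L a (\<alpha>, \<beta>) i $ 1))\<^sup>2 + (norm (curl_coeff L a (\<alpha>, \<beta>) i $ 2))\<^sup>2 + (norm (curl_coeff L a (\<alpha>, \<beta>) i $ 3))\<^sup>2)
      = (case i of (m, n) \<Rightarrow> (1 + lam L a m n) * ((norm (\<alpha> m n))\<^sup>2 + (norm (\<beta> m n))\<^sup>2))"
      using curl_symbol_norm[OF div0[of m n]]
      by (simp add: i curl_coeff_def field_coeff_def lam_def norm_kvec_sq norm_vec2 algebra_simps)
  qed
  finally have s1: "(\<lambda>(m, n). (1 + lam L a m n) * ((norm (\<alpha> m n))\<^sup>2 + (norm (\<beta> m n))\<^sup>2)) summable_on positive_indices" .
  have \<alpha>0: "\<alpha> m 0 = 0" for m
    by (simp add: \<alpha>_def inner2_def vec_eq_iff forall_2)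
  have "(\<lambda>m. (norm (field_coeff (\<alpha>, \<beta>) (m, 0) $ 3))\<^sup>2 + ((norm (curl_coeff L a (\<alpha>, \<beta>) (m, 0) $ 1))\<^sup>2
      + (norm (curl_coeff L a (\<alpha>, \<beta>) (m, 0) $ 2))\<^sup>2)) summable_on UNIV"
    unfolding fc cc by (intro summable_on_add summable_on_zero_index[OF cosine_sum] Ej Wj)
  also have "?this \<longleftrightarrow> (\<lambda>m. (1 + (norm (kvec L m))\<^sup>2) * (norm (\<beta> m 0))\<^sup>2) summable_on UNIV"
    by (rule summable_on_cong)
       (simp add: curl_coeff_def field_coeff_def norm_kvec_sq norm_mult power_mult_distrib algebra_simps)
  finally have s2: "(\<lambda>m. (1 + (norm (kvec L m))\<^sup>2) * (norm (\<beta> m 0))\<^sup>2) summable_on UNIV" .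
  show ?thesis
  proof
    show "(\<alpha>, \<beta>) \<in> C_PEC L a"
      unfolding C_PEC_def using \<alpha>0 s1 s2 div0 by blast
    show "E \<in> recon L a (\<alpha>, \<beta>)"
      unfolding recon_iff field_expands_def fc
      by (intro conjI Esq sines.expands_inner2 cosines.expands_inner2 Ej)
  qed
qed

text \<open>\<open>h0\<close> is the cosine mode of index zero in the third component, so
  orthogonality to its span is the vanishing of one coefficient. Membership in \<open>H_PEC\<close>
  is automatic, since a field in \<open>V_PEC\<close> approximates itself.\<close>

lemma recon_V_phys_iff:
  assumes x: "(\<alpha>, \<beta>) \<in> C_PEC L a" and E: "E \<in> recon L a (\<alpha>, \<beta>)"
  shows "E \<in> V_phys L a \<longleftrightarrow> \<beta> (0, 0) 0 = 0"
proof -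
  have V: "E \<in> V_PEC L a" by (rule recon_V_PEC[OF x E])
  have Esq: "E \<in> square_integrable M" "field_expands E (field_coeff (\<alpha>, \<beta>))" using E by (auto simp: recon_iff)
  have "E \<in> H_PEC L a"
    unfolding H_PEC_def using Esq(1) V
    by (auto simp: L2_eq l2norm_def intro!: bexI[of _ E])
  moreover have "l2inner L a E (\<lambda>p. c *s h0 L a p) = cnj c * \<beta> (0, 0) 0" for c
  proof -
    have h: "cosine_mode L a ((0, 0), 0) p = complex_of_real (1 / sqrt (L\<^sup>2 * a))" for p
      using L by (simp add: cosine_mode_def phi_wave wave_def kvec_def inner_prod_def cmode_def real_sqrt_mult)
    have "(\<Sum>j\<in>UNIV. E p $ j * cnj ((c *s h0 L a p) $ j)) = cnj c * (E p $ 3 * cnj (cosine_mode L a ((0, 0), 0) p))" for p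
      unfolding h by (simp add: sum_3 h0_def)
    then have "l2inner L a E (\<lambda>p. c *s h0 L a p) = cnj c * inner2 M (\<lambda>p. E p $ 3) (cosine_mode L a ((0, 0), 0))"
      unfolding l2inner_def inner2_def by simp
    also have "inner2 M (\<lambda>p. E p $ 3) (cosine_mode L a ((0, 0), 0)) = field_coeff (\<alpha>, \<beta>) ((0, 0), 0) $ 3"
      using cosines.expands_coeff[OF square_integrable_component[OF Esq(1)], of 3] Esq(2)
      unfolding field_expands_def by (metis UNIV_I)
    finally show ?thesis by (simp add: field_coeff_def)
  qed
  ultimately show ?thesis
    using V by (auto simp: V_phys_def H_phys_def dest: spec[of _ 1])
qed

text \<open>Both bijections are instances. The values of \<open>recon\<close> are full classes, so
  surjectivity onto the quotient follows once every field in \<open>V\<close> has coefficients, and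
  the equivalence in the hypothesis places these in \<open>C\<close>.\<close>

lemma recon_bij_betw:
  assumes C: "C \<subseteq> C_PEC L a"
    and V: "\<And>x E. x \<in> C_PEC L a \<Longrightarrow> E \<in> recon L a x \<Longrightarrow> E \<in> V \<longleftrightarrow> x \<in> C" "V \<subseteq> V_PEC L a"
  shows "bij_betw (recon L a) C (V // ae_eq L a)"
  unfolding bij_betw_def
proof
  show "inj_on (recon L a) C"
  proof (rule inj_onI)
    fix x y assume xy: "x \<in> C" "y \<in> C" "recon L a x = recon L a y"
    obtain E where "E \<in> recon L a x" using recon_nonempty xy(1) C by blast
    with xy C show "x = y" by (intro recon_inj[of x y E]) auto
  qed
  show "recon L a ` C = V // ae_eq L a"
  proof (intro set_eqI iffI)
    fix Y assume "Y \<in> recon L a ` C"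
    then obtain x where x: "x \<in> C" "Y = recon L a x" by blast
    obtain E where E: "E \<in> recon L a x" using recon_nonempty x(1) C by blast
    with x C V(1) have "E \<in> V" by blast
    then show "Y \<in> V // ae_eq L a" unfolding x(2) recon_class[OF E] by (rule quotientI)
  next
    fix Y assume "Y \<in> V // ae_eq L a"
    then obtain E where E: "E \<in> V" "Y = ae_eq L a `` {E}" by (rule quotientE)
    obtain x where x: "x \<in> C_PEC L a" "E \<in> recon L a x" using V_PEC_recon E(1) V(2) by blast
    with E V(1) have "x \<in> C" by blast
    then show "Y \<in> recon L a ` C" unfolding E(2) recon_class[OF x(2), symmetric] by (rule imageI)
  qed
qed

end

theorem lemma3p1:
  fixes L a :: real
  assumes "L > 0" and "a > 0"
  shows "bij_betw (recon L a) (C_PEC L a) (V_PEC L a // ae_eq L a) \<and>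
    (\<forall>(\<alpha>, \<beta>) \<in> C_PEC L a. \<forall>E \<in> recon L a (\<alpha>, \<beta>).
       (l2norm L a (wcurl L a E))\<^sup>2 =
         (\<Sum>\<^sub>\<infinity>(m, n) \<in> UNIV \<times> {1..}. lam L a m n * ((norm (\<alpha> m n))\<^sup>2 + (norm (\<beta> m n))\<^sup>2))
         + (\<Sum>\<^sub>\<infinity>m. (norm (kvec L m))\<^sup>2 * (norm (\<beta> m 0))\<^sup>2)) \<and>
    bij_betw (recon L a) (C_phys L a) (V_phys L a // ae_eq L a)"
proof -
  interpret slab L a using assms by unfold_locales
  have "bij_betw (recon L a) (C_PEC L a) (V_PEC L a // ae_eq L a)"
    using recon_V_PEC by (intro recon_bij_betw) auto
  moreover have "bij_betw (recon L a) (C_phys L a) (V_phys L a // ae_eq L a)"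
  proof (rule recon_bij_betw)
    show "C_phys L a \<subseteq> C_PEC L a" "V_phys L a \<subseteq> V_PEC L a"
      by (auto simp: C_phys_def V_phys_def)
    show "E \<in> V_phys L a \<longleftrightarrow> x \<in> C_phys L a" if "x \<in> C_PEC L a" "E \<in> recon L a x" for x E
      using that recon_V_phys_iff by (cases x) (auto simp: C_phys_def)
  qed
  ultimately show ?thesis using wcurl_norm by blast
qed

end
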